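(* Let $k\ge 3$ and let $\widehat{F}$ be a pattern of $K_k$ with exactly two classes, one of which (viewed as a graph formed by its edges) is a graph $J$ with Ramsey number $R(J,J)\le k$. Then for $n$ sufficiently large, the number of $3$-edge-colorings avoiding $\widehat{F}$ is maximized, among all graphs on $n$ vertices, by the Turán graph $T_{k-1}(n)$; that is, $c_{3,\widehat{F}}(T_{k-1}(n))=c_{3,\widehat{F}}(n)$.
   Context: All graphs are finite and simple. A pattern of $K_k$ is a partition of $E(K_k)$ into classes; it can be realized as a coloring of $K_k$ with one color per class. A $3$-edge-coloring of a graph $G$ assigns one of $3$ colors to each edge (not necessarily properly). A copy of $\widehat{F}$ in such a coloring is a set of $k$ pairwise adjacent vertices admitting a bijection to $V(K_k)$ under which two edges have the same color in $G$ iff their images lie in the same class of $\widehat{F}$. A coloring avoids $\widehat{F}$ if it contains no copy. $c_{3,\widehat{F}}(G)$ is the number of $3$-edge-colorings of $G$ avoiding $\widehat{F}$, and $c_{3,\widehat{F}}(n)$ its maximum over all $n$-vertex graphs. $R(J,J)$ is the least $\ell$ such that every $2$-edge-coloring of $K_\ell$ contains a monochromatic copy of $J$. $T_{k-1}(n)$ is the complete $(k-1)$-partite graph on $n$ vertices with parts of sizes as equal as possible. *)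

theory Defs
  imports Main "HOL-Library.FuncSet" "HOL-Library.Disjoint_Sets"
begin

definition Kedges :: "nat set \<Rightarrow> nat set set" where
  "Kedges V = {e. e \<subseteq> V \<and> card e = 2}"

definition graph_on :: "nat \<Rightarrow> nat set set \<Rightarrow> bool" where
  "graph_on n E \<longleftrightarrow> E \<subseteq> Kedges {..<n}"

definition is_pattern :: "nat \<Rightarrow> nat set set set \<Rightarrow> bool" where
  "is_pattern k P \<longleftrightarrow> partition_on (Kedges {..<k}) P"

definition has_pattern_copy ::
  "nat \<Rightarrow> nat set set set \<Rightarrow> nat set set \<Rightarrow> (nat set \<Rightarrow> nat) \<Rightarrow> bool" where
  "has_pattern_copy k P E c \<longleftrightarrow>
     (\<exists>g. inj_on g {..<k} \<and>
          (\<forall>e\<in>Kedges {..<k}. g ` e \<in> E) \<and>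
          (\<forall>e\<in>Kedges {..<k}. \<forall>e'\<in>Kedges {..<k}.
              (c (g ` e) = c (g ` e')) \<longleftrightarrow> (\<exists>C\<in>P. e \<in> C \<and> e' \<in> C)))"

definition avoiding_colorings ::
  "nat \<Rightarrow> nat \<Rightarrow> nat set set set \<Rightarrow> nat set set \<Rightarrow> (nat set \<Rightarrow> nat) set" where
  "avoiding_colorings r k P E = {c \<in> E \<rightarrow>\<^sub>E {..<r}. \<not> has_pattern_copy k P E c}"

definition c_count :: "nat \<Rightarrow> nat \<Rightarrow> nat set set set \<Rightarrow> nat set set \<Rightarrow> nat" where
  "c_count r k P E = card (avoiding_colorings r k P E)"

definition c_max :: "nat \<Rightarrow> nat \<Rightarrow> nat set set set \<Rightarrow> nat \<Rightarrow> nat" where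
  "c_max r k P n = Max {c_count r k P E | E. graph_on n E}"

text \<open>Turan graph T_m(n): vertices {..<n}, parts given by residues mod m
(part sizes differ by at most one), edges between different parts.\<close>
definition turan_edges :: "nat \<Rightarrow> nat \<Rightarrow> nat set set" where
  "turan_edges m n = {e \<in> Kedges {..<n}. \<forall>u\<in>e. \<forall>v\<in>e. u \<noteq> v \<longrightarrow> u mod m \<noteq> v mod m}"

definition has_mono_copy :: "nat set set \<Rightarrow> nat \<Rightarrow> (nat set \<Rightarrow> bool) \<Rightarrow> bool" where
  "has_mono_copy J l c \<longleftrightarrow>
     (\<exists>f col. inj_on f (\<Union>J) \<and> f ` (\<Union>J) \<subseteq> {..<l} \<and> (\<forall>e\<in>J. c (f ` e) = col))"

definition ramsey_number :: "nat set set \<Rightarrow> nat" where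
  "ramsey_number J = (LEAST l. \<forall>c :: nat set \<Rightarrow> bool. has_mono_copy J l c)"

end

theory Submission
  imports Defs Complex_Main "HOL-Library.Ramsey"
begin

text \<open>
  Suppose that the edges of a complete graph on \<open>k\<close> vertices carry lists of allowed colours. Since
  \<open>R(J, J) \<le> k\<close>, the pattern can be coloured from the lists if one colour lies in all lists and all lists
  have size at least two; it can also be coloured if all lists are full except for one nonempty list,
  or except for a star whose lists share a colour.

  Weak regularity replaces a colouring by one of \<open>2 ^ O(n)\<close> models, which assign to every edge the list
  of colours that are not rare there. For every colour the edges whose list has size at least two and
  contains that colour almost form a graph without complete subgraphs on \<open>k\<close> vertices, so
  \<open>2 e\<^sub>2 + 3 e\<^sub>3\<close> is at most about three Turan numbers, while the model accounts for about
  \<open>2 ^ e\<^sub>2 * 3 ^ e\<^sub>3\<close> colourings. As \<open>2 ^ 3 < 3 ^ 2\<close>, a graph with more colourings than the Turan graph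
  has almost all lists full, and stability yields a partition into \<open>k - 1\<close> classes with few edges inside
  the classes.

  Take a partition with the fewest edges inside the classes. All but very few colourings are
  quasirandom between the classes. If some vertex has many neighbours in every class, then in such a
  colouring its colour lists towards the classes have no common colour, which leaves at most about
  \<open>(8/27 * 3 ^ (k - 1)) ^ (n / (k - 1))\<close> ways to colour its star; this is less than the Turan graph gains
  from one vertex because \<open>8/27 < 1/3\<close>. Otherwise, for an edge \<open>uv\<close> inside a class, some pair of colours
  is rare among the pairs of edges from \<open>u\<close> and \<open>v\<close> to some other class. In both cases removing one or two
  vertices at least triples the ratio between the number of colourings and the one for the Turan graph.
  Iterating this would make the ratio too large on a bounded number of vertices.
\<close>

section \<open>Colour lists on a complete graph that force the pattern\<close>

text \<open>The obstacle is exactness. Counting through models is sharp only up to a factor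
  \<open>3 ^ (g * n ^ 2)\<close>, so by itself it can only locate a nearly multipartite structure.
  What makes the answer exact is that more than \<open>3 ^ tur m n\<close> colourings require more
  than \<open>tur m n\<close> edges: whatever the partition, some edge then lies inside a class.
  Such an edge, or a vertex with many neighbours in every class, costs a factor of about
  \<open>(8/9) ^ (n/m)\<close> against the Turan graph, and all error terms are tuned to fit into
  this one gap.

  Weak regularity is strong enough because only families of order \<open>n ^ k\<close> of
  \<open>k\<close>-tuples have to be counted, and because its models are far fewer than the
  colourings.

  The Ramsey hypothesis enters at two places: for lists with a common colour, and to find a vertex
  of the pattern whose edges all lie in one class. A single restricted edge can always be
  accommodated.\<close>

lemma finite_Kedges: "finite V \<Longrightarrow> finite (Kedges V)"
  unfolding Kedges_def by (rule finite_subset[of _ "Pow V"]) auto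

lemma Kedges_pair [simp]: "{x, y} \<in> Kedges V \<longleftrightarrow> x \<in> V \<and> y \<in> V \<and> x \<noteq> y"
  unfolding Kedges_def by (cases "x = y") auto

lemma Kedges_E:
  assumes "e \<in> Kedges V"
  obtains x y where "e = {x, y}" "x \<in> V" "y \<in> V" "x \<noteq> y"
  using assms unfolding Kedges_def by (auto simp: card_2_iff)

lemma Kedges_image:
  assumes "inj_on g V" "g ` V \<subseteq> W" "e \<in> Kedges V"
  shows "g ` e \<in> Kedges W"
  using assms unfolding Kedges_def
  by (auto simp: card_image inj_on_subset)

text \<open>\<open>ramsey_number\<close> is a \<open>LEAST\<close>, so its defining property is
  available only once some number has it. Ramsey's theorem for cliques on
  \<open>card (\<Union>J)\<close> vertices gives one, as any bijection onto a homogeneous set places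
  \<open>J\<close>. Enlarging the host to \<open>k\<close> keeps the copy.\<close>

lemma ramsey_number_mono_copy:
  assumes "J \<subseteq> Kedges {..<l}" and "ramsey_number J \<le> k"
  shows "has_mono_copy J k c"
proof -
  have fin: "finite (\<Union>J)"
    using assms(1) by (intro finite_subset[of "\<Union>J" "{..<l}"]) (auto simp: Kedges_def)
  obtain r where r: "\<forall>(V :: nat set) E. finite V \<and> card V \<ge> r \<longrightarrow>
      (\<exists>R\<subseteq>V. card R = card (\<Union>J) \<and> clique R E \<or> card R = card (\<Union>J) \<and> indep R E)"
    using ramsey2[of "card (\<Union>J)" "card (\<Union>J)"] by metis
  have "has_mono_copy J r c" for c
  proof -
    obtain R where R: "R \<subseteq> {..<r}" "card R = card (\<Union>J)" "clique R {e. c e} \<or> indep R {e. c e}"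
      using r[rule_format, of "{..<r}" "{e. c e}"] by auto
    obtain f where f: "bij_betw f (\<Union>J) R"
      using finite_same_card_bij[OF fin finite_subset[OF R(1)]] R(2)[symmetric] by blast
    have "\<exists>col. \<forall>e\<in>J. c (f ` e) = col"
    proof -
      have *: "\<exists>x y. f ` e = {x, y} \<and> x \<in> R \<and> y \<in> R \<and> x \<noteq> y" if "e \<in> J" for e
      proof -
        have "e \<in> Kedges {..<l}" using that assms(1) by (rule subsetD[rotated])
        then obtain x y where e: "e = {x, y}" "x \<noteq> y" by (rule Kedges_E)
        then have "x \<in> \<Union>J" "y \<in> \<Union>J" using that by auto
        then have "f x \<in> R" "f y \<in> R" "f x \<noteq> f y"
          using f e by (auto simp: bij_betw_def inj_on_eq_iff[of f "\<Union>J" x y])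
        then show ?thesis unfolding e by auto
      qed
      from R(3) show ?thesis
      proof
        assume "clique R {e. c e}"
        then have "c (f ` e)" if "e \<in> J" for e using *[OF that] unfolding clique_def by auto
        then show ?thesis by blast
      next
        assume "indep R {e. c e}"
        then have "\<not> c (f ` e)" if "e \<in> J" for e using *[OF that] unfolding indep_def by auto
        then show ?thesis by blast
      qed
    qed
    then show ?thesis using f R(1) unfolding has_mono_copy_def bij_betw_def by blast
  qed
  then have "\<forall>c. has_mono_copy J (ramsey_number J) c"
    unfolding ramsey_number_def by (intro LeastI[of "\<lambda>l. \<forall>c. has_mono_copy J l c" r]) blast
  then have "has_mono_copy J (ramsey_number J) c" by blast
  then show ?thesis using assms(2) unfolding has_mono_copy_def
    by (meson order_trans lessThan_subset_iff)
qed

lemma inj_on_extend_permutation: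
  assumes "finite A" "B \<subseteq> A" "inj_on f B" "f ` B \<subseteq> A"
  obtains s where "bij_betw s A A" "\<And>x. x \<in> B \<Longrightarrow> s x = f x"
proof -
  have "card (A - B) = card (A - f ` B)"
    using assms by (simp add: card_Diff_subset finite_subset card_image)
  then obtain g where g: "bij_betw g (A - B) (A - f ` B)"
    using finite_same_card_bij assms(1) by (meson finite_Diff)
  let ?s = "\<lambda>x. if x \<in> B then f x else g x"
  have "bij_betw ?s B (f ` B)" using assms(3)
    by (intro bij_betw_cong[THEN iffD1, OF _ inj_on_imp_bij_betw]) auto
  moreover have "bij_betw ?s (A - B) (A - f ` B)"
    by (rule bij_betw_cong[THEN iffD1, OF _ g]) auto
  ultimately have "bij_betw ?s (B \<union> (A - B)) (f ` B \<union> (A - f ` B))"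
    by (rule bij_betw_combine) auto
  moreover have "B \<union> (A - B) = A" "f ` B \<union> (A - f ` B) = A" using assms by auto
  ultimately show ?thesis using that[of ?s] by simp
qed

locale two_class_pattern =
  fixes k :: nat and P :: "nat set set set" and J :: "nat set set"
  assumes k3: "k \<ge> 3"
    and pat: "is_pattern k P"
    and cardP: "card P = 2"
    and JP: "J \<in> P"
    and ram: "ramsey_number J \<le> k"
begin

lemma P_eq: "P = {J, Kedges {..<k} - J}"
proof -
  obtain J' where J': "P = {J, J'}" "J \<noteq> J'"
    using cardP JP by (auto simp: card_2_iff doubleton_eq_iff)
  have "\<Union>P = Kedges {..<k}" "disjoint P"
    using pat unfolding is_pattern_def partition_on_def by auto
  then have "J \<union> J' = Kedges {..<k}" "J \<inter> J' = {}"
    using J' by (auto simp: disjoint_def)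
  then show ?thesis using J' by auto
qed

lemma J_sub: "J \<subseteq> Kedges {..<k}" and J_ne: "J \<noteq> {}"
  using pat JP unfolding is_pattern_def partition_on_def by auto

lemma mono_copy: "has_mono_copy J k c"
  using ramsey_number_mono_copy[OF J_sub ram] .

abbreviation "KK \<equiv> Kedges {..<k}"

definition realizes :: "(nat set \<Rightarrow> nat) \<Rightarrow> bool" where
  "realizes col \<longleftrightarrow> has_pattern_copy k P KK col"

text \<open>The copy is a composition of two embeddings: \<open>g\<close> places the pattern inside
  the coloured \<open>KK\<close>, and \<open>x\<close> carries this complete graph into the
  host.\<close>

lemma realizes_copy:
  assumes "realizes col" "inj_on x {..<k}" "\<And>e. e \<in> KK \<Longrightarrow> x ` e \<in> E \<and> c (x ` e) = col e"
  shows "has_pattern_copy k P E c"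
proof -
  obtain g where g: "inj_on g {..<k}" "\<And>e. e \<in> KK \<Longrightarrow> g ` e \<in> KK"
    "\<And>e e'. e \<in> KK \<Longrightarrow> e' \<in> KK \<Longrightarrow> (col (g ` e) = col (g ` e')) = (\<exists>C\<in>P. e \<in> C \<and> e' \<in> C)"
    using assms(1) unfolding realizes_def has_pattern_copy_def by blast
  \<comment> \<open>\<open>g\<close> is only known to map edges to edges; every vertex of
    \<open>KK\<close> lies on an edge, which brings its image into \<open>{..<k}\<close>.\<close>
  have gk: "g ` {..<k} \<subseteq> {..<k}"
  proof (intro image_subsetI)
    fix i assume i: "i \<in> {..<k}"
    obtain j where j: "j \<in> {..<k}" "j \<noteq> i" using k3
      by (metis i lessThan_iff less_le_trans numeral_3_eq_3 zero_less_Suc less_Suc_eq nat_neq_iff)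
    show "g i \<in> {..<k}" using g(2)[of "{i, j}"] i j by simp
  qed
  have "inj_on (x \<circ> g) {..<k}" using g(1) gk assms(2) by (meson comp_inj_on inj_on_subset)
  then show ?thesis unfolding has_pattern_copy_def
    using g assms(3) by (intro exI[of _ "x \<circ> g"]) (simp add: image_comp[symmetric] del: o_apply)
qed

text \<open>Common tool of the list lemmas below: the permutation \<open>s\<close> decides where the
  class \<open>J\<close> goes, its edges take \<open>a\<close> and all others take
  \<open>b\<close>.\<close>

lemma realize_two_colours:
  assumes s: "bij_betw s {..<k} {..<k}" and ab: "a \<noteq> b"
    and a: "\<And>e. e \<in> J \<Longrightarrow> a \<in> L (s ` e)"
    and b: "\<And>e. e \<in> KK - J \<Longrightarrow> b \<in> L (s ` e)"
  shows "\<exists>col. realizes col \<and> (\<forall>e\<in>KK. col e \<in> L e)"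
proof -
  let ?t = "the_inv_into {..<k} s"
  have inj: "inj_on s {..<k}" and im: "s ` {..<k} = {..<k}"
    using s by (auto simp: bij_betw_def)
  define col where "col e = (if ?t ` e \<in> J then a else b)" for e
  have ts: "?t ` (s ` e) = e" if "e \<in> KK" for e
  proof -
    have "e \<subseteq> {..<k}" using that by (simp add: Kedges_def)
    then show ?thesis using the_inv_into_f_f[OF inj] by (force simp: image_iff)
  qed
  have sK: "s ` e \<in> KK" if "e \<in> KK" for e using Kedges_image[OF inj _ that] im by auto
  have onto: "\<exists>e'\<in>KK. e = s ` e'" if "e \<in> KK" for e
  proof
    have "inj_on ?t {..<k}" "?t ` {..<k} \<subseteq> {..<k}"
      using bij_betw_the_inv_into[OF s] by (auto simp: bij_betw_def)
    then show "?t ` e \<in> KK" using Kedges_image that by blast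
    have "e \<subseteq> s ` {..<k}" using that im by (simp add: Kedges_def)
    then show "e = s ` (?t ` e)" using f_the_inv_into_f[OF inj] by (force simp: image_iff)
  qed
  have "realizes col" unfolding realizes_def has_pattern_copy_def
    using inj sK ts ab by (intro exI[of _ s]) (auto simp: col_def P_eq)
  moreover have "col e \<in> L e" if e: "e \<in> KK" for e
    using onto[OF e] ts a b unfolding col_def by auto
  ultimately show ?thesis by blast
qed

text \<open>A list of size at least two that contains \<open>i\<close> also contains
  \<open>a\<close> or \<open>b\<close>. Call an edge red if its list contains \<open>a\<close>. A
  monochromatic copy of \<open>J\<close> can be coloured by \<open>a\<close> alone if it is red and
  by \<open>b\<close> alone otherwise, and the common colour \<open>i\<close> serves the remaining
  edges.\<close>

lemma realize_common_colour:
  assumes i: "\<And>e. e \<in> KK \<Longrightarrow> i \<in> L e" and c: "\<And>e. e \<in> KK \<Longrightarrow> L e \<subseteq> {..<3} \<and> card (L e) \<ge> 2"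
  shows "\<exists>col. realizes col \<and> (\<forall>e\<in>KK. col e \<in> L e)"
proof -
  have "{0, 1} \<in> KK" using k3 by simp
  then have "i < 3" using i c by fastforce
  then obtain a b :: nat where ab: "{..<3} = {i, a, b}" "a \<noteq> i" "b \<noteq> i" "a \<noteq> b"
  proof -
    have 3: "{..<3::nat} = {0,1,2}" by auto
    consider "i = 0" | "i = 1" | "i = 2" using \<open>i < 3\<close> by linarith
    then show ?thesis
    proof cases
      case 1 then show ?thesis using that[of 1 2] 3 by auto
    next
      case 2 then show ?thesis using that[of 0 2] 3 by auto
    next
      case 3 then show ?thesis using that[of 0 1] \<open>{..<3::nat} = {0,1,2}\<close> by auto
    qed
  qed
  obtain f col where f: "inj_on f (\<Union>J)" "f ` (\<Union>J) \<subseteq> {..<k}" "\<forall>e\<in>J. (a \<in> L (f ` e)) = col"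
    using mono_copy[of "\<lambda>e. a \<in> L e"] unfolding has_mono_copy_def by blast
  have "\<Union>J \<subseteq> {..<k}" using J_sub by (auto simp: Kedges_def)
  then obtain s where s: "bij_betw s {..<k} {..<k}" "\<And>x. x \<in> \<Union>J \<Longrightarrow> s x = f x"
    using inj_on_extend_permutation[OF _ _ f(1,2)] by blast
  have sf: "s ` e = f ` e" if "e \<in> J" for e using that s(2) by (auto intro!: image_cong)
  have sK: "s ` e \<in> KK" if "e \<in> KK" for e using Kedges_image that s(1) by (metis bij_betw_def order_refl)
  show ?thesis
  proof (cases col)
    case True
    show ?thesis
      by (rule realize_two_colours[OF s(1) ab(2)]) (use f(3) sf True i sK in auto)
  next
    case False
    have "b \<in> L (s ` e)" if "e \<in> J" for e
    proof (rule ccontr)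
      assume "b \<notin> L (s ` e)"
      moreover have "a \<notin> L (s ` e)" using f(3) False sf that by simp
      moreover have K: "s ` e \<in> KK" using sK that J_sub by blast
      ultimately have "L (s ` e) \<subseteq> {i}" using c[OF K] ab by blast
      then have "card (L (s ` e)) \<le> 1" using card_mono[of "{i}"] by simp
      then show False using c[OF K] by simp
    qed
    then show ?thesis
      by (intro realize_two_colours[OF s(1) ab(3)]) (use i sK in auto)
  qed
qed

text \<open>It is enough to move some edge of \<open>J\<close> onto \<open>e0\<close>: then
  \<open>J\<close> takes the colour \<open>a\<close>, and full lists leave room for a second colour
  on all other edges.\<close>

lemma realize_one_edge:
  assumes e0: "e0 \<in> KK" "a \<in> L e0" and full: "\<And>e. e \<in> KK \<Longrightarrow> e \<noteq> e0 \<Longrightarrow> {..<3} \<subseteq> L e" and "a < 3"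
  shows "\<exists>col. realizes col \<and> (\<forall>e\<in>KK. col e \<in> L e)"
proof -
  obtain e where e: "e \<in> J" using J_ne by blast
  obtain p q where pq: "e = {p, q}" "p < k" "q < k" "p \<noteq> q"
    using e J_sub by (blast elim: Kedges_E)
  obtain p' q' where pq': "e0 = {p', q'}" "p' < k" "q' < k" "p' \<noteq> q'"
    using e0 by (blast elim: Kedges_E)
  let ?f = "\<lambda>x. if x = p then p' else q'"
  have "inj_on ?f {p, q}" using pq pq' by (auto simp: inj_on_def)
  then obtain s where s: "bij_betw s {..<k} {..<k}" "\<And>x. x \<in> {p, q} \<Longrightarrow> s x = ?f x"
    using inj_on_extend_permutation[of "{..<k}" "{p, q}" ?f] pq pq' by auto
  have se: "s ` e = e0" using s(2) pq pq' by auto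
  have inj: "inj_on s {..<k}" using s by (simp add: bij_betw_def)
  have sK: "s ` d \<in> KK" if "d \<in> KK" for d using Kedges_image that s(1) by (metis bij_betw_def order_refl)
  have ne: "s ` d \<noteq> e0" if "d \<in> KK" "d \<noteq> e" for d
  proof
    assume "s ` d = e0"
    then have "s ` d = s ` e" using se by simp
    moreover have "d \<subseteq> {..<k}" "e \<subseteq> {..<k}" using that e J_sub by (auto simp: Kedges_def)
    ultimately show False using inj_on_image_eq_iff[OF inj] that by blast
  qed
  obtain b where b: "b < 3" "a \<noteq> b" using that[of "if a = 0 then 1 else 0"] by auto
  show ?thesis
  proof (rule realize_two_colours[OF s(1) b(2)])
    fix d assume d: "d \<in> J"
    show "a \<in> L (s ` d)"
    proof (cases "d = e")
      case True
      then show ?thesis using se e0 by simp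
    next
      case False
      then show ?thesis using full[of "s ` d"] ne[of d] sK[of d] \<open>a < 3\<close> d J_sub by auto
    qed
  next
    fix d assume "d \<in> KK - J"
    then show "b \<in> L (s ` d)" using full[of "s ` d"] ne[of d] sK[of d] b e by auto
  qed
qed

text \<open>If \<open>J\<close> misses a vertex, all edges there lie outside \<open>J\<close>. If
  \<open>J\<close> spans all vertices, the bound on its Ramsey number forces it to be a full star.
  This is read off from the colouring that separates the edges at one vertex from the
  others.\<close>

lemma monochromatic_star: "\<exists>u<k. (\<forall>e\<in>KK. u \<in> e \<longrightarrow> e \<in> J) \<or> (\<forall>e\<in>KK. u \<in> e \<longrightarrow> e \<notin> J)"
proof (cases "\<Union>J = {..<k}")
  case False
  then obtain u where "u < k" "u \<notin> \<Union>J" using J_sub by (auto simp: Kedges_def)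
  then show ?thesis by blast
next
  case True
  obtain f col where f: "inj_on f {..<k}" "f ` {..<k} \<subseteq> {..<k}" "\<forall>e\<in>J. ((0::nat) \<in> f ` e) = col"
    using mono_copy[of "\<lambda>e. 0 \<in> e"] True unfolding has_mono_copy_def by auto
  have "f ` {..<k} = {..<k}" using f(1,2) by (simp add: endo_inj_surj)
  then obtain u where u: "u < k" "f u = 0" using k3 by (metis imageE lessThan_iff less_le_trans zero_less_numeral)
  \<comment> \<open>An edge of \<open>J\<close> at \<open>u\<close> is sent to an edge at 0, so the
    colour of the copy is that of the star and every edge of \<open>J\<close> passes through
    \<open>u\<close>.\<close>
  have mem: "u \<in> e" if "e \<in> J" for e
  proof -
    obtain e' where "u \<in> e'" "e' \<in> J" using u True by (metis UnionE lessThan_iff)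
    then have "0 \<in> f ` e'" using u by force
    then have "0 \<in> f ` e" using f(3) \<open>e' \<in> J\<close> that by blast
    then obtain w where "w \<in> e" "f w = 0" by auto
    moreover have "w < k" using that J_sub \<open>w \<in> e\<close> by (auto simp: Kedges_def)
    ultimately have "w = u" using u inj_onD[OF f(1), of w u] by auto
    then show ?thesis using \<open>w \<in> e\<close> by simp
  qed
  have "e \<in> J" if "e \<in> KK" "u \<in> e" for e
  proof -
    obtain x y where "e = {x, y}" "x \<in> {..<k}" "y \<in> {..<k}" "x \<noteq> y" using \<open>e \<in> KK\<close> by (rule Kedges_E)
    then obtain w where w: "e = {u, w}" "w \<noteq> u" "w < k" using \<open>u \<in> e\<close> by (cases "u = x") auto
    obtain d where d: "d \<in> J" "w \<in> d" using w True by (metis UnionE lessThan_iff)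
    then have "u \<in> d" using mem by blast
    moreover have "d \<in> KK" using d J_sub by blast
    ultimately have "d = {u, w}" using d w by (auto elim!: Kedges_E)
    then show ?thesis using d w by simp
  qed
  then show ?thesis using u by blast
qed

text \<open>Put the vertex with a monochromatic star on \<open>v\<close>. The class of that star
  takes \<open>a\<close> everywhere; the other class takes any second colour and meets only full
  lists.\<close>

lemma realize_star:
  assumes v: "v < k" and star: "\<And>e. e \<in> KK \<Longrightarrow> v \<in> e \<Longrightarrow> a \<in> L e"
    and full: "\<And>e. e \<in> KK \<Longrightarrow> v \<notin> e \<Longrightarrow> {..<3} \<subseteq> L e" and "a < 3"
  shows "\<exists>col. realizes col \<and> (\<forall>e\<in>KK. col e \<in> L e)"
proof -
  obtain u where u: "u < k" "(\<forall>e\<in>KK. u \<in> e \<longrightarrow> e \<in> J) \<or> (\<forall>e\<in>KK. u \<in> e \<longrightarrow> e \<notin> J)"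
    using monochromatic_star by blast
  obtain s where s: "bij_betw s {..<k} {..<k}" "s u = v"
    using inj_on_extend_permutation[of "{..<k}" "{u}" "\<lambda>_. v"] u v by auto
  have inj: "inj_on s {..<k}" using s by (simp add: bij_betw_def)
  have sK: "s ` d \<in> KK" if "d \<in> KK" for d using Kedges_image that s(1) by (metis bij_betw_def order_refl)
  have mem: "v \<in> s ` d \<longleftrightarrow> u \<in> d" if "d \<in> KK" for d
  proof -
    have "d \<subseteq> {..<k}" using that by (auto simp: Kedges_def)
    then show ?thesis using inj_on_image_mem_iff[OF inj, of u d] u s by auto
  qed
  obtain b where b: "b < 3" "a \<noteq> b" using that[of "if a = 0 then 1 else 0"] by auto
  have all: "x \<in> L (s ` d)" if "d \<in> KK" "u \<notin> d" "x < 3" for d x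
    using full[of "s ` d"] sK mem that by blast
  have str: "a \<in> L (s ` d)" if "d \<in> KK" for d
    using star[of "s ` d"] all sK mem that \<open>a < 3\<close> by blast
  from u(2) show ?thesis
  proof
    assume "\<forall>e\<in>KK. u \<in> e \<longrightarrow> e \<in> J"
    then show ?thesis using J_sub b all str
      by (intro realize_two_colours[OF s(1) b(2)]) blast+
  next
    assume "\<forall>e\<in>KK. u \<in> e \<longrightarrow> e \<notin> J"
    then show ?thesis using J_sub b all str
      by (intro realize_two_colours[OF s(1) b(2)[symmetric]]) blast+
  qed
qed

end

section \<open>Functions with few bad values\<close>

text \<open>Rankin's trick: if each bad value costs a factor \<open>z\<close>, a function with at
  most \<open>r\<close> bad values has weight at least \<open>z powr r\<close>, and the sum of all
  weights over the product set factorises. It replaces binomial estimates throughout.\<close>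

lemma card_PiE_few_bad:
  fixes S :: "'a \<Rightarrow> 'b set" and z r :: real
  assumes "finite E" "\<And>e. e \<in> E \<Longrightarrow> finite (S e)" "0 < z" "z \<le> 1"
  shows "card {c \<in> Pi\<^sub>E E S. card {e \<in> E. bad e (c e)} \<le> r}
    \<le> z powr (- r) * (\<Prod>e\<in>E. \<Sum>s\<in>S e. if bad e s then z else 1)"
proof -
  let ?C = "{c \<in> Pi\<^sub>E E S. card {e \<in> E. bad e (c e)} \<le> r}"
  have fin: "finite (Pi\<^sub>E E S)" using assms by (intro finite_PiE) auto
  have "card ?C * z powr r = (\<Sum>c\<in>?C. z powr r)" by simp
  also have "\<dots> \<le> (\<Sum>c\<in>?C. \<Prod>e\<in>E. if bad e (c e) then z else 1)"
  proof (rule sum_mono)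
    fix c assume c: "c \<in> ?C"
    have "z powr r \<le> z powr (card {e \<in> E. bad e (c e)})"
      using c assms(3,4) by (intro powr_mono') auto
    also have "\<dots> = (\<Prod>e\<in>E. if bad e (c e) then z else 1)"
      using assms(1,3) by (simp add: powr_realpow prod.If_cases Int_def)
    finally show "z powr r \<le> \<dots>" .
  qed
  also have "\<dots> \<le> (\<Sum>c\<in>Pi\<^sub>E E S. \<Prod>e\<in>E. if bad e (c e) then z else 1)"
    using fin assms(3) by (intro sum_mono2) (auto intro!: prod_nonneg)
  also have "\<dots> = (\<Prod>e\<in>E. \<Sum>s\<in>S e. if bad e s then z else 1)"
    using prod_sum_PiE[of E S "\<lambda>e s. if bad e s then z else 1"] assms by simp
  finally show ?thesis using assms(3) by (simp add: powr_minus field_simps)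
qed

section \<open>Ordered pairs and Turan numbers\<close>

text \<open>Ordered pairs instead of edges: the count is additive in both sets, and an edge inside
  \<open>V\<close> counts twice.\<close>

definition pc :: "'a set \<Rightarrow> 'b set \<Rightarrow> ('a \<Rightarrow> 'b \<Rightarrow> bool) \<Rightarrow> nat" where
  "pc A B R = card {(x, y) \<in> A \<times> B. R x y}"

lemma pc_sum: "finite A \<Longrightarrow> finite B \<Longrightarrow> pc A B R = (\<Sum>x\<in>A. card {y \<in> B. R x y})"
proof -
  assume f: "finite A" "finite B"
  have "{(x, y) \<in> A \<times> B. R x y} = Sigma A (\<lambda>x. {y \<in> B. R x y})" by auto
  then show ?thesis unfolding pc_def using f by simp
qed

lemma pc_Un_left: "finite A \<Longrightarrow> finite A' \<Longrightarrow> finite B \<Longrightarrow> A \<inter> A' = {} \<Longrightarrow> pc (A \<union> A') B R = pc A B R + pc A' B R"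
  by (simp add: pc_sum sum.union_disjoint)

lemma pc_swap: "pc A B R = pc B A (\<lambda>y x. R x y)"
proof -
  have "{(x, y) \<in> B \<times> A. R y x} = prod.swap ` {(x, y) \<in> A \<times> B. R x y}" by auto
  then show ?thesis unfolding pc_def by (simp add: card_image inj_on_def)
qed

lemma pc_Un_right: "finite A \<Longrightarrow> finite B \<Longrightarrow> finite B' \<Longrightarrow> B \<inter> B' = {} \<Longrightarrow> pc A (B \<union> B') R = pc A B R + pc A B' R"
  by (simp add: pc_swap[of A] pc_Un_left)

lemma pc_cong: "(\<And>x y. x \<in> A \<Longrightarrow> y \<in> B \<Longrightarrow> R x y = R' x y) \<Longrightarrow> pc A B R = pc A B R'"
  unfolding pc_def by (rule arg_cong[of _ _ card]) auto

lemma pc_mono: "finite A \<Longrightarrow> finite B \<Longrightarrow> (\<And>x y. x \<in> A \<Longrightarrow> y \<in> B \<Longrightarrow> R x y \<Longrightarrow> R' x y) \<Longrightarrow> pc A B R \<le> pc A B R'"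
  unfolding pc_def by (rule card_mono) (auto intro: finite_subset[of _ "A \<times> B"])

lemma pc_le: "finite A \<Longrightarrow> finite B \<Longrightarrow> pc A B R \<le> card A * card B"
  unfolding pc_def card_cartesian_product[symmetric] by (rule card_mono) auto

lemma pc_split:
  assumes "finite A" "finite B"
  shows "pc A B R = pc A B (\<lambda>x y. R x y \<and> Q x y) + pc A B (\<lambda>x y. R x y \<and> \<not> Q x y)"
proof -
  have "{(x, y) \<in> A \<times> B. R x y} = {(x, y) \<in> A \<times> B. R x y \<and> Q x y} \<union> {(x, y) \<in> A \<times> B. R x y \<and> \<not> Q x y}"
    by auto
  then show ?thesis unfolding pc_def using assms
    by (simp, intro card_Un_disjoint) (auto intro: finite_subset[of _ "A \<times> B"])
qed

lemma pc_insert_vertex: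
  assumes "finite V" "v \<notin> V" "\<And>x y. R x y \<Longrightarrow> R y x" "\<not> R v v"
  shows "pc (insert v V) (insert v V) R = pc V V R + 2 * card {y \<in> V. R v y}"
proof -
  have s: "{y \<in> {v}. R x y} = (if R x v then {v} else {})" for x by auto
  have "pc (insert v V) (insert v V) R = pc ({v} \<union> V) ({v} \<union> V) R" by simp
  also have "\<dots> = pc {v} {v} R + pc {v} V R + pc V {v} R + pc V V R"
    using assms(1,2) by (simp only: pc_Un_left pc_Un_right finite.intros finite_Un Int_insert_left if_False Int_empty_left add.assoc)
  finally have "pc (insert v V) (insert v V) R = pc {v} {v} R + pc {v} V R + pc V {v} R + pc V V R" .
  moreover have "{(x, y) \<in> {v} \<times> {v}. R x y} = {}" using assms(4) by auto
  then have "pc {v} {v} R = 0" unfolding pc_def by (simp only: card.empty)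
  moreover have "pc {v} V R = card {y \<in> V. R v y}" using assms(1) by (simp add: pc_sum)
  moreover have "pc V {v} R = pc {v} V R" by (subst pc_swap, rule pc_cong) (use assms(3) in blast)
  ultimately show ?thesis by linarith
qed

lemma pc_edges:
  assumes "finite V" "E \<subseteq> Kedges V"
  shows "pc V V (\<lambda>x y. {x, y} \<in> E) = 2 * card E"
proof -
  have fE: "finite E" using assms finite_Kedges finite_subset by blast
  have "{(x, y) \<in> V \<times> V. {x, y} \<in> E} = (\<Union>e\<in>E. {(x, y). {x, y} = e})"
    using assms(2) by (auto simp: Kedges_def)
  moreover have c2: "finite {(x, y). {x, y} = e} \<and> card {(x, y). {x, y} = e} = 2" if "e \<in> E" for e
  proof -
    have "e \<in> Kedges V" using assms(2) \<open>e \<in> E\<close> by blast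
    then obtain a b where "e = {a, b}" "a \<noteq> b" by (rule Kedges_E)
    then have "{(x, y). {x, y} = e} = {(a, b), (b, a)}" by (auto simp: doubleton_eq_iff)
    then show ?thesis using \<open>a \<noteq> b\<close> by simp
  qed
  moreover have "card (\<Union>e\<in>E. {(x, y). {x, y} = e}) = (\<Sum>e\<in>E. card {(x, y). {x, y} = e})"
    by (rule card_UN_disjoint) (use fE c2 in auto)
  ultimately show ?thesis unfolding pc_def by simp
qed

section \<open>Turan numbers and nearly maximal cuts\<close>

abbreviation "tur m n \<equiv> card (turan_edges m n)"

lemma card_same_residue:
  assumes "m \<ge> 1"
  shows "card {x \<in> {..<n}. x mod m = n mod m} = n div (m::nat)"
proof -
  have "{x \<in> {..<n}. x mod m = n mod m} = (\<lambda>j. n mod m + j * m) ` {..<n div m}"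
  proof (intro equalityI subsetI)
    fix x assume x: "x \<in> {x \<in> {..<n}. x mod m = n mod m}"
    have "x = n mod m + (x div m) * m" using x by (metis (mono_tags) mem_Collect_eq mod_div_mult_eq add.commute)
    moreover have "x div m < n div m"
    proof (rule ccontr)
      assume "\<not> x div m < n div m"
      then have "n div m * m \<le> x div m * m" by simp
      then have "n \<le> x" using x by (metis (mono_tags) add_le_mono1 div_mult_mod_eq mem_Collect_eq)
      then show False using x by simp
    qed
    ultimately show "x \<in> (\<lambda>j. n mod m + j * m) ` {..<n div m}" by blast
  next
    fix x assume "x \<in> (\<lambda>j. n mod m + j * m) ` {..<n div m}"
    then obtain j where j: "x = n mod m + j * m" "j < n div m" by auto
    have "(j + 1) * m \<le> n div m * m" using j(2) by (intro mult_le_mono1) simp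
    then have "j * m + m \<le> n - n mod m" by (simp add: minus_mod_eq_div_mult)
    moreover have "n mod m \<le> n" by simp
    ultimately have "x < n" using assms j(1) by linarith
    then show "x \<in> {x \<in> {..<n}. x mod m = n mod m}" using j by simp
  qed
  moreover have "inj_on (\<lambda>j. n mod m + j * m) {..<n div m}" using assms by (auto simp: inj_on_def)
  ultimately show ?thesis by (simp add: card_image)
qed

lemma finite_turan: "finite (turan_edges m n)"
  unfolding turan_edges_def using finite_Kedges[of "{..<n}"] by auto

lemma tur_pc: "2 * tur m n = pc {..<n} {..<n} (\<lambda>x y. x mod m \<noteq> y mod m)"
  by (subst pc_edges[symmetric, of "{..<n}"], auto simp: turan_edges_def intro!: pc_cong)

lemma tur_Suc:
  assumes "m \<ge> 1"
  shows "tur m (Suc n) = tur m n + (n - n div m)"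
proof -
  have "2 * tur m (Suc n) = 2 * tur m n + 2 * card {y \<in> {..<n}. n mod m \<noteq> y mod m}"
    unfolding tur_pc lessThan_Suc by (rule pc_insert_vertex) auto
  also have "card {y \<in> {..<n}. n mod m \<noteq> y mod m} = card ({..<n} - {x \<in> {..<n}. x mod m = n mod m})"
    by (rule arg_cong[of _ _ card]) auto
  also have "\<dots> = n - n div m" using card_same_residue[OF assms, of n] by (subst card_Diff_subset) auto
  finally show ?thesis by (simp only: distrib_left[symmetric] mult_cancel1) simp
qed

lemma tur_step_real:
  assumes "m \<ge> 1"
  shows "real (tur m (Suc n)) \<ge> tur m n + (1 - 1 / m) * n"
proof -
  have "real (n div m) \<le> n / m" by (rule of_nat_div_le_of_nat)
  moreover have "n div m \<le> n" by simp
  ultimately show ?thesis unfolding tur_Suc[OF assms] by (simp add: of_nat_diff algebra_simps)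
qed

lemma tur_lower:
  assumes "m \<ge> 1"
  shows "2 * real (tur m n) \<ge> (1 - 1 / m) * (real n * (real n - 1))"
proof (induction n)
  case (Suc n)
  have "(1 - 1 / m) * (real (Suc n) * (real (Suc n) - 1)) = (1 - 1 / m) * (real n * (real n - 1)) + 2 * ((1 - 1 / m) * n)"
    by (simp add: algebra_simps)
  then show ?case using Suc tur_step_real[OF assms, of n] by linarith
qed simp

text \<open>By pigeonhole some part has more than \<open>n div m\<close> of the \<open>Suc n\<close>
  vertices. Deleting one of them loses at most \<open>n - n div m\<close> cut edges, exactly the
  increment in \<open>tur_Suc\<close>.\<close>

lemma cut_le_tur:
  assumes "finite V" "m \<ge> 1" "f ` V \<subseteq> {..<m}"
  shows "pc V V (\<lambda>x y. f x \<noteq> f y) \<le> 2 * tur m (card V)"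
  using assms(1,3)
proof (induction "card V" arbitrary: V)
  case 0
  then show ?case by (simp add: pc_def)
next
  case (Suc n)
  have sumV: "card V = (\<Sum>p<m. card {x \<in> V. f x = p})"
    using card_Union_disjoint sum.group[of V "{..<m}" f "\<lambda>_. 1::nat"] Suc.prems by simp
  have "\<exists>p<m. card {x \<in> V. f x = p} > n div m"
  proof (rule ccontr)
    assume "\<not> ?thesis"
    then have "card V \<le> (\<Sum>p<m. n div m)" unfolding sumV by (intro sum_mono) auto
    then have "Suc n \<le> n div m * m" using Suc.hyps(2) by (simp add: mult.commute)
    then show False using div_times_less_eq_dividend[of n m] by linarith
  qed
  then obtain p where p: "p < m" "card {x \<in> V. f x = p} > n div m" by blast
  then have "{x \<in> V. f x = p} \<noteq> {}" by (metis card.empty not_less0)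
  then obtain v where v: "v \<in> V" "f v = p" by blast
  define W where "W = V - {v}"
  have W: "finite W" "v \<notin> W" "V = insert v W" "card W = n"
    using v Suc.prems Suc.hyps(2) unfolding W_def by auto
  have "pc V V (\<lambda>x y. f x \<noteq> f y) = pc W W (\<lambda>x y. f x \<noteq> f y) + 2 * card {y \<in> W. f v \<noteq> f y}"
    unfolding W(3) by (rule pc_insert_vertex) (use W in auto)
  moreover have A: "pc W W (\<lambda>x y. f x \<noteq> f y) \<le> 2 * tur m n"
    using Suc.hyps(1)[of W] W Suc.prems by auto
  moreover have B: "card {y \<in> W. f v \<noteq> f y} \<le> n - n div m"
  proof -
    have "{y \<in> W. f v \<noteq> f y} = V - {x \<in> V. f x = p}" using v unfolding W_def by auto
    then have "card {y \<in> W. f v \<noteq> f y} = Suc n - card {x \<in> V. f x = p}"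
      using Suc.prems Suc.hyps(2) by (simp add: card_Diff_subset)
    then show ?thesis using p by linarith
  qed
  ultimately show ?case unfolding Suc.hyps(2)[symmetric] tur_Suc[OF assms(2)]
    using add_mono[OF A mult_le_mono2[OF B, of 2]] by (simp only: distrib_left)
qed

text \<open>The squares of the part sizes sum to \<open>n\<^sup>2\<close> minus the cut, so a nearly
  maximal cut makes their variance small. The linear error \<open>n\<close> is absorbed by
  \<open>card V \<ge> 1 / g\<close>, which is the factor 2 under the root.\<close>

lemma balanced_parts:
  fixes g :: real
  assumes "finite V" "m \<ge> 1" "f ` V \<subseteq> {..<m}" "g > 0" "card V \<ge> 1 / g"
    and cut: "pc V V (\<lambda>x y. f x \<noteq> f y) \<ge> 2 * real (tur m (card V)) - g * (card V)\<^sup>2"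
    and "p < m"
  shows "card {x \<in> V. f x = p} \<ge> (1 / m - sqrt (2 * g)) * card V"
proof -
  define n where "n = real (card V)"
  define s where "s p = real (card {x \<in> V. f x = p})" for p
  have n0: "n \<ge> 1 / g" using assms(5) unfolding n_def .
  moreover have "1 / g > 0" using assms(4) by simp
  ultimately have npos: "n > 0" by linarith
  note n0 = n0 npos
  have s_sum: "(\<Sum>p<m. s p) = n"
    using sum.group[of V "{..<m}" f "\<lambda>_. 1::real"] assms(1,3) unfolding s_def n_def by simp
  have "n\<^sup>2 = pc V V (\<lambda>x y. True)" unfolding n_def pc_def by (simp add: power2_eq_square card_cartesian_product)
  also have "\<dots> = real (pc V V (\<lambda>x y. f x \<noteq> f y)) + real (pc V V (\<lambda>x y. f x = f y))"
    using pc_split[OF assms(1) assms(1), of "\<lambda>_ _. True" "\<lambda>x y. f x \<noteq> f y"] by simp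
  also have "pc V V (\<lambda>x y. f x = f y) = (\<Sum>x\<in>V. s (f x))"
    using assms(1) by (simp add: pc_sum s_def eq_commute)
  also have "\<dots> = (\<Sum>p<m. \<Sum>x | x \<in> V \<and> f x = p. s (f x))"
    using sum.group[of V "{..<m}" f "\<lambda>x. s (f x)"] assms(1,3) by simp
  also have "\<dots> = (\<Sum>p<m. (s p)\<^sup>2)"
    by (rule sum.cong) (auto simp: s_def power2_eq_square)
  finally have sq: "(\<Sum>p<m. (s p)\<^sup>2) = n\<^sup>2 - pc V V (\<lambda>x y. f x \<noteq> f y)" by simp
  have "(\<Sum>p<m. (s p - n / m)\<^sup>2) = (\<Sum>p<m. (s p)\<^sup>2 - 2 * (n / m) * s p + (n / m)\<^sup>2)"
    by (rule sum.cong) (auto simp: power2_diff)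
  also have "\<dots> = (\<Sum>p<m. (s p)\<^sup>2) - 2 * (n / m) * n + m * (n / m)\<^sup>2"
    by (simp only: sum.distrib sum_subtractf sum_distrib_left[symmetric] s_sum) simp
  also have "\<dots> = (\<Sum>p<m. (s p)\<^sup>2) - n\<^sup>2 / m" using assms(2) by (simp add: power2_eq_square field_simps)
  also have "\<dots> \<le> n\<^sup>2 - (1 - 1 / m) * (n * (n - 1)) + g * n\<^sup>2 - n\<^sup>2 / m"
    using cut tur_lower[OF assms(2), of "card V"] unfolding sq n_def by simp
  also have "\<dots> = (1 - 1 / m) * n + g * n\<^sup>2" by (simp add: power2_eq_square algebra_simps add_divide_distrib)
  also have "\<dots> \<le> n + g * n\<^sup>2" using n0 assms(2) by (simp add: algebra_simps)
  also have "\<dots> \<le> 2 * g * n\<^sup>2"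
  proof -
    have "1 \<le> g * n" using n0 assms(4) by (simp add: field_simps)
    then have "1 * n \<le> g * n * n" using n0 by (intro mult_right_mono) auto
    then show ?thesis by (simp add: power2_eq_square)
  qed
  finally have "(\<Sum>p<m. (s p - n / m)\<^sup>2) \<le> 2 * g * n\<^sup>2" .
  moreover have "(s p - n / m)\<^sup>2 \<le> (\<Sum>p<m. (s p - n / m)\<^sup>2)"
    using assms(7) by (intro member_le_sum) auto
  ultimately have "(s p - n / m)\<^sup>2 \<le> 2 * g * n\<^sup>2" by linarith
  then have "\<bar>s p - n / m\<bar> \<le> sqrt (2 * g * n\<^sup>2)" by (metis real_sqrt_abs real_sqrt_le_mono)
  also have "\<dots> = sqrt (2 * g) * n" using n0 by (simp add: real_sqrt_mult)
  finally show ?thesis unfolding s_def n_def by (simp add: algebra_simps abs_le_iff)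
qed

section \<open>Graphs with few cliques\<close>

text \<open>Ordered tuples, so that fixing the last entry leaves tuples in its neighbourhood and the
  recursion \<open>cliques_Suc\<close> has no multiplicities.\<close>

definition cliques :: "nat \<Rightarrow> ('a \<Rightarrow> 'a \<Rightarrow> bool) \<Rightarrow> 'a set \<Rightarrow> nat" where
  "cliques s A V = card {x \<in> {..<s} \<rightarrow>\<^sub>E V. \<forall>i<s. \<forall>j<i. A (x i) (x j)}"

lemma cliques_Suc:
  assumes "finite V"
  shows "cliques (Suc s) A V = (\<Sum>y\<in>V. cliques s A {z \<in> V. A y z})"
proof -
  let ?S = "\<lambda>y. {g \<in> {..<s} \<rightarrow>\<^sub>E {z \<in> V. A y z}. \<forall>i<s. \<forall>j<i. A (g i) (g j)}"
  let ?h = "\<lambda>(y, g). g(s := y)"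
  have fin: "finite (?S y)" for y using assms by (intro finite_subset[OF _ finite_PiE[of "{..<s}" "\<lambda>_. V"]]) auto
  have "{x \<in> {..<Suc s} \<rightarrow>\<^sub>E V. \<forall>i<Suc s. \<forall>j<i. A (x i) (x j)} = ?h ` Sigma V ?S"
  proof (intro equalityI subsetI)
    fix x assume x: "x \<in> {x \<in> {..<Suc s} \<rightarrow>\<^sub>E V. \<forall>i<Suc s. \<forall>j<i. A (x i) (x j)}"
    let ?g = "x(s := undefined)"
    have "x = ?h (x s, ?g)" by simp
    moreover have "(x s, ?g) \<in> Sigma V ?S" using x by (auto simp: PiE_def Pi_def extensional_def)
    ultimately show "x \<in> ?h ` Sigma V ?S" by (rule image_eqI)
  next
    fix x assume "x \<in> ?h ` Sigma V ?S"
    then obtain y g where "y \<in> V" "g \<in> ?S y" "x = g(s := y)" by auto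
    then show "x \<in> {x \<in> {..<Suc s} \<rightarrow>\<^sub>E V. \<forall>i<Suc s. \<forall>j<i. A (x i) (x j)}"
      by (auto simp: PiE_def Pi_def extensional_def less_Suc_eq)
  qed
  moreover have "inj_on ?h (Sigma V ?S)"
  proof (rule inj_onI, clarify)
    fix y g y' g'
    assume g: "g \<in> {..<s} \<rightarrow>\<^sub>E {z \<in> V. A y z}" "g' \<in> {..<s} \<rightarrow>\<^sub>E {z \<in> V. A y' z}" and eq: "g(s := y) = g'(s := y')"
    have u: "g s = undefined" "g' s = undefined" using g by (auto simp: PiE_def extensional_def)
    have "y = y'" using fun_cong[OF eq, of s] by simp
    moreover have "g z = g' z" for z using fun_cong[OF eq, of z] u by (cases "z = s") auto
    ultimately show "y = y' \<and> g = g'" by auto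
  qed
  ultimately have "cliques (Suc s) A V = card (Sigma V ?S)"
    unfolding cliques_def by (simp add: card_image)
  also have "\<dots> = (\<Sum>y\<in>V. cliques s A {z \<in> V. A y z})"
    unfolding cliques_def by (rule card_SigmaI) (use assms fin in auto)
  finally show ?thesis .
qed

lemma cliques_2: "finite V \<Longrightarrow> cliques 2 A V = pc V V A"
proof -
  assume V: "finite V"
  have 1: "cliques (Suc 0) A W = card W" if "finite W" for W
    using that by (simp add: cliques_Suc) (simp add: cliques_def)
  show ?thesis using V 1 by (simp add: numeral_2_eq_2 cliques_Suc[of V "Suc 0"] pc_sum)
qed

text \<open>Furedi's stability argument, run on the vertices that lie in few cliques: the class of a
  vertex of maximum degree is its non-neighbourhood, the rest is partitioned recursively.\<close>

lemma few_cliques_partition: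
  fixes \<gamma> :: real
  assumes "\<gamma> > 0"
  shows "\<exists>\<eta>>0. \<forall>(V :: 'a set) A (N :: real). finite V \<longrightarrow> card V \<le> N \<longrightarrow> N > 0 \<longrightarrow>
    (\<forall>x y. A x y \<longrightarrow> A y x) \<longrightarrow> cliques (Suc (Suc s)) A V \<le> \<eta> * N ^ Suc (Suc s) \<longrightarrow>
    (\<exists>f. f ` V \<subseteq> {..<Suc s} \<and>
      pc V V A + pc V V (\<lambda>x y. A x y \<and> f x = f y) \<le> pc V V (\<lambda>x y. f x \<noteq> f y) + \<gamma> * N\<^sup>2)"
  using assms
proof (induction s arbitrary: \<gamma>)
  case 0
  show ?case
  proof (intro exI[of _ "\<gamma> / 2"] conjI allI impI)
    fix V :: "'a set" and A and N :: real
    assume a: "finite V" "cliques (Suc (Suc 0)) A V \<le> \<gamma> / 2 * N ^ Suc (Suc 0)"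
    then have "pc V V A \<le> \<gamma> / 2 * N\<^sup>2" using cliques_2[OF a(1)] by (simp add: numeral_2_eq_2)
    then show "\<exists>f. f ` V \<subseteq> {..<Suc 0} \<and>
      pc V V A + pc V V (\<lambda>x y. A x y \<and> f x = f y) \<le> pc V V (\<lambda>x y. f x \<noteq> f y) + \<gamma> * N\<^sup>2"
      by (intro exI[of _ "\<lambda>_. 0"]) auto
  qed (use 0 in auto)
next
  case (Suc s)
  obtain \<eta>' where \<eta>': "\<eta>' > 0" and IH: "\<And>(V :: 'a set) A (N :: real). finite V \<Longrightarrow> card V \<le> N \<Longrightarrow> N > 0 \<Longrightarrow>
    (\<forall>x y. A x y \<longrightarrow> A y x) \<Longrightarrow> cliques (Suc (Suc s)) A V \<le> \<eta>' * N ^ Suc (Suc s) \<Longrightarrow>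
    (\<exists>f. f ` V \<subseteq> {..<Suc s} \<and>
      pc V V A + pc V V (\<lambda>x y. A x y \<and> f x = f y) \<le> pc V V (\<lambda>x y. f x \<noteq> f y) + \<gamma> / 2 * N\<^sup>2)"
    using Suc.IH[of "\<gamma> / 2"] Suc.prems by auto
  show ?case
  \<comment> \<open>With this bound at most \<open>\<gamma> / 4 * N\<close> vertices have too many
    cliques in their neighbourhood for the induction hypothesis.\<close>
  proof (intro exI[of _ "\<eta>' * \<gamma> / 4"] conjI allI impI)
    fix V :: "'a set" and A and N :: real
    assume V: "finite V" "card V \<le> N" "N > 0" and sym: "\<forall>x y. A x y \<longrightarrow> A y x"
      and few: "cliques (Suc (Suc (Suc s))) A V \<le> \<eta>' * \<gamma> / 4 * N ^ Suc (Suc (Suc s))"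
    define nb where "nb y = {z \<in> V. A y z}" for y
    have fnb: "finite (nb y)" for y using V by (simp add: nb_def)
    have nbN: "card (nb y) \<le> N" for y
      using card_mono[OF V(1), of "nb y"] V(2) by (force simp: nb_def)
    define bad where "bad = {y \<in> V. cliques (Suc (Suc s)) A (nb y) > \<eta>' * N ^ Suc (Suc s)}"
    have bad: "card bad \<le> \<gamma> / 4 * N"
    proof -
      have "card bad * (\<eta>' * N ^ Suc (Suc s)) = (\<Sum>y\<in>bad. \<eta>' * N ^ Suc (Suc s))" by simp
      also have "\<dots> \<le> (\<Sum>y\<in>bad. real (cliques (Suc (Suc s)) A (nb y)))"
        by (rule sum_mono) (auto simp: bad_def)
      also have "\<dots> \<le> (\<Sum>y\<in>V. real (cliques (Suc (Suc s)) A (nb y)))"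
        using V by (intro sum_mono2) (auto simp: bad_def)
      also have "\<dots> = cliques (Suc (Suc (Suc s))) A V"
        using cliques_Suc[OF V(1), of "Suc (Suc s)" A] by (simp add: nb_def)
      also have "\<dots> \<le> \<gamma> / 4 * N * (\<eta>' * N ^ Suc (Suc s))" using few by (simp add: mult_ac)
      finally show ?thesis using \<eta>' V by (simp only: mult_le_cancel_right) (simp add: not_less[symmetric])
    qed
    show "\<exists>f. f ` V \<subseteq> {..<Suc (Suc s)} \<and>
      pc V V A + pc V V (\<lambda>x y. A x y \<and> f x = f y) \<le> pc V V (\<lambda>x y. f x \<noteq> f y) + \<gamma> * N\<^sup>2"
    proof (cases "V \<subseteq> bad")
      case True
      then have "V = bad" by (auto simp: bad_def)
      have "pc V V A \<le> real (card V) * card V" using pc_le[OF V(1) V(1)] by (metis of_nat_mono of_nat_mult)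
      also have "\<dots> \<le> (\<gamma> / 4 * N) * N" using V bad \<open>V = bad\<close> Suc.prems by (intro mult_mono) auto
      finally have "pc V V A \<le> \<gamma> / 4 * N\<^sup>2" by (simp add: power2_eq_square)
      moreover have "\<gamma> * N\<^sup>2 \<ge> 0" using Suc.prems by simp
      ultimately show ?thesis by (intro exI[of _ "\<lambda>_. 0"]) auto
    next
      case False
      then have ne: "V - bad \<noteq> {}" by auto
      then have "Max ((\<lambda>y. card (nb y)) ` (V - bad)) \<in> (\<lambda>y. card (nb y)) ` (V - bad)"
        using V by (intro Max_in) auto
      then obtain x where x1: "x \<in> V - bad" "Max ((\<lambda>y. card (nb y)) ` (V - bad)) = card (nb x)"
        by (rule imageE)
      have "card (nb y) \<le> card (nb x)" if "y \<in> V - bad" for y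
        unfolding x1(2)[symmetric] using V that by (intro Max_ge) auto
      note x = x1(1) this
      define B where "B = nb x"
      define C where "C = V - B"
      have BC: "finite B" "finite C" "B \<inter> C = {}" "V = B \<union> C" "card B \<le> N"
        using V nbN unfolding B_def C_def nb_def by auto
      obtain f where f: "f ` B \<subseteq> {..<Suc s}" and
        fB: "pc B B A + pc B B (\<lambda>x y. A x y \<and> f x = f y) \<le> pc B B (\<lambda>x y. f x \<noteq> f y) + \<gamma> / 2 * N\<^sup>2"
        using IH[OF BC(1) BC(5) V(3) sym] x(1) unfolding bad_def B_def by (auto simp: not_less)
      define f' where "f' y = (if y \<in> B then f y else Suc s)" for y
      have split: "pc V V R = pc B B R + pc B C R + pc C B R + pc C C R" for R
        unfolding BC(4) using BC by (simp add: pc_Un_left pc_Un_right)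
      have fne: "f y \<noteq> Suc s" "Suc s \<noteq> f y" if "y \<in> B" for y using f that by auto
      have CB: "y \<notin> B" if "y \<in> C" for y using that by (simp add: C_def)
      have full: "pc B' C' (\<lambda>_ _. True) = card B' * card C'" for B' C' :: "'a set"
        by (simp add: pc_def card_cartesian_product)
      have none: "pc B' C' (\<lambda>_ _. False) = 0" for B' C' :: "'a set" by (simp add: pc_def)
      have same: "pc V V (\<lambda>x y. A x y \<and> f' x = f' y) = pc B B (\<lambda>x y. A x y \<and> f x = f y) + pc C C A"
      proof -
        have "pc B B (\<lambda>x y. A x y \<and> f' x = f' y) = pc B B (\<lambda>x y. A x y \<and> f x = f y)"
          by (rule pc_cong) (auto simp: f'_def)
        moreover have "pc B C (\<lambda>x y. A x y \<and> f' x = f' y) = pc B C (\<lambda>_ _. False)"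
          by (rule pc_cong) (use fne CB in \<open>auto simp: f'_def\<close>)
        moreover have "pc C B (\<lambda>x y. A x y \<and> f' x = f' y) = pc C B (\<lambda>_ _. False)"
          by (rule pc_cong) (use fne CB in \<open>auto simp: f'_def\<close>)
        moreover have "pc C C (\<lambda>x y. A x y \<and> f' x = f' y) = pc C C A"
          by (rule pc_cong) (use CB in \<open>auto simp: f'_def\<close>)
        ultimately show ?thesis unfolding split none by simp
      qed
      have cut: "pc V V (\<lambda>x y. f' x \<noteq> f' y) = pc B B (\<lambda>x y. f x \<noteq> f y) + 2 * (card C * card B)"
      proof -
        have "pc B B (\<lambda>x y. f' x \<noteq> f' y) = pc B B (\<lambda>x y. f x \<noteq> f y)"
          by (rule pc_cong) (auto simp: f'_def)
        moreover have "pc B C (\<lambda>x y. f' x \<noteq> f' y) = pc B C (\<lambda>_ _. True)"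
          by (rule pc_cong) (use fne CB in \<open>auto simp: f'_def\<close>)
        moreover have "pc C B (\<lambda>x y. f' x \<noteq> f' y) = pc C B (\<lambda>_ _. True)"
          by (rule pc_cong) (use fne CB in \<open>auto simp: f'_def\<close>)
        moreover have "pc C C (\<lambda>x y. f' x \<noteq> f' y) = pc C C (\<lambda>_ _. False)"
          by (rule pc_cong) (use CB in \<open>auto simp: f'_def\<close>)
        ultimately show ?thesis unfolding split none full by simp
      qed
      have BCsym: "pc B C A = pc C B A"
        by (subst pc_swap, rule pc_cong) (use sym in blast)
      \<comment> \<open>Since \<open>pc V V A + pc C C A = pc B B A + 2 * pc C V A\<close>, it
        suffices to bound the degrees of the vertices of \<open>C\<close> by \<open>card B\<close>;
        only the bad vertices may exceed this.\<close>
      have "pc C V A = pc C B A + pc C C A" unfolding BC(4) using BC by (simp add: pc_Un_right)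
      moreover have "real (pc C V A) \<le> card C * card B + \<gamma> / 4 * N\<^sup>2"
      proof -
        have "real (pc C V A) = (\<Sum>y\<in>C. real (card (nb y)))" using BC V by (simp add: pc_sum nb_def)
        also have "\<dots> \<le> (\<Sum>y\<in>C. real (card B) + (if y \<in> bad then N else 0))"
        proof (rule sum_mono)
          fix y assume "y \<in> C"
          then have "y \<in> V" by (simp add: C_def)
          then show "real (card (nb y)) \<le> real (card B) + (if y \<in> bad then N else 0)"
            using x(2)[of y] nbN[of y] by (auto simp: B_def)
        qed
        also have "\<dots> = card C * card B + card (C \<inter> bad) * N"
          using BC by (simp add: sum.distrib sum.If_cases)
        also have "card (C \<inter> bad) * N \<le> card bad * N"
          using V by (intro mult_right_mono of_nat_mono card_mono) (auto simp: bad_def)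
        also have "card bad * N \<le> \<gamma> / 4 * N * N" using bad V by (intro mult_right_mono) auto
        finally show ?thesis by (simp add: power2_eq_square)
      qed
      moreover have "f' ` V \<subseteq> {..<Suc (Suc s)}" using f by (auto simp: f'_def)
      moreover have "pc V V A = pc B B A + 2 * pc C B A + pc C C A" unfolding split using BCsym by simp
      ultimately show ?thesis using fB same cut by (intro exI[of _ f']) simp
    qed
  qed (use \<eta>' Suc.prems in auto)
qed

section \<open>Weak regularity and counting\<close>

definition clipped_step :: "real \<Rightarrow> ('i \<Rightarrow> real) \<Rightarrow> 'i set \<Rightarrow> real \<Rightarrow> 'i \<Rightarrow> real" where
  "clipped_step \<epsilon> U \<tau> \<sigma> = (\<lambda>i. max 0 (min 1 (U i + (if i \<in> \<tau> then \<sigma> * \<epsilon> else 0))))"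

text \<open>Everything reachable from 0 in at most \<open>l\<close> steps. The family refers to no
  target function, so its size bounds the number of models needed for all colourings at once. The
  tests may depend on the current model, as level sets do.\<close>

fun models :: "real \<Rightarrow> (('i \<Rightarrow> real) \<Rightarrow> 'i set set) \<Rightarrow> nat \<Rightarrow> ('i \<Rightarrow> real) set" where
  "models \<epsilon> \<T> 0 = {\<lambda>_. 0}"
| "models \<epsilon> \<T> (Suc l) = models \<epsilon> \<T> l \<union>
     (\<Union>U\<in>models \<epsilon> \<T> l. (\<lambda>(\<tau>, \<sigma>). clipped_step \<epsilon> U \<tau> \<sigma>) ` (\<T> U \<times> {1, -1}))"

lemma card_models:
  assumes "\<And>U. finite (\<T> U)" "\<And>U. card (\<T> U) \<le> q"
  shows "finite (models \<epsilon> \<T> l) \<and> card (models \<epsilon> \<T> l) \<le> (2 * q + 1) ^ l"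
proof (induction l)
  case (Suc l)
  let ?N = "\<lambda>U. (\<lambda>(\<tau>, \<sigma>). clipped_step \<epsilon> U \<tau> \<sigma>) ` (\<T> U \<times> {1, -1 :: real})"
  have N: "finite (?N U)" "card (?N U) \<le> 2 * q" for U
  proof -
    show "finite (?N U)" using assms(1) by simp
    have "card (?N U) \<le> card (\<T> U \<times> {1, -1 :: real})" by (rule card_image_le) (use assms(1) in simp)
    also have "\<dots> = 2 * card (\<T> U)" by (simp add: card_cartesian_product)
    finally show "card (?N U) \<le> 2 * q" using assms(2)[of U] by linarith
  qed
  have "card (\<Union>U\<in>models \<epsilon> \<T> l. ?N U) \<le> (\<Sum>U\<in>models \<epsilon> \<T> l. card (?N U))"
    using Suc by (intro card_UN_le) auto
  also have "\<dots> \<le> (\<Sum>U\<in>models \<epsilon> \<T> l. 2 * q)" by (intro sum_mono N)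
  also have "\<dots> \<le> (2 * q + 1) ^ l * (2 * q)" using Suc by simp
  finally have "card (models \<epsilon> \<T> (Suc l)) \<le> (2 * q + 1) ^ l + (2 * q + 1) ^ l * (2 * q)"
    using card_Un_le[of "models \<epsilon> \<T> l" "\<Union>U\<in>models \<epsilon> \<T> l. ?N U"] Suc by simp
  then show ?case using Suc N by (simp add: algebra_simps)
qed simp

lemma models_bounded: "U \<in> models \<epsilon> \<T> l \<Longrightarrow> 0 \<le> U i \<and> U i \<le> 1"
  by (induction l arbitrary: U) (auto simp: clipped_step_def)

text \<open>The energy increment argument for weak regularity. As the target has values in the unit interval,
  clipping only decreases the distance to it, and a model is determined by the few tests used.\<close>

lemma weak_regularity:
  fixes W :: "'i \<Rightarrow> real" and \<epsilon> C :: real and N l :: nat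
  assumes "finite I" and W: "\<And>i. i \<in> I \<Longrightarrow> 0 \<le> W i \<and> W i \<le> 1"
    and tests: "\<And>U \<tau>. \<tau> \<in> \<T> U \<Longrightarrow> \<tau> \<subseteq> I \<and> card \<tau> \<le> N"
    and "\<epsilon> > 0" "N > 0" and "(\<Sum>i\<in>I. (W i)\<^sup>2) \<le> C * N" and l: "l * \<epsilon>\<^sup>2 > C"
  shows "\<exists>U\<in>models \<epsilon> \<T> l. \<forall>\<tau>\<in>\<T> U. \<bar>\<Sum>i\<in>\<tau>. W i - U i\<bar> \<le> \<epsilon> * N"
proof -
  define good where "good U \<longleftrightarrow> (\<forall>\<tau>\<in>\<T> U. \<bar>\<Sum>i\<in>\<tau>. W i - U i\<bar> \<le> \<epsilon> * N)" for U
  \<comment> \<open>A failed test lowers the squared distance to \<open>W\<close> by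
    \<open>\<epsilon>\<^sup>2 * N\<close>: the linear term gains twice this amount, and the
    quadratic term takes back at most half of the gain.\<close>
  have "(\<exists>U\<in>models \<epsilon> \<T> j. good U) \<or> (\<exists>U\<in>models \<epsilon> \<T> j. (\<Sum>i\<in>I. (W i - U i)\<^sup>2) \<le> (C - j * \<epsilon>\<^sup>2) * N)" for j
  proof (induction j)
    case 0
    then show ?case using assms(6) by simp
  next
    case (Suc j)
    show ?case
    proof (cases "\<exists>U\<in>models \<epsilon> \<T> j. good U")
      case True
      then show ?thesis by auto
    next
      case False
      then obtain U where U: "U \<in> models \<epsilon> \<T> j" "\<not> good U" "(\<Sum>i\<in>I. (W i - U i)\<^sup>2) \<le> (C - j * \<epsilon>\<^sup>2) * N"
        using Suc by blast
      then obtain \<tau> where \<tau>: "\<tau> \<in> \<T> U" "\<bar>\<Sum>i\<in>\<tau>. W i - U i\<bar> > \<epsilon> * N" unfolding good_def by force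
      define \<sigma> :: real where "\<sigma> = (if (\<Sum>i\<in>\<tau>. W i - U i) > 0 then 1 else -1)"
      have \<sigma>: "\<sigma> * (\<Sum>i\<in>\<tau>. W i - U i) > \<epsilon> * N" "\<sigma>\<^sup>2 = 1" using \<tau>(2) unfolding \<sigma>_def by (auto split: if_splits)
      let ?U = "clipped_step \<epsilon> U \<tau> \<sigma>"
      have "(\<Sum>i\<in>I. (W i - ?U i)\<^sup>2) \<le> (\<Sum>i\<in>I. (W i - U i - (if i \<in> \<tau> then \<sigma> * \<epsilon> else 0))\<^sup>2)"
      proof (rule sum_mono)
        fix i assume "i \<in> I"
        define y where "y = U i + (if i \<in> \<tau> then \<sigma> * \<epsilon> else 0)"
        have "\<bar>W i - max 0 (min 1 y)\<bar> \<le> \<bar>W i - y\<bar>"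
          using W[OF \<open>i \<in> I\<close>] by (auto simp: max_def min_def abs_if)
        then have "(W i - max 0 (min 1 y))\<^sup>2 \<le> (W i - y)\<^sup>2" by (rule abs_le_square_iff[THEN iffD1])
        then show "(W i - ?U i)\<^sup>2 \<le> (W i - U i - (if i \<in> \<tau> then \<sigma> * \<epsilon> else 0))\<^sup>2"
          by (simp add: clipped_step_def y_def diff_diff_eq)
      qed
      also have "\<dots> = (\<Sum>i\<in>I. (W i - U i)\<^sup>2 + (if i \<in> \<tau> then \<epsilon>\<^sup>2 - 2 * \<epsilon> * \<sigma> * (W i - U i) else 0))"
        by (rule sum.cong) (use \<sigma>(2) in \<open>auto simp: power2_eq_square algebra_simps\<close>)
      also have "\<dots> = (\<Sum>i\<in>I. (W i - U i)\<^sup>2) + (\<Sum>i\<in>\<tau>. \<epsilon>\<^sup>2 - 2 * \<epsilon> * \<sigma> * (W i - U i))"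
        using tests[OF \<tau>(1)] assms(1) by (simp add: sum.distrib sum.If_cases Int_absorb1)
      also have "(\<Sum>i\<in>\<tau>. \<epsilon>\<^sup>2 - 2 * \<epsilon> * \<sigma> * (W i - U i)) = card \<tau> * \<epsilon>\<^sup>2 - 2 * \<epsilon> * (\<sigma> * (\<Sum>i\<in>\<tau>. W i - U i))"
        by (simp only: sum_subtractf sum_distrib_left[symmetric] sum_constant mult.assoc)
      also have "\<dots> \<le> N * \<epsilon>\<^sup>2 - 2 * \<epsilon> * (\<epsilon> * N)"
        using tests[OF \<tau>(1)] \<sigma>(1) assms(4) by (intro diff_mono mult_right_mono mult_left_mono) auto
      finally have "(\<Sum>i\<in>I. (W i - ?U i)\<^sup>2) \<le> (C - Suc j * \<epsilon>\<^sup>2) * N"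
        using U(3) by (simp add: algebra_simps power2_eq_square)
      moreover have "?U \<in> models \<epsilon> \<T> (Suc j)" using U(1) \<tau>(1) unfolding \<sigma>_def by force
      ultimately show ?thesis by blast
    qed
  qed
  from this[of l] show ?thesis
  proof
    assume "\<exists>U\<in>models \<epsilon> \<T> l. (\<Sum>i\<in>I. (W i - U i)\<^sup>2) \<le> (C - l * \<epsilon>\<^sup>2) * N"
    moreover have "(C - l * \<epsilon>\<^sup>2) * N < 0" using l assms(5) by (simp add: mult_less_0_iff)
    moreover have "(\<Sum>i\<in>I. (W i - U i)\<^sup>2) \<ge> 0" for U by (simp add: sum_nonneg)
    ultimately show ?thesis by (meson less_le_trans not_less)
  qed (simp add: good_def)
qed

text \<open>A bilinear form with weights in the unit interval is largest at weights 0 and 1: round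
  \<open>a\<close> by the signs of the inner sums, then round \<open>b\<close>.\<close>

lemma cut_norm_upper:
  fixes D :: "'a \<Rightarrow> 'b \<Rightarrow> real"
  assumes fin: "finite X" "finite Y"
    and cut: "\<And>S T. S \<subseteq> X \<Longrightarrow> T \<subseteq> Y \<Longrightarrow> (\<Sum>x\<in>S. \<Sum>y\<in>T. D x y) \<le> B"
    and a: "\<And>x. x \<in> X \<Longrightarrow> 0 \<le> a x \<and> a x \<le> 1" and b: "\<And>y. y \<in> Y \<Longrightarrow> 0 \<le> b y \<and> b y \<le> 1"
  shows "(\<Sum>x\<in>X. \<Sum>y\<in>Y. a x * b y * D x y) \<le> B"
proof -
  have pos: "(\<Sum>x\<in>Z. w x * c x) \<le> (\<Sum>x\<in>{x \<in> Z. c x > 0}. c x)"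
    if "finite Z" "\<And>x. x \<in> Z \<Longrightarrow> 0 \<le> w x \<and> w x \<le> 1" for Z :: "'z set" and w c :: "'z \<Rightarrow> real"
  proof -
    have "(\<Sum>x\<in>Z. w x * c x) \<le> (\<Sum>x\<in>Z. if c x > 0 then c x else 0)"
      by (rule sum_mono) (use that in \<open>auto simp: mult_left_le_one_le mult_nonneg_nonpos\<close>)
    then show ?thesis using that(1) by (simp add: sum.inter_filter)
  qed
  define S where "S = {x \<in> X. (\<Sum>y\<in>Y. b y * D x y) > 0}"
  define T where "T = {y \<in> Y. (\<Sum>x\<in>S. D x y) > 0}"
  have "(\<Sum>x\<in>X. \<Sum>y\<in>Y. a x * b y * D x y) = (\<Sum>x\<in>X. a x * (\<Sum>y\<in>Y. b y * D x y))"
    by (simp add: sum_distrib_left mult.assoc)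
  also have "\<dots> \<le> (\<Sum>x\<in>S. \<Sum>y\<in>Y. b y * D x y)" unfolding S_def using fin a by (intro pos) auto
  also have "\<dots> = (\<Sum>y\<in>Y. b y * (\<Sum>x\<in>S. D x y))" by (subst sum.swap) (simp add: sum_distrib_left)
  also have "\<dots> \<le> (\<Sum>y\<in>T. \<Sum>x\<in>S. D x y)" unfolding T_def using fin b by (intro pos) auto
  also have "\<dots> = (\<Sum>x\<in>S. \<Sum>y\<in>T. D x y)" by (rule sum.swap)
  also have "\<dots> \<le> B" by (rule cut) (auto simp: S_def T_def)
  finally show ?thesis .
qed

lemma cut_norm_bilinear:
  fixes D :: "'a \<Rightarrow> 'b \<Rightarrow> real"
  assumes fin: "finite X" "finite Y"
    and cut: "\<And>S T. S \<subseteq> X \<Longrightarrow> T \<subseteq> Y \<Longrightarrow> \<bar>\<Sum>x\<in>S. \<Sum>y\<in>T. D x y\<bar> \<le> B"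
    and a: "\<And>x. x \<in> X \<Longrightarrow> 0 \<le> a x \<and> a x \<le> 1" and b: "\<And>y. y \<in> Y \<Longrightarrow> 0 \<le> b y \<and> b y \<le> 1"
  shows "\<bar>\<Sum>x\<in>X. \<Sum>y\<in>Y. a x * b y * D x y\<bar> \<le> B"
proof -
  have "(\<Sum>x\<in>X. \<Sum>y\<in>Y. a x * b y * D x y) \<le> B"
    by (rule cut_norm_upper[OF fin _ a b]) (use cut in \<open>auto simp: abs_le_iff\<close>)
  moreover have "(\<Sum>x\<in>X. \<Sum>y\<in>Y. a x * b y * (- D x y)) \<le> B"
    by (rule cut_norm_upper[OF fin _ a b]) (use cut in \<open>auto simp: abs_le_iff sum_negf\<close>)
  ultimately show ?thesis by (simp add: abs_le_iff sum_negf)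
qed

lemma sum_PiE_insert:
  assumes "finite K" "i \<notin> K"
  shows "(\<Sum>x\<in>insert i K \<rightarrow>\<^sub>E V. f x) = (\<Sum>g\<in>K \<rightarrow>\<^sub>E V. \<Sum>a\<in>V. f (g(i := a)))"
proof -
  have "(\<Sum>x\<in>insert i K \<rightarrow>\<^sub>E V. f x) = (\<Sum>z\<in>V \<times> (K \<rightarrow>\<^sub>E V). f ((\<lambda>(y, g). g(i := y)) z))"
    unfolding PiE_insert_eq by (subst sum.reindex) (use assms in \<open>auto intro: inj_combinator\<close>)
  also have "\<dots> = (\<Sum>a\<in>V. \<Sum>g\<in>K \<rightarrow>\<^sub>E V. f (g(i := a)))"
    by (simp add: sum.cartesian_product case_prod_unfold)
  finally show ?thesis by (simp add: sum.swap[of _ V])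
qed

text \<open>The edges of the complete graph with an orientation, because a model need not be
  symmetric.\<close>

definition pairs :: "nat \<Rightarrow> (nat \<times> nat) set" where
  "pairs k = {(i, j). i < j \<and> j < k}"

lemma finite_pairs: "finite (pairs k)"
  by (rule finite_subset[of _ "{..<k} \<times> {..<k}"]) (auto simp: pairs_def)

text \<open>With all coordinates except \<open>i\<close> and \<open>j\<close> fixed, every other
  factor sees at most one of the two. So the product is a constant times a function of
  \<open>x i\<close> times a function of \<open>x j\<close>, and the cut norm applies.\<close>

lemma counting_one_pair:
  fixes D :: "'a \<Rightarrow> 'a \<Rightarrow> real" and B :: real
  assumes "finite V" and ij: "(i, j) \<in> pairs k"
    and cut: "\<And>S T. S \<subseteq> V \<Longrightarrow> T \<subseteq> V \<Longrightarrow> \<bar>\<Sum>x\<in>S. \<Sum>y\<in>T. D x y\<bar> \<le> B"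
    and H: "\<And>e x y. 0 \<le> H e x y \<and> H e x y \<le> 1"
  shows "\<bar>\<Sum>x\<in>{..<k} \<rightarrow>\<^sub>E V. D (x i) (x j) * (\<Prod>e\<in>pairs k - {(i, j)}. H e (x (fst e)) (x (snd e)))\<bar>
    \<le> B * card V ^ (k - 2)"
proof -
  define Q where "Q = pairs k - {(i, j)}"
  define Qi where "Qi = {e \<in> Q. fst e = i \<or> snd e = i}"
  define Qj where "Qj = {e \<in> Q. fst e = j \<or> snd e = j}"
  define R where "R = Q - Qi - Qj"
  have i: "i < k" "j < k" "i \<noteq> j" using ij by (auto simp: pairs_def)
  have fin: "finite Qi" "finite Qj" "finite R" "finite Q"
    using finite_pairs by (auto simp: Q_def Qi_def Qj_def R_def)
  have dis: "Qi \<inter> Qj = {}" using ij by (auto simp: Q_def Qi_def Qj_def pairs_def)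
  define K where "K = {..<k} - {i, j}"
  have K: "{..<k} = insert j (insert i K)" "finite K" "i \<notin> K" "j \<notin> insert i K"
    using i by (auto simp: K_def)
  have H': "0 \<le> (\<Prod>e\<in>A. H e (x e) (y e)) \<and> (\<Prod>e\<in>A. H e (x e) (y e)) \<le> 1" for A x y
    using H by (auto intro: prod_nonneg prod_le_1)
  have one: "\<bar>\<Sum>a\<in>V. \<Sum>b\<in>V. D a b * (\<Prod>e\<in>Q. H e ((g(i := a, j := b)) (fst e)) ((g(i := a, j := b)) (snd e)))\<bar> \<le> B" for g
  proof -
    define \<alpha> where "\<alpha> a = (\<Prod>e\<in>Qi. H e ((g(i := a)) (fst e)) ((g(i := a)) (snd e)))" for a
    define \<beta> where "\<beta> b = (\<Prod>e\<in>Qj. H e ((g(j := b)) (fst e)) ((g(j := b)) (snd e)))" for b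
    define c where "c = (\<Prod>e\<in>R. H e (g (fst e)) (g (snd e)))"
    have "(\<Prod>e\<in>Q. H e ((g(i := a, j := b)) (fst e)) ((g(i := a, j := b)) (snd e))) = c * \<alpha> a * \<beta> b" for a b
    proof -
      let ?h = "\<lambda>e. H e ((g(i := a, j := b)) (fst e)) ((g(i := a, j := b)) (snd e))"
      have "Q = R \<union> (Qi \<union> Qj)" by (auto simp: R_def Qi_def Qj_def)
      then have "prod ?h Q = prod ?h R * prod ?h (Qi \<union> Qj)"
        using fin by (simp only:) (rule prod.union_disjoint, auto simp: R_def)
      also have "prod ?h (Qi \<union> Qj) = prod ?h Qi * prod ?h Qj"
        using fin dis by (intro prod.union_disjoint)
      also have "prod ?h R = c" unfolding c_def
        by (rule prod.cong) (auto simp: R_def Qi_def Qj_def)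
      also have "prod ?h Qi = \<alpha> a" unfolding \<alpha>_def
        by (rule prod.cong) (use dis in \<open>auto simp: Qi_def Qj_def\<close>)
      also have "prod ?h Qj = \<beta> b" unfolding \<beta>_def
        by (rule prod.cong) (use dis i in \<open>auto simp: Qi_def Qj_def\<close>)
      finally show ?thesis by (simp only: mult.assoc)
    qed
    then have "(\<Sum>a\<in>V. \<Sum>b\<in>V. D a b * (\<Prod>e\<in>Q. H e ((g(i := a, j := b)) (fst e)) ((g(i := a, j := b)) (snd e))))
        = (\<Sum>a\<in>V. \<Sum>b\<in>V. (c * \<alpha> a) * \<beta> b * D a b)" by (simp only: mult_ac)
    moreover have "\<bar>\<dots>\<bar> \<le> B"
    proof (rule cut_norm_bilinear[OF assms(1,1) cut])
      show "0 \<le> c * \<alpha> x \<and> c * \<alpha> x \<le> 1" for x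
        using H' unfolding c_def \<alpha>_def by (intro conjI mult_nonneg_nonneg mult_le_one) auto
      show "0 \<le> \<beta> x \<and> \<beta> x \<le> 1" for x using H' unfolding \<beta>_def by auto
    qed
    ultimately show ?thesis by simp
  qed
  have "(\<Sum>x\<in>{..<k} \<rightarrow>\<^sub>E V. D (x i) (x j) * (\<Prod>e\<in>Q. H e (x (fst e)) (x (snd e))))
    = (\<Sum>g\<in>K \<rightarrow>\<^sub>E V. \<Sum>a\<in>V. \<Sum>b\<in>V. D a b * (\<Prod>e\<in>Q. H e ((g(i := a, j := b)) (fst e)) ((g(i := a, j := b)) (snd e))))"
    using K(2-4) i(3) unfolding K(1) by (simp add: sum_PiE_insert)
  also have "\<bar>\<dots>\<bar> \<le> (\<Sum>g\<in>K \<rightarrow>\<^sub>E V. B)"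
    by (rule order_trans[OF sum_abs sum_mono[OF one]])
  also have "\<dots> = B * card V ^ (k - 2)"
    using i by (simp add: card_PiE K_def card_Diff_subset numeral_2_eq_2)
  finally show ?thesis unfolding Q_def .
qed

text \<open>Exchange \<open>G\<close> for \<open>F\<close> one pair at a time; each exchange is an
  instance of \<open>counting_one_pair\<close> with factors of both kinds.\<close>

lemma counting_lemma:
  fixes F G :: "nat \<times> nat \<Rightarrow> 'a \<Rightarrow> 'a \<Rightarrow> real" and B :: real
  assumes "finite V"
    and cut: "\<And>e S T. e \<in> pairs k \<Longrightarrow> S \<subseteq> V \<Longrightarrow> T \<subseteq> V \<Longrightarrow> \<bar>\<Sum>x\<in>S. \<Sum>y\<in>T. F e x y - G e x y\<bar> \<le> B"
    and F: "\<And>e x y. 0 \<le> F e x y \<and> F e x y \<le> 1" and G: "\<And>e x y. 0 \<le> G e x y \<and> G e x y \<le> 1"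
  shows "\<bar>(\<Sum>x\<in>{..<k} \<rightarrow>\<^sub>E V. \<Prod>e\<in>pairs k. F e (x (fst e)) (x (snd e)))
    - (\<Sum>x\<in>{..<k} \<rightarrow>\<^sub>E V. \<Prod>e\<in>pairs k. G e (x (fst e)) (x (snd e)))\<bar> \<le> card (pairs k) * (B * card V ^ (k - 2))"
proof -
  define t where "t A = (\<Sum>x\<in>{..<k} \<rightarrow>\<^sub>E V. \<Prod>e\<in>pairs k. (if e \<in> A then F e else G e) (x (fst e)) (x (snd e)))" for A
  have step: "\<bar>t (insert e A) - t A\<bar> \<le> B * card V ^ (k - 2)" if e: "e \<in> pairs k" "e \<notin> A" for e A
  proof -
    obtain i j where ij: "e = (i, j)" by (cases e)
    let ?p = "\<lambda>x. \<Prod>e\<in>pairs k - {e}. (if e \<in> A then F e else G e) (x (fst e)) (x (snd e))"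
    have "t (insert e A) = (\<Sum>x\<in>{..<k} \<rightarrow>\<^sub>E V. F e (x i) (x j) * ?p x)"
      unfolding t_def prod.remove[OF finite_pairs e(1)] by (intro sum.cong arg_cong2[of _ _ _ _ "(*)"] prod.cong) (auto simp: ij)
    moreover have "t A = (\<Sum>x\<in>{..<k} \<rightarrow>\<^sub>E V. G e (x i) (x j) * ?p x)"
      unfolding t_def prod.remove[OF finite_pairs e(1)] using e(2) by (simp add: ij)
    ultimately have "t (insert e A) - t A = (\<Sum>x\<in>{..<k} \<rightarrow>\<^sub>E V. (F e (x i) (x j) - G e (x i) (x j)) * ?p x)"
      by (simp add: sum_subtractf left_diff_distrib)
    also have "\<bar>\<dots>\<bar> \<le> B * card V ^ (k - 2)"
      using counting_one_pair[OF assms(1), of i j k "\<lambda>x y. F e x y - G e x y" B "\<lambda>e. if e \<in> A then F e else G e"]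
        e cut[OF e(1)] F G unfolding ij by auto
    finally show ?thesis .
  qed
  have "A \<subseteq> pairs k \<Longrightarrow> \<bar>t A - t {}\<bar> \<le> card A * (B * card V ^ (k - 2))" if "finite A" for A
    using that
  proof induction
    case (insert e A)
    then show ?case using step[of e A] by (simp add: algebra_simps)
  qed simp
  from this[OF finite_pairs order_refl] have "\<bar>t (pairs k) - t {}\<bar> \<le> card (pairs k) * (B * card V ^ (k - 2))" .
  moreover have "t (pairs k) = (\<Sum>x\<in>{..<k} \<rightarrow>\<^sub>E V. \<Prod>e\<in>pairs k. F e (x (fst e)) (x (snd e)))"
    unfolding t_def by (intro sum.cong prod.cong) auto
  ultimately show ?thesis unfolding t_def by simp
qed

section \<open>Graphs with many colourings are almost multipartite\<close>

text \<open>\<open>U (i, x, y)\<close> models the density of colour \<open>i\<close> at the pair \<open>x, y\<close>; it need not be symmetric in \<open>x, y\<close>.\<close>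

definition allowed :: "(nat \<times> nat \<times> nat \<Rightarrow> real) \<Rightarrow> real \<Rightarrow> nat set \<Rightarrow> nat set" where
  "allowed U \<delta> e = {i. i < 3 \<and> (\<forall>x\<in>e. \<forall>y\<in>e. x \<noteq> y \<longrightarrow> U (i, x, y) \<ge> \<delta>)}"

text \<open>Besides the rectangles, the level sets of the model are tests. This bounds the number of edges
  whose colour is not allowed.\<close>

definition tests :: "real \<Rightarrow> nat set \<Rightarrow> (nat \<times> nat \<times> nat \<Rightarrow> real) \<Rightarrow> (nat \<times> nat \<times> nat) set set" where
  "tests \<delta> V U = (\<lambda>(i, S, T). {i} \<times> S \<times> T) ` ({..<3} \<times> Pow V \<times> Pow V)
     \<union> (\<lambda>i. {i} \<times> {(x, y) \<in> V \<times> V. U (i, x, y) < \<delta>}) ` {..<3}"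

definition colour_indicator :: "nat set set \<Rightarrow> (nat set \<Rightarrow> nat) \<Rightarrow> nat \<times> nat \<times> nat \<Rightarrow> real" where
  "colour_indicator E c = (\<lambda>(i, x, y). of_bool ({x, y} \<in> E \<and> c {x, y} = i))"

definition is_model :: "real \<Rightarrow> real \<Rightarrow> nat set \<Rightarrow> nat set set \<Rightarrow> (nat set \<Rightarrow> nat) \<Rightarrow> (nat \<times> nat \<times> nat \<Rightarrow> real) \<Rightarrow> bool" where
  "is_model \<epsilon> \<delta> V E c U \<longleftrightarrow> (\<forall>t. 0 \<le> U t \<and> U t \<le> 1) \<and>
     (\<forall>\<tau>\<in>tests \<delta> V U. \<bar>\<Sum>t\<in>\<tau>. colour_indicator E c t - U t\<bar> \<le> \<epsilon> * (card V)\<^sup>2)"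

lemma sum_singleton_Times: "(\<Sum>t\<in>{i} \<times> Z. f t) = (\<Sum>z\<in>Z. f (i, z))"
proof -
  have "{i} \<times> Z = Pair i ` Z" by auto
  then show ?thesis by (simp add: sum.reindex inj_on_def)
qed

lemma finite_allowed [simp]: "finite (allowed U \<delta> e)" and allowed_sub: "allowed U \<delta> e \<subseteq> {..<3}"
  by (auto simp: allowed_def)

lemma card_allowed: "card (allowed U \<delta> e) \<le> 3"
  using card_mono[OF _ allowed_sub[of U \<delta> e]] by simp

lemma allowed_full: "card (allowed U \<delta> e) = 3 \<Longrightarrow> allowed U \<delta> e = {..<3}"
  by (rule card_subset_eq) (simp_all add: allowed_sub)

lemma card_tests:
  assumes "finite V"
  shows "finite (tests \<delta> V U)" and "card (tests \<delta> V U) \<le> 6 * 4 ^ card V"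
proof -
  show "finite (tests \<delta> V U)" using assms by (simp add: tests_def)
  have "card (tests \<delta> V U) \<le> card ({..<3::nat} \<times> Pow V \<times> Pow V) + card {..<3::nat}"
    unfolding tests_def using assms by (intro order_trans[OF card_Un_le] add_mono card_image_le) auto
  also have "\<dots> = 3 * (2 ^ card V * 2 ^ card V) + 3" using assms by (simp add: card_cartesian_product card_Pow)
  also have "\<dots> = 3 * 4 ^ card V + 3" by (simp add: power_mult_distrib[symmetric])
  also have "\<dots> \<le> 6 * 4 ^ card V" using one_le_power[of "4::nat" "card V"] by simp
  finally show "card (tests \<delta> V U) \<le> 6 * 4 ^ card V" .
qed

lemma model_exists:
  fixes \<epsilon> \<delta> :: real
  assumes "finite V" "V \<noteq> {}" "\<epsilon> > 0" "l * \<epsilon>\<^sup>2 > 3"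
  shows "\<exists>U\<in>models \<epsilon> (tests \<delta> V) l. is_model \<epsilon> \<delta> V E c U"
proof -
  let ?I = "{..<3::nat} \<times> V \<times> V"
  have "\<exists>U\<in>models \<epsilon> (tests \<delta> V) l. \<forall>\<tau>\<in>tests \<delta> V U. \<bar>\<Sum>t\<in>\<tau>. colour_indicator E c t - U t\<bar> \<le> \<epsilon> * real ((card V)\<^sup>2)"
  proof (rule weak_regularity[where I = ?I and C = 3])
    fix U \<tau> assume "\<tau> \<in> tests \<delta> V U"
    then consider i S T where "\<tau> = {i} \<times> S \<times> T" "i < 3" "S \<subseteq> V" "T \<subseteq> V"
      | i where "\<tau> = {i} \<times> {(x, y) \<in> V \<times> V. U (i, x, y) < \<delta>}" "i < 3"
      unfolding tests_def by auto
    then have "\<exists>i<3. \<tau> \<subseteq> {i} \<times> V \<times> V" by cases auto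
    then obtain i where i: "i < 3" "\<tau> \<subseteq> {i} \<times> V \<times> V" by blast
    then have "card \<tau> \<le> card ({i} \<times> V \<times> V)" using assms(1) by (intro card_mono) auto
    then show "\<tau> \<subseteq> ?I \<and> card \<tau> \<le> (card V)\<^sup>2" using i by (auto simp: card_cartesian_product power2_eq_square)
  next
    \<comment> \<open>At most one unit of energy for each colour and ordered pair; this is the
      constant \<open>C = 3\<close>.\<close>
    have "(\<Sum>t\<in>?I. (colour_indicator E c t)\<^sup>2) \<le> (\<Sum>t\<in>?I. 1)"
      by (rule sum_mono) (auto simp: colour_indicator_def)
    also have "\<dots> = 3 * real ((card V)\<^sup>2)" by (simp add: card_cartesian_product power2_eq_square)
    finally show "(\<Sum>t\<in>?I. (colour_indicator E c t)\<^sup>2) \<le> 3 * real ((card V)\<^sup>2)" .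
  qed (use assms in \<open>auto simp: colour_indicator_def card_gt_0_iff\<close>)
  then show ?thesis unfolding is_model_def using models_bounded by (metis of_nat_power)
qed

text \<open>An edge whose colour \<open>i\<close> is not allowed lies, in some order, in the set of
  pairs where the model is below \<open>\<delta>\<close> for \<open>i\<close>. This level set is
  itself a test, so the number of such pairs of colour \<open>i\<close> exceeds the mass of the
  model there, at most \<open>\<delta>\<close> per pair, only by the regularity error.\<close>

lemma model_few_unlisted:
  fixes \<epsilon> \<delta> :: real
  assumes "finite V" "E \<subseteq> Kedges V" "is_model \<epsilon> \<delta> V E c U" "c \<in> E \<rightarrow>\<^sub>E {..<3}" "\<delta> \<ge> 0"
  shows "card {e \<in> E. c e \<notin> allowed U \<delta> e} \<le> 3 * (\<delta> + \<epsilon>) * (card V)\<^sup>2"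
proof -
  define Z where "Z i = {(x, y) \<in> V \<times> V. U (i, x, y) < \<delta>}" for i
  define Y where "Y i = {(x, y) \<in> Z i. {x, y} \<in> E \<and> c {x, y} = i}" for i
  have fin: "finite (Z i)" "finite (Y i)" for i
    using assms(1) by (auto simp: Y_def Z_def intro: finite_subset[of _ "V \<times> V"])
  have Y: "card (Y i) \<le> (\<delta> + \<epsilon>) * (card V)\<^sup>2" if "i < 3" for i
  proof -
    have "(\<Sum>t\<in>{i} \<times> Z i. colour_indicator E c t) = (\<Sum>t\<in>{i} \<times> Z i. if t \<in> {i} \<times> Y i then 1 else 0)"
      by (rule sum.cong) (auto simp: colour_indicator_def Y_def)
    also have "\<dots> = card (({i} \<times> Z i) \<inter> ({i} \<times> Y i))" using fin by (simp add: sum.If_cases)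
    also have "({i} \<times> Z i) \<inter> ({i} \<times> Y i) = {i} \<times> Y i" by (auto simp: Y_def)
    finally have "card (Y i) = (\<Sum>t\<in>{i} \<times> Z i. colour_indicator E c t)" by (simp add: card_cartesian_product)
    moreover have "{i} \<times> Z i \<in> tests \<delta> V U" using that unfolding tests_def Z_def by blast
    then have "(\<Sum>t\<in>{i} \<times> Z i. colour_indicator E c t - U t) \<le> \<epsilon> * (card V)\<^sup>2"
      using assms(3) unfolding is_model_def by (metis abs_le_D1)
    moreover have "(\<Sum>t\<in>{i} \<times> Z i. U t) \<le> (\<Sum>t\<in>{i} \<times> Z i. \<delta>)" by (rule sum_mono) (auto simp: Z_def)
    moreover have "(\<Sum>t\<in>{i} \<times> Z i. \<delta>) \<le> \<delta> * (card V)\<^sup>2"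
    proof -
      have "card (Z i) \<le> card (V \<times> V)" using assms(1) by (intro card_mono) (auto simp: Z_def)
      then have "real (card (Z i)) \<le> (card V)\<^sup>2"
        by (simp only: card_cartesian_product power2_eq_square of_nat_le_iff)
      then show ?thesis using assms(5) by (simp add: card_cartesian_product mult.commute mult_left_mono)
    qed
    ultimately show ?thesis by (simp add: sum_subtractf algebra_simps)
  qed
  have "{e \<in> E. c e \<notin> allowed U \<delta> e} \<subseteq> (\<Union>i<3. (\<lambda>(x, y). {x, y}) ` Y i)"
  proof
    fix e assume "e \<in> {e \<in> E. c e \<notin> allowed U \<delta> e}"
    then have e: "e \<in> E" "c e \<notin> allowed U \<delta> e" by auto
    then have "c e < 3" "e \<in> Kedges V" using assms(2,4) by auto
    then obtain x y where xy: "x \<in> e" "y \<in> e" "x \<noteq> y" "U (c e, x, y) < \<delta>"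
      using e(2) unfolding allowed_def by force
    moreover have "e = {x, y}" "x \<in> V" "y \<in> V" using \<open>e \<in> Kedges V\<close> xy by (auto elim!: Kedges_E)
    ultimately have "(x, y) \<in> Y (c e)" "e = (\<lambda>(x, y). {x, y}) (x, y)" using e by (auto simp: Y_def Z_def)
    then show "e \<in> (\<Union>i<3. (\<lambda>(x, y). {x, y}) ` Y i)" using \<open>c e < 3\<close> by blast
  qed
  then have "card {e \<in> E. c e \<notin> allowed U \<delta> e} \<le> card (\<Union>i<3::nat. (\<lambda>(x, y). {x, y}) ` Y i)"
    using fin by (intro card_mono) auto
  also have "\<dots> \<le> (\<Sum>i<3. card ((\<lambda>(x, y). {x, y}) ` Y i))" by (rule card_UN_le) simp
  also have "\<dots> \<le> (\<Sum>i<3. card (Y i))" by (intro sum_mono card_image_le fin)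
  finally have "real (card {e \<in> E. c e \<notin> allowed U \<delta> e}) \<le> (\<Sum>i<3::nat. real (card (Y i)))"
    by (metis of_nat_mono of_nat_sum)
  also have "\<dots> \<le> (\<Sum>i<3::nat. (\<delta> + \<epsilon>) * (card V)\<^sup>2)" by (rule sum_mono) (use Y in auto)
  also have "\<dots> = 3 * (\<delta> + \<epsilon>) * (card V)\<^sup>2" by (simp only: sum_constant card_lessThan mult.assoc of_nat_numeral)
  finally show ?thesis .
qed

text \<open>Rankin's trick with the colours outside the list as bad values. An edge with
  \<open>s\<close> allowed colours contributes \<open>s + (3 - s) * z\<close>, at most
  \<open>1 + 3 * z\<close> times the larger of \<open>s\<close> and 1.\<close>

lemma card_few_unlisted:
  fixes z r \<delta> :: real
  assumes "finite E" "0 < z" "z \<le> 1"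
  shows "card {c \<in> E \<rightarrow>\<^sub>E {..<3}. card {e \<in> E. c e \<notin> allowed U \<delta> e} \<le> r}
    \<le> z powr (- r) * ((1 + 3 * z) ^ card E *
        (2 ^ card {e \<in> E. card (allowed U \<delta> e) = 2} * 3 ^ card {e \<in> E. card (allowed U \<delta> e) = 3}))"
proof -
  define w where "w e = (if card (allowed U \<delta> e) = 3 then 3 else if card (allowed U \<delta> e) = 2 then 2 else (1::real))" for e
  have "real (card {c \<in> E \<rightarrow>\<^sub>E {..<3}. card {e \<in> E. c e \<notin> allowed U \<delta> e} \<le> r})
    \<le> z powr (- r) * (\<Prod>e\<in>E. \<Sum>s\<in>{..<3}. if s \<notin> allowed U \<delta> e then z else 1)"
    by (rule card_PiE_few_bad) (use assms in auto)
  also have "(\<Prod>e\<in>E. \<Sum>s\<in>{..<3}. if s \<notin> allowed U \<delta> e then z else 1) \<le> (\<Prod>e\<in>E. (1 + 3 * z) * w e)"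
  proof (rule prod_mono, intro conjI)
    fix e assume "e \<in> E"
    let ?L = "allowed U \<delta> e"
    show "(\<Sum>s\<in>{..<3}. if s \<notin> ?L then z else 1) \<ge> 0" using assms by (intro sum_nonneg) auto
    have "(\<Sum>s\<in>{..<3}. if s \<notin> ?L then z else 1) = card ({..<3} - ?L) * z + card ({..<3} \<inter> ?L)"
      by (simp add: sum.If_cases Diff_eq Compl_eq)
    also have "{..<3} \<inter> ?L = ?L" using allowed_sub by blast
    also have "card ({..<3} - ?L) = 3 - card ?L" using allowed_sub by (simp add: card_Diff_subset)
    also have "(3 - card ?L) * z + card ?L \<le> (1 + 3 * z) * w e"
    proof -
      have "card ?L = 0 \<or> card ?L = 1 \<or> card ?L = 2 \<or> card ?L = 3" using card_allowed[of U \<delta> e] by linarith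
      then show ?thesis using assms by (auto simp: w_def)
    qed
    finally show "(\<Sum>s\<in>{..<3}. if s \<notin> ?L then z else 1) \<le> (1 + 3 * z) * w e" .
  qed
  also have "(\<Prod>e\<in>E. (1 + 3 * z) * w e) = (1 + 3 * z) ^ card E * (\<Prod>e\<in>E. w e)" by (simp add: prod.distrib)
  also have "(\<Prod>e\<in>E. w e) = (\<Prod>e\<in>E. (if card (allowed U \<delta> e) = 2 then 2 else 1) * (if card (allowed U \<delta> e) = 3 then 3 else 1))"
    by (rule prod.cong) (auto simp: w_def)
  also have "\<dots> = 2 ^ card {e \<in> E. card (allowed U \<delta> e) = 2} * 3 ^ card {e \<in> E. card (allowed U \<delta> e) = 3}"
    using assms(1) by (simp add: prod.distrib prod.If_cases Int_def)
  finally show ?thesis using assms by (simp add: mult_left_mono)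
qed

context two_class_pattern
begin

lemma KK_E:
  assumes "e \<in> KK"
  obtains i j where "e = {i, j}" "i < j" "j < k"
proof -
  obtain i j where ij: "e = {i, j}" "i \<in> {..<k}" "j \<in> {..<k}" "i \<noteq> j" using assms by (rule Kedges_E)
  then show ?thesis using that[of i j] that[of j i] by (cases "i < j") (auto simp: insert_commute)
qed

definition listable :: "(nat \<times> nat \<times> nat \<Rightarrow> real) \<Rightarrow> real \<Rightarrow> nat set \<Rightarrow> nat set set \<Rightarrow> (nat \<Rightarrow> nat) set" where
  "listable U \<delta> V E = {x \<in> {..<k} \<rightarrow>\<^sub>E V. (\<forall>e\<in>KK. x ` e \<in> E) \<and>
     (\<exists>col. realizes col \<and> (\<forall>e\<in>KK. col e \<in> allowed U \<delta> (x ` e)))}"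

lemma inj_on_clique_map:
  assumes "E \<subseteq> Kedges V" "\<And>e. e \<in> KK \<Longrightarrow> x ` e \<in> E"
  shows "inj_on x {..<k}"
proof (rule inj_onI, rule ccontr)
  fix i j assume ij: "i \<in> {..<k}" "j \<in> {..<k}" "x i = x j" "i \<noteq> j"
  then have "{i, j} \<in> KK" by simp
  then have "x ` {i, j} \<in> Kedges V" using assms by blast
  moreover have "x ` {i, j} = {x i}" using ij by auto
  ultimately show False by (simp add: Kedges_def)
qed

text \<open>As \<open>c\<close> avoids the pattern, no tuple shows a realizing colouring
  \<open>col\<close> in \<open>c\<close>, so by the counting lemma the model gives small total
  weight to \<open>col\<close>. A tuple that can be listed with \<open>col\<close> has weight at
  least \<open>\<delta> ^ card (pairs k)\<close>, and there are finitely many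
  \<open>col\<close>.\<close>

lemma model_few_listable:
  fixes \<epsilon> \<delta> :: real
  assumes "finite V" "E \<subseteq> Kedges V" "is_model \<epsilon> \<delta> V E c U" "\<not> has_pattern_copy k P E c" "\<delta> > 0"
  shows "card (listable U \<delta> V E) * \<delta> ^ card (pairs k)
    \<le> card (KK \<rightarrow>\<^sub>E {..<3::nat}) * (card (pairs k) * \<epsilon> * card V ^ k)"
proof -
  define S where "S col = {x \<in> {..<k} \<rightarrow>\<^sub>E V. \<forall>e\<in>KK. x ` e \<in> E \<and> col e \<in> allowed U \<delta> (x ` e)}" for col
  have finT: "finite ({..<k} \<rightarrow>\<^sub>E V)" using assms(1) by (intro finite_PiE) auto
  have finS: "finite (S col)" for col using finT by (auto simp: S_def)
  have U: "0 \<le> U t" "U t \<le> 1" for t using assms(3) unfolding is_model_def by blast+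
  define C where "C = {col \<in> KK \<rightarrow>\<^sub>E {..<3}. realizes col}"
  have finC: "finite C" "card C \<le> card (KK \<rightarrow>\<^sub>E {..<3::nat})"
  proof -
    have f: "finite (KK \<rightarrow>\<^sub>E {..<3::nat})" by (rule finite_PiE) (simp_all add: finite_Kedges)
    have C: "C \<subseteq> KK \<rightarrow>\<^sub>E {..<3}" unfolding C_def by (rule Collect_restrict)
    show "finite C" by (rule finite_subset[OF C f])
    show "card C \<le> card (KK \<rightarrow>\<^sub>E {..<3::nat})" by (rule card_mono[OF f C])
  qed
  have S: "card (S col) * \<delta> ^ card (pairs k) \<le> card (pairs k) * \<epsilon> * card V ^ k" if col: "col \<in> C" for col
  proof -
    define F where "F e x y = colour_indicator E c (col {fst e, snd e}, x, y)" for e and x y :: nat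
    define G where "G e x y = U (col {fst e, snd e}, x, y)" for e :: "nat \<times> nat" and x y :: nat
    have pK: "{fst e, snd e} \<in> KK" if "e \<in> pairs k" for e using that by (auto simp: pairs_def)
    have "(\<Prod>e\<in>pairs k. F e (x (fst e)) (x (snd e))) = 0" if x: "x \<in> {..<k} \<rightarrow>\<^sub>E V" for x
    proof (rule ccontr)
      assume "\<not> ?thesis"
      then have nz: "F e (x (fst e)) (x (snd e)) \<noteq> 0" if "e \<in> pairs k" for e
        using finite_pairs \<open>e \<in> pairs k\<close> by (auto simp: prod_zero_iff)
      have ec: "x ` e \<in> E \<and> c (x ` e) = col e" if e: "e \<in> KK" for e
      proof -
        obtain i j where ij: "e = {i, j}" "i < j" "j < k" using e by (rule KK_E)
        then show ?thesis using nz[of "(i, j)"] by (auto simp: pairs_def F_def colour_indicator_def split: if_splits)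
      qed
      then have "has_pattern_copy k P E c"
        using realizes_copy[of col x E c] inj_on_clique_map[OF assms(2), of x] col by (auto simp: C_def)
      then show False using assms(4) by simp
    qed
    then have F0: "(\<Sum>x\<in>{..<k} \<rightarrow>\<^sub>E V. \<Prod>e\<in>pairs k. F e (x (fst e)) (x (snd e))) = 0" by simp
    have "\<bar>(\<Sum>x\<in>{..<k} \<rightarrow>\<^sub>E V. \<Prod>e\<in>pairs k. F e (x (fst e)) (x (snd e)))
      - (\<Sum>x\<in>{..<k} \<rightarrow>\<^sub>E V. \<Prod>e\<in>pairs k. G e (x (fst e)) (x (snd e)))\<bar>
      \<le> card (pairs k) * (\<epsilon> * (card V)\<^sup>2 * card V ^ (k - 2))"
    proof (rule counting_lemma[OF assms(1)])
      fix e A B assume e: "e \<in> pairs k" and AB: "A \<subseteq> V" "B \<subseteq> V"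
      let ?i = "col {fst e, snd e}"
      have i: "?i < 3" using col pK[OF e] by (auto simp: C_def)
      have "{?i} \<times> A \<times> B \<in> tests \<delta> V U" unfolding tests_def
        by (rule UnI1, rule image_eqI[of _ _ "(?i, A, B)"]) (use i AB in auto)
      then have "\<bar>\<Sum>t\<in>{?i} \<times> A \<times> B. colour_indicator E c t - U t\<bar> \<le> \<epsilon> * (card V)\<^sup>2"
        using assms(3) unfolding is_model_def by blast
      also have "(\<Sum>t\<in>{?i} \<times> A \<times> B. colour_indicator E c t - U t) = (\<Sum>x\<in>A. \<Sum>y\<in>B. F e x y - G e x y)"
        by (simp add: F_def G_def sum_singleton_Times sum.cartesian_product case_prod_unfold)
      finally show "\<bar>\<Sum>x\<in>A. \<Sum>y\<in>B. F e x y - G e x y\<bar> \<le> \<epsilon> * (card V)\<^sup>2" .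
    qed (use U in \<open>auto simp: F_def G_def colour_indicator_def\<close>)
    then have "(\<Sum>x\<in>{..<k} \<rightarrow>\<^sub>E V. \<Prod>e\<in>pairs k. G e (x (fst e)) (x (snd e)))
      \<le> card (pairs k) * (\<epsilon> * (card V)\<^sup>2 * card V ^ (k - 2))" unfolding F0 by (simp add: abs_le_iff)
    also have "\<dots> = card (pairs k) * \<epsilon> * card V ^ k"
    proof -
      have "real (card V) ^ 2 * real (card V) ^ (k - 2) = real (card V) ^ (2 + (k - 2))" by (rule power_add[symmetric])
      also have "2 + (k - 2) = k" using k3 by simp
      finally show ?thesis by (simp add: mult.assoc)
    qed
    finally have le: "(\<Sum>x\<in>{..<k} \<rightarrow>\<^sub>E V. \<Prod>e\<in>pairs k. G e (x (fst e)) (x (snd e))) \<le> card (pairs k) * \<epsilon> * card V ^ k" .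
    have "card (S col) * \<delta> ^ card (pairs k) = (\<Sum>x\<in>S col. \<Prod>e\<in>pairs k. \<delta>)" by simp
    also have "\<dots> \<le> (\<Sum>x\<in>S col. \<Prod>e\<in>pairs k. G e (x (fst e)) (x (snd e)))"
    proof (intro sum_mono prod_mono conjI)
      fix x e assume x: "x \<in> S col" and e: "e \<in> pairs k"
      have "x ` {fst e, snd e} \<in> E" "col {fst e, snd e} \<in> allowed U \<delta> (x ` {fst e, snd e})"
        using x pK[OF e] unfolding S_def by blast+
      moreover have "x ` {fst e, snd e} \<in> Kedges V" using calculation(1) assms(2) by blast
      ultimately show "\<delta> \<le> G e (x (fst e)) (x (snd e))"
        by (auto simp: G_def allowed_def)
    qed (use assms(5) in simp)
    also have "\<dots> \<le> (\<Sum>x\<in>{..<k} \<rightarrow>\<^sub>E V. \<Prod>e\<in>pairs k. G e (x (fst e)) (x (snd e)))"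
      using finT U by (intro sum_mono2) (auto simp: S_def G_def intro!: prod_nonneg)
    finally show ?thesis using le by linarith
  qed
  have "listable U \<delta> V E \<subseteq> (\<Union>col\<in>C. S col)"
  proof
    fix x assume x: "x \<in> listable U \<delta> V E"
    then obtain col where col: "realizes col" "\<forall>e\<in>KK. col e \<in> allowed U \<delta> (x ` e)" by (auto simp: listable_def)
    \<comment> \<open>Restriction to \<open>KK\<close> makes \<open>col\<close> a member of the
      finite set \<open>C\<close>; whether it realizes the pattern depends on its values on
      \<open>KK\<close> only.\<close>
    have "realizes (restrict col KK)"
    proof -
      have "(\<forall>e\<in>KK. g ` e \<in> KK) \<Longrightarrow> (\<forall>e\<in>KK. restrict col KK (g ` e) = col (g ` e))" for g by simp
      then show ?thesis using col(1) unfolding realizes_def has_pattern_copy_def by (smt (verit))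
    qed
    moreover have "restrict col KK \<in> KK \<rightarrow>\<^sub>E {..<3}" using col(2) by (auto simp: allowed_def)
    ultimately have "restrict col KK \<in> C" by (simp add: C_def)
    moreover have "x \<in> S (restrict col KK)" using x col(2) by (auto simp: S_def listable_def)
    ultimately show "x \<in> (\<Union>col\<in>C. S col)" by blast
  qed
  then have "card (listable U \<delta> V E) \<le> card (\<Union>col\<in>C. S col)" using finC finS by (intro card_mono) auto
  also have "\<dots> \<le> (\<Sum>col\<in>C. card (S col))" using finC by (intro card_UN_le)
  finally have "real (card (listable U \<delta> V E)) \<le> (\<Sum>col\<in>C. real (card (S col)))" by (metis of_nat_mono of_nat_sum)
  then have "card (listable U \<delta> V E) * \<delta> ^ card (pairs k) \<le> (\<Sum>col\<in>C. real (card (S col))) * \<delta> ^ card (pairs k)"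
    using assms(5) by (intro mult_right_mono) auto
  also have "\<dots> \<le> (\<Sum>col\<in>C. card (pairs k) * \<epsilon> * card V ^ k)"
    unfolding sum_distrib_right by (intro sum_mono S)
  also have "\<dots> = card C * (card (pairs k) * \<epsilon> * card V ^ k)" by simp
  also have "\<dots> \<le> card (KK \<rightarrow>\<^sub>E {..<3::nat}) * (card (pairs k) * \<epsilon> * card V ^ k)"
  proof (rule mult_right_mono)
    \<comment> \<open>The empty rectangle is a test with discrepancy 0, so the error term cannot be
      negative.\<close>
    have "{0} \<times> {} \<times> {} \<in> tests \<delta> V U" unfolding tests_def
      by (rule UnI1, rule image_eqI[of _ _ "(0, {}, {})"]) auto
    then have "0 \<le> \<epsilon> * (card V)\<^sup>2" using assms(3) unfolding is_model_def by force
    then have "\<epsilon> \<ge> 0 \<or> card V = 0" by (auto simp: zero_le_mult_iff)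
    then show "0 \<le> card (pairs k) * \<epsilon> * card V ^ k" using k3 by (auto simp: power_0_left)
  qed (use finC in simp)
  finally show ?thesis .
qed

end

section \<open>Stability for graphs with colour lists\<close>

lemma pc_edges_Collect:
  assumes "finite V" "E \<subseteq> Kedges V"
  shows "pc V V (\<lambda>x y. {x, y} \<in> E \<and> Q {x, y}) = 2 * card {e \<in> E. Q e}"
proof -
  have "{e \<in> E. Q e} \<subseteq> Kedges V" using assms(2) by auto
  from pc_edges[OF assms(1) this] show ?thesis by simp
qed

context two_class_pattern
begin

abbreviation "m \<equiv> k - 1"

lemma power_k: "(n :: real)\<^sup>2 * n ^ (k - 2) = n ^ k"
proof -
  have "2 + (k - 2) = k" using k3 by simp
  then show ?thesis by (metis power_add)
qed

lemma m_ge: "m \<ge> 2" using k3 by simp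

text \<open>On such a clique all lists share \<open>i\<close> and have size at least two, which is
  the situation of \<open>realize_common_colour\<close>.\<close>

lemma cliques_le_listable:
  assumes "finite V"
  shows "cliques k (\<lambda>x y. {x, y} \<in> E \<and> i \<in> allowed U \<delta> {x, y} \<and> card (allowed U \<delta> {x, y}) \<ge> 2) V
    \<le> card (listable U \<delta> V E)"
  unfolding cliques_def
proof (rule card_mono)
  show "finite (listable U \<delta> V E)" unfolding listable_def
    using assms by (intro finite_subset[OF _ finite_PiE[of "{..<k}" "\<lambda>_. V"]]) auto
  show "{x \<in> {..<k} \<rightarrow>\<^sub>E V. \<forall>a<k. \<forall>b<a. {x a, x b} \<in> E \<and> i \<in> allowed U \<delta> {x a, x b} \<and> card (allowed U \<delta> {x a, x b}) \<ge> 2}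
    \<subseteq> listable U \<delta> V E"
  proof
    fix x assume x: "x \<in> {x \<in> {..<k} \<rightarrow>\<^sub>E V. \<forall>a<k. \<forall>b<a. {x a, x b} \<in> E \<and> i \<in> allowed U \<delta> {x a, x b} \<and> card (allowed U \<delta> {x a, x b}) \<ge> 2}"
    have *: "x ` e \<in> E \<and> i \<in> allowed U \<delta> (x ` e) \<and> card (allowed U \<delta> (x ` e)) \<ge> 2" if e: "e \<in> KK" for e
    proof -
      obtain b a where "e = {b, a}" "b < a" "a < k" using e by (rule KK_E)
      then show ?thesis using x by (auto simp: insert_commute)
    qed
    have "\<exists>col. realizes col \<and> (\<forall>e\<in>KK. col e \<in> allowed U \<delta> (x ` e))"
      by (rule realize_common_colour[where L = "\<lambda>e. allowed U \<delta> (x ` e)"]) (use * allowed_sub in auto)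
    then show "x \<in> listable U \<delta> V E" using x * by (auto simp: listable_def)
  qed
qed

lemma sum_allowed_ge_2:
  assumes "finite E"
  shows "(\<Sum>i<3. card {e \<in> E. i \<in> allowed U \<delta> e \<and> card (allowed U \<delta> e) \<ge> 2})
    = 2 * card {e \<in> E. card (allowed U \<delta> e) = 2} + 3 * card {e \<in> E. card (allowed U \<delta> e) = 3}"
proof -
  let ?c = "\<lambda>e. card (allowed U \<delta> e)"
  have "(\<Sum>i<3. card {e \<in> E. i \<in> allowed U \<delta> e \<and> ?c e \<ge> 2})
    = (\<Sum>i<3. \<Sum>e\<in>E. if i \<in> allowed U \<delta> e \<and> ?c e \<ge> 2 then 1 else 0)"
    using assms by (simp add: sum.If_cases Int_def)
  also have "\<dots> = (\<Sum>e\<in>E. \<Sum>i<3. if i \<in> allowed U \<delta> e \<and> ?c e \<ge> 2 then 1 else 0)" by (rule sum.swap)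
  also have "\<dots> = (\<Sum>e\<in>E. (if ?c e = 2 then 2 else 0) + (if ?c e = 3 then 3 else 0))"
  proof (rule sum.cong)
    fix e
    have "{..<3} \<inter> {i. i \<in> allowed U \<delta> e} = allowed U \<delta> e" using allowed_sub by blast
    then have "(\<Sum>i<3. if i \<in> allowed U \<delta> e \<and> ?c e \<ge> 2 then 1 else 0) = (if ?c e \<ge> 2 then ?c e else 0)"
      by (cases "?c e \<ge> 2") (simp_all add: sum.If_cases)
    then show "(\<Sum>i<3. if i \<in> allowed U \<delta> e \<and> ?c e \<ge> 2 then 1 else 0) = (if ?c e = 2 then 2 else 0) + (if ?c e = 3 then 3 else (0::nat))"
      using card_allowed[of U \<delta> e] by auto
  qed simp
  also have "\<dots> = 2 * card {e \<in> E. ?c e = 2} + 3 * card {e \<in> E. ?c e = 3}"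
    using assms by (simp add: sum.distrib sum.If_cases Int_def)
  finally show ?thesis .
qed

text \<open>With \<open>e\<^sub>2\<close> and \<open>e\<^sub>3\<close> edges having two and three allowed colours, \<open>2 e\<^sub>2 + 3 e\<^sub>3\<close> counts the edges of the
  three graphs of \<open>cliques_le_listable\<close>, each of which has at most about \<open>tur m n\<close> edges.\<close>

lemma list_graph_stability:
  fixes g :: real
  assumes "g > 0"
  shows "\<exists>\<eta>>0. \<forall>V E U \<delta>. finite V \<longrightarrow> V \<noteq> {} \<longrightarrow> E \<subseteq> Kedges V \<longrightarrow> card (listable U \<delta> V E) \<le> (\<eta> :: real) * card V ^ k \<longrightarrow>
    tur m (card V) - g * (card V)\<^sup>2 \<le> 16 / 25 * card {e \<in> E. card (allowed U \<delta> e) = 2} + card {e \<in> E. card (allowed U \<delta> e) = 3} \<longrightarrow>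
    (\<exists>f. f ` V \<subseteq> {..<m} \<and>
      pc V V (\<lambda>x y. f x \<noteq> f y \<and> \<not> ({x, y} \<in> E \<and> card (allowed U \<delta> {x, y}) = 3)) \<le> 198 * g * (card V)\<^sup>2 \<and>
      2 * tur m (card V) - 100 * g * (card V)\<^sup>2 \<le> pc V V (\<lambda>x y. f x \<noteq> f y))"
proof -
  obtain \<eta> :: real where "\<eta> > 0" and \<eta>: "\<And>(V :: nat set) A (N :: real). finite V \<Longrightarrow> card V \<le> N \<Longrightarrow> N > 0 \<Longrightarrow>
    (\<forall>x y. A x y \<longrightarrow> A y x) \<Longrightarrow> cliques (Suc (Suc (k - 2))) A V \<le> \<eta> * N ^ Suc (Suc (k - 2)) \<Longrightarrow>
    (\<exists>f. f ` V \<subseteq> {..<Suc (k - 2)} \<and>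
      pc V V A + pc V V (\<lambda>x y. A x y \<and> f x = f y) \<le> pc V V (\<lambda>x y. f x \<noteq> f y) + 2 * g * N\<^sup>2)"
    using few_cliques_partition[of "2 * g" "k - 2", where 'a = nat] assms by auto
  show ?thesis
  proof (intro exI[of _ \<eta>] conjI allI impI \<open>\<eta> > 0\<close>)
    fix V :: "nat set" and E U \<delta>
    assume V: "finite V" "V \<noteq> {}" "E \<subseteq> Kedges V" and few: "card (listable U \<delta> V E) \<le> \<eta> * card V ^ k"
      and big: "tur m (card V) - g * (card V)\<^sup>2 \<le> 16 / 25 * card {e \<in> E. card (allowed U \<delta> e) = 2} + card {e \<in> E. card (allowed U \<delta> e) = 3}"
    define n2 where "n2 = (real (card V))\<^sup>2"
    define T where "T = real (tur m (card V))"
    define e2 where "e2 = real (card {e \<in> E. card (allowed U \<delta> e) = 2})"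
    define e3 where "e3 = real (card {e \<in> E. card (allowed U \<delta> e) = 3})"
    have fE: "finite E" using V finite_Kedges finite_subset by blast
    define A where "A i x y \<longleftrightarrow> {x, y} \<in> E \<and> i \<in> allowed U \<delta> {x, y} \<and> card (allowed U \<delta> {x, y}) \<ge> 2" for i x y
    have kk: "Suc (Suc (k - 2)) = k" "Suc (k - 2) = m" using k3 by auto
    have ex: "\<exists>f. f ` V \<subseteq> {..<m} \<and>
      pc V V (A i) + pc V V (\<lambda>x y. A i x y \<and> f x = f y) \<le> pc V V (\<lambda>x y. f x \<noteq> f y) + 2 * g * n2" for i
      unfolding n2_def
    proof (rule \<eta>[unfolded kk(1), unfolded kk(2)])
      show "\<forall>x y. A i x y \<longrightarrow> A i y x" by (simp add: A_def insert_commute)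
      have "real (cliques k (A i) V) \<le> card (listable U \<delta> V E)"
        using cliques_le_listable[OF V(1), of E i U \<delta>] unfolding A_def by simp
      then show "cliques k (A i) V \<le> \<eta> * real (card V) ^ k" using few by simp
    qed (use V in \<open>auto simp: card_gt_0_iff\<close>)
    have cutT: "real (pc V V (\<lambda>x y. f x \<noteq> f y)) \<le> 2 * T" if "f ` V \<subseteq> {..<m}" for f :: "nat \<Rightarrow> nat"
      using cut_le_tur[OF V(1) _ that] m_ge unfolding T_def by simp
    have Ai: "pc V V (A i) = 2 * card {e \<in> E. i \<in> allowed U \<delta> e \<and> card (allowed U \<delta> e) \<ge> 2}" for i
      unfolding A_def by (rule pc_edges_Collect[OF V(1,3)])
    have "real (pc V V (A i)) \<le> 2 * T + 2 * g * n2" for i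
      using ex[of i] cutT by fastforce
    then have "(\<Sum>i<3. real (pc V V (A i))) \<le> (\<Sum>i<3::nat. 2 * T + 2 * g * n2)" by (intro sum_mono)
    moreover have "(\<Sum>i<3. real (pc V V (A i))) = 2 * (2 * e2 + 3 * e3)"
    proof -
      have "(\<Sum>i<3. real (pc V V (A i))) = 2 * real (\<Sum>i<3. card {e \<in> E. i \<in> allowed U \<delta> e \<and> card (allowed U \<delta> e) \<ge> 2})"
        unfolding Ai by (simp add: sum_distrib_left)
      then show ?thesis unfolding sum_allowed_ge_2[OF fE] by (simp add: e2_def e3_def)
    qed
    ultimately have 1: "2 * e2 + 3 * e3 \<le> 3 * T + 3 * g * n2" by simp
    have 2: "T - g * n2 \<le> 16 / 25 * e2 + e3" using big unfolding T_def n2_def e2_def e3_def by simp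
    \<comment> \<open>Three times fact 2 compared with fact 1 leaves
      \<open>2/25 * e2 \<le> 6 * g * n2\<close>, so \<open>e2\<close> is at most
      \<open>75 * g * n2\<close>, and 49 is \<open>1 + 16/25 * 75\<close>.\<close>
    have e3: "e3 \<ge> T - 49 * g * n2" using 1 2 by linarith
    obtain f where f: "f ` V \<subseteq> {..<m}"
      "pc V V (A 0) + pc V V (\<lambda>x y. A 0 x y \<and> f x = f y) \<le> pc V V (\<lambda>x y. f x \<noteq> f y) + 2 * g * n2"
      using ex[of 0] by blast
    define H where "H x y \<longleftrightarrow> {x, y} \<in> E \<and> card (allowed U \<delta> {x, y}) = 3" for x y
    have H3: "real (pc V V H) = 2 * e3" unfolding H_def e3_def
      using pc_edges_Collect[OF V(1,3), of "\<lambda>e. card (allowed U \<delta> e) = 3"] by simp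
    have HA: "A 0 x y" if "H x y" for x y
      using that allowed_full[of U \<delta> "{x, y}"] by (auto simp: H_def A_def)
    have A0: "real (pc V V (A 0)) \<ge> 2 * e3"
      unfolding H3[symmetric] using pc_mono[OF V(1,1) HA] by simp
    have int: "real (pc V V (\<lambda>x y. H x y \<and> f x = f y)) \<le> pc V V (\<lambda>x y. A 0 x y \<and> f x = f y)"
      using HA by (intro of_nat_mono pc_mono V(1)) auto
    have "pc V V H = pc V V (\<lambda>x y. H x y \<and> f x \<noteq> f y) + pc V V (\<lambda>x y. H x y \<and> f x = f y)"
      using pc_split[OF V(1,1), of H "\<lambda>x y. f x \<noteq> f y"] by simp
    moreover have "pc V V (\<lambda>x y. f x \<noteq> f y) = pc V V (\<lambda>x y. f x \<noteq> f y \<and> H x y) + pc V V (\<lambda>x y. f x \<noteq> f y \<and> \<not> H x y)"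
      by (rule pc_split[OF V(1,1)])
    moreover have "pc V V (\<lambda>x y. f x \<noteq> f y \<and> H x y) = pc V V (\<lambda>x y. H x y \<and> f x \<noteq> f y)"
      by (rule pc_cong) auto
    \<comment> \<open>The graph \<open>A 0\<close> has at least \<open>2 * T - 98 * g * n2\<close>
      ordered pairs and the cut at most \<open>2 * T\<close>, so at most \<open>100 * g * n2\<close>
      pairs of \<open>A 0\<close> lie inside classes. With the deficit \<open>98 * g * n2\<close> of
      \<open>H\<close> this makes 198.\<close>
    ultimately have "real (pc V V (\<lambda>x y. f x \<noteq> f y \<and> \<not> H x y)) \<le> 198 * g * n2"
      "2 * T - 100 * g * n2 \<le> pc V V (\<lambda>x y. f x \<noteq> f y)"
      using cutT[OF f(1)] f(2) A0 int H3 e3 by linarith+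
    then show "\<exists>f. f ` V \<subseteq> {..<m} \<and>
      pc V V (\<lambda>x y. f x \<noteq> f y \<and> \<not> ({x, y} \<in> E \<and> card (allowed U \<delta> {x, y}) = 3)) \<le> 198 * g * (card V)\<^sup>2 \<and>
      2 * tur m (card V) - 100 * g * (card V)\<^sup>2 \<le> pc V V (\<lambda>x y. f x \<noteq> f y)"
      using f(1) unfolding H_def T_def n2_def by (intro exI[of _ f]) simp
  qed
qed

lemma card_tuples_through:
  assumes "finite V" "M \<subseteq> V \<times> V" "(i, j) \<in> pairs k"
  shows "card {x \<in> {..<k} \<rightarrow>\<^sub>E V. (x i, x j) \<in> M} \<le> card M * card V ^ (k - 2)"
proof -
  have finT: "finite ({..<k} \<rightarrow>\<^sub>E V)" using assms(1) by (intro finite_PiE) auto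
  let ?D = "\<lambda>x y. if (x, y) \<in> M then 1 else (0::real)"
  have "\<bar>\<Sum>x\<in>{..<k} \<rightarrow>\<^sub>E V. ?D (x i) (x j) * (\<Prod>e\<in>pairs k - {(i, j)}. 1)\<bar> \<le> real (card M) * card V ^ (k - 2)"
  proof (rule counting_one_pair[OF assms(1,3), where H = "\<lambda>_ _ _. 1"])
    fix S T assume ST: "S \<subseteq> V" "T \<subseteq> V"
    then have fin: "finite S" "finite T" using assms(1) finite_subset by auto
    have fM: "finite M" using assms(1,2) finite_subset by blast
    have "(\<Sum>x\<in>S. \<Sum>y\<in>T. ?D x y) = (\<Sum>z\<in>S \<times> T. if z \<in> M then 1 else 0)"
      by (simp add: sum.cartesian_product case_prod_unfold)
    also have "\<dots> = card ((S \<times> T) \<inter> M)" using fin by (simp add: sum.If_cases)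
    also have "\<dots> \<le> card M" using fM by (intro of_nat_mono card_mono) auto
    finally show "\<bar>\<Sum>x\<in>S. \<Sum>y\<in>T. ?D x y\<bar> \<le> real (card M)" by (simp add: abs_le_iff sum_nonneg)
  qed auto
  moreover have "(\<Sum>x\<in>{..<k} \<rightarrow>\<^sub>E V. ?D (x i) (x j)) = card {x \<in> {..<k} \<rightarrow>\<^sub>E V. (x i, x j) \<in> M}"
    using finT by (simp add: sum.If_cases Int_def)
  ultimately have "real (card {x \<in> {..<k} \<rightarrow>\<^sub>E V. (x i, x j) \<in> M}) \<le> real (card M * card V ^ (k - 2))"
    by simp
  then show ?thesis by linarith
qed

text \<open>Combine an edge inside one class with one vertex from each other class. Apart from the
  few tuples through a cross pair without full list, only the list of the interior edge is
  restricted, so \<open>realize_one_edge\<close> applies.\<close>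

lemma interior_listable:
  fixes \<beta> \<mu> s :: real
  assumes V: "finite V" "E \<subseteq> Kedges V" and f: "f ` V \<subseteq> {..<m}"
    and missing: "pc V V (\<lambda>x y. f x \<noteq> f y \<and> \<not> ({x, y} \<in> E \<and> card (allowed U \<delta> {x, y}) = 3)) \<le> \<mu> * (card V)\<^sup>2"
    and parts: "\<And>p. p < m \<Longrightarrow> card {x \<in> V. f x = p} \<ge> s * card V" and "s \<ge> 0"
    and interior: "pc V V (\<lambda>x y. f x = f y \<and> {x, y} \<in> E \<and> allowed U \<delta> {x, y} \<noteq> {}) \<ge> \<beta> * (card V)\<^sup>2"
  shows "(\<beta> / m * s ^ (k - 2) - card (pairs k) * \<mu>) * card V ^ k \<le> card (listable U \<delta> V E)"
proof -
  define n where "n = real (card V)"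
  define I where "I p = {(x, y) \<in> V \<times> V. f x = p \<and> f y = p \<and> {x, y} \<in> E \<and> allowed U \<delta> {x, y} \<noteq> {}}" for p
  define M where "M = {(x, y) \<in> V \<times> V. f x \<noteq> f y \<and> \<not> ({x, y} \<in> E \<and> card (allowed U \<delta> {x, y}) = 3)}"
  have finI: "finite (I p)" for p using V(1) by (auto simp: I_def intro: finite_subset[of _ "V \<times> V"])
  have finT: "finite ({..<k} \<rightarrow>\<^sub>E V)" using V(1) by (intro finite_PiE) auto
  \<comment> \<open>Some class holds an average share of the interior pairs. The tuples send 0 and 1
    there and \<open>{2..<k}\<close> bijectively to the other \<open>k - 2\<close> classes.\<close>
  have "\<exists>p<m. real (card (I p)) \<ge> \<beta> / m * n\<^sup>2"
  proof (rule ccontr)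
    assume "\<not> ?thesis"
    then have lt: "real (card (I p)) < \<beta> / m * n\<^sup>2" if "p < m" for p using that by force
    have "{(x, y) \<in> V \<times> V. f x = f y \<and> {x, y} \<in> E \<and> allowed U \<delta> {x, y} \<noteq> {}} = (\<Union>p<m. I p)"
      using f by (auto simp: I_def)
    then have "pc V V (\<lambda>x y. f x = f y \<and> {x, y} \<in> E \<and> allowed U \<delta> {x, y} \<noteq> {}) = card (\<Union>p<m. I p)"
      unfolding pc_def by simp
    also have "\<dots> \<le> (\<Sum>p<m. card (I p))" by (rule card_UN_le) simp
    finally have "\<beta> * n\<^sup>2 \<le> (\<Sum>p<m. real (card (I p)))" using interior unfolding n_def by (simp add: of_nat_sum[symmetric] del: of_nat_sum)
    also have "\<dots> < (\<Sum>p<m. \<beta> / m * n\<^sup>2)"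
      by (rule sum_strict_mono) (use lt m_ge in \<open>auto simp: lessThan_empty_iff\<close>)
    finally show False using m_ge by simp
  qed
  then obtain p where p: "p < m" "real (card (I p)) \<ge> \<beta> / m * n\<^sup>2" by blast
  have "card {2..<k} = card ({..<m} - {p})" using p(1) by simp
  then obtain \<pi> where \<pi>: "bij_betw \<pi> {2..<k} ({..<m} - {p})"
    using finite_same_card_bij[of "{2..<k}" "{..<m} - {p}"] by auto
  define Q where "Q = {x \<in> {..<k} \<rightarrow>\<^sub>E V. (x 0, x 1) \<in> I p \<and> (\<forall>j\<in>{2..<k}. f (x j) = \<pi> j)}"
  have finQ: "finite Q" using finT by (simp add: Q_def)
  have Qcard: "\<beta> / m * s ^ (k - 2) * n ^ k \<le> card Q"
  proof -
    let ?G = "PiE {2..<k} (\<lambda>j. {x \<in> V. f x = \<pi> j})"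
    let ?h = "\<lambda>((a, b), g). g(0 := a, Suc 0 := b)"
    have "(s * n) ^ (k - 2) = (\<Prod>j\<in>{2..<k}. s * n)" by simp
    also have "\<dots> \<le> (\<Prod>j\<in>{2..<k}. real (card {x \<in> V. f x = \<pi> j}))"
    proof (rule prod_mono, intro conjI)
      fix j assume "j \<in> {2..<k}"
      then have "\<pi> j < m" using \<pi> by (auto simp: bij_betw_def)
      then show "s * n \<le> real (card {x \<in> V. f x = \<pi> j})" using parts by (simp add: n_def)
    qed (use assms(6) in \<open>simp add: n_def\<close>)
    also have "\<dots> = card ?G" by (simp add: card_PiE)
    finally have G: "(s * n) ^ (k - 2) \<le> card ?G" .
    have inj: "inj_on ?h (I p \<times> ?G)"
    proof (rule inj_onI)
      fix u v assume uv: "u \<in> I p \<times> ?G" "v \<in> I p \<times> ?G" "?h u = ?h v"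
      obtain a b g a' b' g' where u: "u = ((a, b), g)" "v = ((a', b'), g')" by (metis surj_pair)
      have g: "g \<in> ?G" "g' \<in> ?G" and eq: "g(0 := a, Suc 0 := b) = g'(0 := a', Suc 0 := b')"
        using uv u by auto
      have "g z = g' z" for z
        using fun_cong[OF eq, of z] g by (cases "z < 2") (auto simp: PiE_def extensional_def split: if_splits)
      then show "u = v" using u fun_cong[OF eq, of 0] fun_cong[OF eq, of 1] by auto
    qed
    have "?h ` (I p \<times> ?G) \<subseteq> Q"
    proof
      fix x assume "x \<in> ?h ` (I p \<times> ?G)"
      then obtain a b g where x: "x = g(0 := a, Suc 0 := b)" "(a, b) \<in> I p" "g \<in> ?G" by auto
      then have "a \<in> V" "b \<in> V" by (auto simp: I_def)
      moreover have "x i \<in> V" if "i < k" for i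
        using that x calculation by (cases "i < 2") (auto simp: PiE_def Pi_def)
      moreover have "x i = undefined" if "\<not> i < k" for i
        using that x k3 by (auto simp: PiE_def extensional_def)
      moreover have "f (x j) = \<pi> j" if "j \<in> {2..<k}" for j using that x by (auto simp: PiE_def Pi_def)
      ultimately show "x \<in> Q" using x(1,2) by (auto simp: Q_def PiE_def Pi_def extensional_def)
    qed
    then have "card (I p \<times> ?G) \<le> card Q" by (rule card_inj_on_le[OF inj _ finQ])
    then have "real (card (I p) * card ?G) \<le> card Q" unfolding card_cartesian_product by (rule of_nat_mono)
    then have "real (card (I p)) * card ?G \<le> card Q" unfolding of_nat_mult .
    moreover have "\<beta> / m * n\<^sup>2 * (s * n) ^ (k - 2) \<le> real (card (I p)) * card ?G"
      using p(2) G assms(6) by (intro mult_mono) (auto simp: n_def)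
    moreover note power_k[of n, symmetric]
    ultimately show ?thesis by (simp add: power_mult_distrib mult_ac)
  qed
  define X where "X = (\<Union>e\<in>pairs k. {x \<in> {..<k} \<rightarrow>\<^sub>E V. (x (fst e), x (snd e)) \<in> M})"
  have Xcard: "card X \<le> card (pairs k) * \<mu> * n ^ k"
  proof -
    have "card X \<le> (\<Sum>e\<in>pairs k. card {x \<in> {..<k} \<rightarrow>\<^sub>E V. (x (fst e), x (snd e)) \<in> M})"
      unfolding X_def by (rule card_UN_le[OF finite_pairs])
    also have "\<dots> \<le> (\<Sum>e\<in>pairs k. card M * card V ^ (k - 2))"
      by (rule sum_mono, rule card_tuples_through) (use V(1) in \<open>auto simp: M_def\<close>)
    finally have "card X \<le> card (pairs k) * (card M * card V ^ (k - 2))" by simp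
    then have "real (card X) \<le> card (pairs k) * (card M * n ^ (k - 2))"
      unfolding n_def by (metis of_nat_mono of_nat_mult of_nat_power)
    also have "\<dots> \<le> card (pairs k) * (\<mu> * n\<^sup>2 * n ^ (k - 2))"
      using missing by (intro mult_left_mono mult_right_mono) (auto simp: n_def M_def pc_def)
    also have "\<dots> = card (pairs k) * \<mu> * (n\<^sup>2 * n ^ (k - 2))" by (simp only: mult_ac)
    also note power_k
    finally show ?thesis .
  qed
  have "Q - X \<subseteq> listable U \<delta> V E"
  proof
    fix x assume x: "x \<in> Q - X"
    have xV: "x \<in> {..<k} \<rightarrow>\<^sub>E V" using x by (simp add: Q_def)
    have e0: "{x 0, x 1} \<in> E" "allowed U \<delta> {x 0, x 1} \<noteq> {}" "f (x 0) = p" "f (x 1) = p"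
      using x by (auto simp: Q_def I_def)
    have *: "x ` e \<in> E \<and> card (allowed U \<delta> (x ` e)) = 3" if e: "e \<in> KK" "e \<noteq> {0, 1}" for e
    proof -
      obtain a b where ab: "e = {a, b}" "a < b" "b < k" using e(1) by (rule KK_E)
      have b2: "b \<ge> 2" using ab e(2) by (cases "b = 1") auto
      then have fb: "f (x b) = \<pi> b" "\<pi> b \<noteq> p" using x ab \<pi> by (auto simp: Q_def bij_betw_def)
      have "f (x a) \<noteq> f (x b)"
      proof (cases "a < 2")
        case True
        then have "f (x a) = p" using e0 by (cases "a = 0") (auto simp: less_2_cases_iff)
        then show ?thesis using fb by simp
      next
        case False
        then have "f (x a) = \<pi> a" using x ab by (auto simp: Q_def)
        moreover have "\<pi> a \<noteq> \<pi> b" 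
          using inj_onD[OF bij_betw_imp_inj_on[OF \<pi>], of a b] False ab by auto
        ultimately show ?thesis using fb by simp
      qed
      moreover have "(x a, x b) \<notin> M"
      proof -
        have "(a, b) \<in> pairs k" using ab by (simp add: pairs_def)
        then show ?thesis using x xV unfolding X_def by force
      qed
      moreover have "x a \<in> V" "x b \<in> V" using PiE_mem[OF xV] ab(2,3) by simp_all
      ultimately have "{x a, x b} \<in> E \<and> card (allowed U \<delta> {x a, x b}) = 3" unfolding M_def by blast
      then show ?thesis unfolding ab(1) by simp
    qed
    have "\<exists>col. realizes col \<and> (\<forall>e\<in>KK. col e \<in> allowed U \<delta> (x ` e))"
    proof -
      have "x ` {0, 1} = {x 0, x 1}" by simp
      then obtain a where a: "a \<in> allowed U \<delta> (x ` {0, 1})" using e0(2) by (metis equals0I)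
      show ?thesis
      proof (rule realize_one_edge[of "{0, 1}" a "\<lambda>e. allowed U \<delta> (x ` e)"])
        show "{0, 1} \<in> KK" using k3 by simp
        show "{..<3} \<subseteq> allowed U \<delta> (x ` e)" if "e \<in> KK" "e \<noteq> {0, 1}" for e
          using *[OF that] allowed_full by blast
        show "a < 3" using a by (simp add: allowed_def)
      qed (rule a)
    qed
    moreover have "x ` e \<in> E" if "e \<in> KK" for e
      using *[OF that] e0(1) by (cases "e = {0, 1}") simp_all
    ultimately show "x \<in> listable U \<delta> V E" unfolding listable_def using xV by blast
  qed
  moreover have "finite (listable U \<delta> V E)" unfolding listable_def using finT by auto
  ultimately have "card (Q - X) \<le> card (listable U \<delta> V E)" by (intro card_mono)
  moreover have "card Q - card X \<le> card (Q - X)"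
    by (rule diff_card_le_card_Diff) (use finT finite_pairs in \<open>auto simp: X_def\<close>)
  ultimately have "real (card Q) - card X \<le> card (listable U \<delta> V E)" by linarith
  then show ?thesis using Qcard Xcard by (simp add: n_def left_diff_distrib)
qed

end

section \<open>Few edges inside the classes: the choice of constants\<close>

lemma powr_near_one:
  fixes x l :: real
  assumes "x > 0" "l > 1"
  shows "\<exists>t>0. \<forall>s. \<bar>s\<bar> \<le> t \<longrightarrow> x powr s \<le> l"
proof (intro exI[of _ "ln l / (\<bar>ln x\<bar> + 1)"] conjI allI impI)
  show "ln l / (\<bar>ln x\<bar> + 1) > 0" using assms by (simp add: ln_gt_zero)
  fix s assume s: "\<bar>s\<bar> \<le> ln l / (\<bar>ln x\<bar> + 1)"
  have "s * ln x \<le> \<bar>s\<bar> * \<bar>ln x\<bar>" by (simp add: abs_mult[symmetric])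
  also have "\<dots> \<le> \<bar>s\<bar> * (\<bar>ln x\<bar> + 1)" by (simp add: mult_left_mono)
  also have "\<dots> \<le> ln l" using s by (simp add: field_simps)
  finally have "exp (s * ln x) \<le> exp (ln l)" by simp
  then show "x powr s \<le> l" using assms by (simp add: powr_def)
qed

text \<open>The exponent is chosen between $\log_3 2$ and $2/3$: the gap to $2/3$ makes edges with two
  allowed colours wasteful in \<open>list_graph_stability\<close>.\<close>

lemma two_le_three_powr: "2 \<le> (3 :: real) powr (16 / 25)"
proof -
  have "((3 :: real) powr (16 / 25)) ^ 25 = 3 powr (16 / 25 * real 25)" by (simp only: powr_powr[symmetric] powr_realpow[symmetric] powr_gt_zero zero_less_numeral)
  also have "\<dots> = 3 ^ 16" by (simp add: powr_realpow[symmetric])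
  finally have "(2 :: real) ^ 25 \<le> (3 powr (16 / 25)) ^ 25" by simp
  then show ?thesis by (rule power_le_imp_le_base[of _ 24, simplified]) simp
qed

text \<open>For \<open>q \<le> 6 * 4 ^ n\<close> tests, \<open>13 * 4 ^ n\<close> is at least
  \<open>2 * q + 1\<close>, so the left side bounds the number of models. The 4 in the threshold
  comes from \<open>13 * 4 \<le> 3 ^ 4\<close>.\<close>

lemma quadratic_dominates:
  fixes g :: real
  assumes "g > 0" "n \<ge> 1" "real n \<ge> 4 * l / g"
  shows "(13 * 4 ^ n) ^ l \<le> (3 :: real) powr (g * (real n)\<^sup>2)"
proof -
  have "(13 * 4 ^ n :: real) \<le> 13 ^ n * 4 ^ n"
    using assms(2) power_increasing[of 1 n "13 :: real"] by (intro mult_right_mono) auto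
  also have "\<dots> = 52 ^ n" by (simp flip: power_mult_distrib)
  also have "\<dots> \<le> (3 ^ 4) ^ n" by (rule power_mono) auto
  finally have "(13 * 4 ^ n :: real) ^ l \<le> ((3 ^ 4) ^ n) ^ l" by (rule power_mono) simp
  also have "\<dots> = 3 powr real (4 * n * l)" by (simp add: powr_realpow power_mult del: of_nat_mult)
  also have "\<dots> \<le> 3 powr (g * (real n)\<^sup>2)"
  proof (rule powr_mono)
    have "4 * real l \<le> g * real n" using assms by (simp add: field_simps)
    then have "4 * real l * real n \<le> g * real n * real n" by (rule mult_right_mono) simp
    then show "real (4 * n * l) \<le> g * (real n)\<^sup>2" by (simp add: power2_eq_square mult_ac)
  qed simp
  finally show ?thesis .
qed

context two_class_pattern
begin

text \<open>Some model is shared by at least an average number of colourings. Three losses in the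
  exponent, each \<open>g / 3\<close> times the squared order, add up to \<open>g\<close>: the
  number of models, the weight of the unlisted edges, and the factor \<open>1 + 3 * z\<close> per
  edge. What remains is the number of colourings from the lists.\<close>

lemma many_colourings_model:
  fixes z \<delta> \<epsilon> g :: real
  assumes V: "finite V" "V \<noteq> {}" "E \<subseteq> Kedges V" and count: "3 ^ T < c_count 3 k P E"
    and z: "0 < z" "z \<le> 1" "1 + 3 * z \<le> 3 powr (g / 3)"
    and \<delta>: "0 < \<epsilon>" "\<epsilon> \<le> \<delta>" "z powr (- 6 * \<delta>) \<le> 3 powr (g / 3)"
    and l: "l * \<epsilon>\<^sup>2 > 3" and big: "(13 * 4 ^ card V) ^ l \<le> 3 powr (g / 3 * (card V)\<^sup>2)"
  shows "\<exists>c U. c \<in> avoiding_colorings 3 k P E \<and> is_model \<epsilon> \<delta> V E c U \<and>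
    T - g * (card V)\<^sup>2 \<le> 16 / 25 * card {e \<in> E. card (allowed U \<delta> e) = 2} + card {e \<in> E. card (allowed U \<delta> e) = 3}"
proof -
  define n2 where "n2 = (real (card V))\<^sup>2"
  have fE: "finite E" using V finite_Kedges finite_subset by blast
  define Cs where "Cs = avoiding_colorings 3 k P E"
  have finC: "finite Cs" unfolding Cs_def avoiding_colorings_def
    using fE by (intro finite_subset[OF _ finite_PiE[of E "\<lambda>_. {..<3::nat}"]]) auto
  define cl where "cl U = {c \<in> Cs. is_model \<epsilon> \<delta> V E c U}" for U
  let ?Ms = "models \<epsilon> (tests \<delta> V) l"
  have M: "finite ?Ms" "card ?Ms \<le> (13 * 4 ^ card V) ^ l"
  proof -
    have *: "finite ?Ms \<and> card ?Ms \<le> (2 * (6 * 4 ^ card V) + 1) ^ l"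
      by (rule card_models) (use card_tests[OF V(1)] in auto)
    then show "finite ?Ms" by blast
    have "(2 * (6 * 4 ^ card V) + 1) ^ l \<le> (13 * 4 ^ card V :: nat) ^ l" by (rule power_mono) auto
    then show "card ?Ms \<le> (13 * 4 ^ card V) ^ l" using * by linarith
  qed
  have Mr: "real (card ?Ms) \<le> 3 powr (g / 3 * n2)"
  proof -
    have "real (card ?Ms) \<le> real ((13 * 4 ^ card V) ^ l)" using M(2) by (rule of_nat_mono)
    also have "\<dots> \<le> 3 powr (g / 3 * n2)" using big unfolding n2_def by simp
    finally show ?thesis .
  qed
  have "Cs = (\<Union>U\<in>?Ms. cl U)" using model_exists[OF V(1,2) \<delta>(1) l, of \<delta> E] by (auto simp: cl_def)
  then have "card Cs \<le> (\<Sum>U\<in>?Ms. card (cl U))" by (simp add: card_UN_le[OF M(1)])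
  then have sum: "3 ^ T < (\<Sum>U\<in>?Ms. real (card (cl U)))"
    using count unfolding c_count_def Cs_def[symmetric] by (simp flip: of_nat_sum)
  have "\<exists>U\<in>?Ms. 3 powr (T - g / 3 * n2) \<le> card (cl U)"
  proof (rule ccontr)
    assume "\<not> ?thesis"
    then have "(\<Sum>U\<in>?Ms. real (card (cl U))) \<le> (\<Sum>U\<in>?Ms. 3 powr (T - g / 3 * n2))" by (intro sum_mono) force
    also have "\<dots> \<le> 3 powr (g / 3 * n2) * 3 powr (T - g / 3 * n2)" using Mr by simp
    also have "\<dots> = 3 ^ T" by (simp add: powr_add[symmetric] powr_realpow)
    finally show False using sum by simp
  qed
  then obtain U where U: "U \<in> ?Ms" "3 powr (T - g / 3 * n2) \<le> card (cl U)" by blast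
  have "real (card (cl U)) > 0" by (rule less_le_trans[OF _ U(2)]) simp
  then obtain c where c: "c \<in> Cs" "is_model \<epsilon> \<delta> V E c U" unfolding cl_def by (auto simp: card_gt_0_iff)
  define e2 where "e2 = card {e \<in> E. card (allowed U \<delta> e) = 2}"
  define e3 where "e3 = card {e \<in> E. card (allowed U \<delta> e) = 3}"
  let ?r = "6 * \<delta> * n2"
  have "cl U \<subseteq> {c \<in> E \<rightarrow>\<^sub>E {..<3}. card {e \<in> E. c e \<notin> allowed U \<delta> e} \<le> ?r}"
  proof
    fix c assume "c \<in> cl U"
    then have c: "c \<in> E \<rightarrow>\<^sub>E {..<3}" "is_model \<epsilon> \<delta> V E c U" by (auto simp: cl_def Cs_def avoiding_colorings_def)
    then have "real (card {e \<in> E. c e \<notin> allowed U \<delta> e}) \<le> 3 * (\<delta> + \<epsilon>) * n2"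
      using model_few_unlisted[OF V(1,3) c(2,1)] \<delta> by (simp add: n2_def)
    also have "\<dots> \<le> ?r" using \<delta> by (intro mult_right_mono) (auto simp: n2_def)
    finally show "c \<in> {c \<in> E \<rightarrow>\<^sub>E {..<3}. card {e \<in> E. c e \<notin> allowed U \<delta> e} \<le> ?r}" using c by simp
  qed
  then have "card (cl U) \<le> card {c \<in> E \<rightarrow>\<^sub>E {..<3}. card {e \<in> E. c e \<notin> allowed U \<delta> e} \<le> ?r}"
    by (intro card_mono finite_subset[OF _ finite_PiE[of E "\<lambda>_. {..<3::nat}"]]) (use fE in auto)
  then have "real (card (cl U)) \<le> z powr (- ?r) * ((1 + 3 * z) ^ card E * (2 ^ e2 * 3 ^ e3))"
    using card_few_unlisted[OF fE z(1,2), of U \<delta> ?r] unfolding e2_def e3_def by linarith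
  also have "\<dots> \<le> 3 powr (g / 3 * n2) * (3 powr (g / 3 * n2) * (3 powr (16 / 25 * e2) * 3 powr e3))"
  proof (intro mult_mono)
    have "z powr (- ?r) = (z powr (- 6 * \<delta>)) powr n2" by (simp add: powr_powr mult_ac)
    also have "\<dots> \<le> (3 powr (g / 3)) powr n2" by (rule powr_mono2) (use \<delta> in \<open>auto simp: n2_def\<close>)
    finally show "z powr (- ?r) \<le> 3 powr (g / 3 * n2)" by (simp add: powr_powr)
    have "2 * card E \<le> card V * card V"
      using pc_edges[OF V(1,3)] pc_le[OF V(1,1), of "\<lambda>x y. {x, y} \<in> E"] by simp
    then have "real (2 * card E) \<le> real (card V * card V)" by (rule of_nat_mono)
    then have "real (card E) \<le> n2" unfolding n2_def by (simp add: power2_eq_square)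
    then have "(1 + 3 * z) powr card E \<le> (1 + 3 * z) powr n2" using z by (intro powr_mono) auto
    also have "\<dots> \<le> (3 powr (g / 3)) powr n2" by (rule powr_mono2) (use z in \<open>auto simp: n2_def\<close>)
    finally show "(1 + 3 * z) ^ card E \<le> 3 powr (g / 3 * n2)" using z by (simp add: powr_powr powr_realpow)
    have "(2::real) ^ e2 \<le> (3 powr (16 / 25)) ^ e2" by (rule power_mono[OF two_le_three_powr]) simp
    then show "2 ^ e2 \<le> (3 :: real) powr (16 / 25 * e2)" by (simp add: powr_powr flip: powr_realpow)
    show "(3 :: real) ^ e3 \<le> 3 powr e3" by (simp add: powr_realpow)
  qed (use z in auto)
  also have "\<dots> = 3 powr (2 * (g / 3 * n2) + (16 / 25 * e2 + e3))" by (simp flip: powr_add)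
  finally have "3 powr (T - g / 3 * n2) \<le> 3 powr (2 * (g / 3 * n2) + (16 / 25 * e2 + e3))" using U(2) by linarith
  then have "T - g / 3 * n2 \<le> 2 * (g / 3 * n2) + (16 / 25 * e2 + e3)" by simp
  then have "T - g * n2 \<le> 16 / 25 * e2 + e3" by linarith
  then show ?thesis using c unfolding Cs_def n2_def e2_def e3_def by auto
qed

lemma few_interior_edges:
  fixes \<gamma> :: real
  assumes "\<gamma> > 0"
  shows "\<exists>N. \<forall>V E. finite V \<longrightarrow> card V \<ge> N \<longrightarrow> E \<subseteq> Kedges V \<longrightarrow> 3 ^ tur m (card V) < c_count 3 k P E \<longrightarrow>
    (\<exists>f. f ` V \<subseteq> {..<m} \<and> pc V V (\<lambda>x y. f x = f y \<and> {x, y} \<in> E) \<le> \<gamma> * (card V)\<^sup>2)"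
proof -
  \<comment> \<open>Density of the tuples built on interior edges: half of the interior pairs are
    set aside for empty lists, one class has a share \<open>1 / m\<close> of the rest, and each of
    the other \<open>k - 2\<close> classes will have at least \<open>card V / (2 * m)\<close>
    vertices.\<close>
  define h where "h = \<gamma> / 2 / m * (1 / (2 * m)) ^ (k - 2)"
  have "h > 0" using assms m_ge k3 unfolding h_def by simp
  define q where "q = real (card (pairs k))"
  have "q \<ge> 0" by (simp add: q_def)
  \<comment> \<open>The first bound keeps the tuples through deficient cross pairs below
    \<open>h / 2\<close>, the second keeps every class above half of the average size.\<close>
  define g where "g = min (h / (396 * (q + 1))) (1 / (200 * (2 * m)\<^sup>2))"
  have "g > 0" using \<open>h > 0\<close> \<open>q \<ge> 0\<close> m_ge k3 unfolding g_def by simp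
  have g1: "q * (198 * g) \<le> h / 2"
  proof -
    have "q * (198 * g) \<le> (q + 1) * (198 * (h / (396 * (q + 1))))"
      using \<open>q \<ge> 0\<close> \<open>g > 0\<close> by (intro mult_mono) (auto simp: g_def)
    also have "\<dots> = h / 2" using \<open>q \<ge> 0\<close> by (simp add: field_simps)
    finally show ?thesis .
  qed
  have g2: "sqrt (2 * (100 * g)) \<le> 1 / (2 * m)"
  proof -
    have "g \<le> 1 / (200 * (2 * m)\<^sup>2)" unfolding g_def by (rule min.cobounded2)
    then have "2 * (100 * g) \<le> (1 / (2 * m))\<^sup>2" by (simp add: power_divide)
    then show ?thesis by (rule real_le_lsqrt[rotated -1]) (use m_ge \<open>g > 0\<close> in auto)
  qed
  obtain \<eta>0 :: real where "\<eta>0 > 0" and \<eta>0: "\<And>V E U \<delta>. finite V \<Longrightarrow> V \<noteq> {} \<Longrightarrow> E \<subseteq> Kedges V \<Longrightarrow>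
    card (listable U \<delta> V E) \<le> \<eta>0 * card V ^ k \<Longrightarrow>
    tur m (card V) - g * (card V)\<^sup>2 \<le> 16 / 25 * card {e \<in> E. card (allowed U \<delta> e) = 2} + card {e \<in> E. card (allowed U \<delta> e) = 3} \<Longrightarrow>
    (\<exists>f. f ` V \<subseteq> {..<m} \<and>
      pc V V (\<lambda>x y. f x \<noteq> f y \<and> \<not> ({x, y} \<in> E \<and> card (allowed U \<delta> {x, y}) = 3)) \<le> 198 * g * (card V)\<^sup>2 \<and>
      2 * tur m (card V) - 100 * g * (card V)\<^sup>2 \<le> pc V V (\<lambda>x y. f x \<noteq> f y))"
    using list_graph_stability[OF \<open>g > 0\<close>] by blast
  \<comment> \<open>The final contradiction is between a density of at least \<open>h / 2\<close>
    from the construction and at most \<open>h / 4\<close> of listable tuples.\<close>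
  define \<eta> where "\<eta> = min \<eta>0 (h / 4)"
  have "\<eta> > 0" using \<open>\<eta>0 > 0\<close> \<open>h > 0\<close> by (simp add: \<eta>_def)
  have g3: "3 powr (g / 3) > 1" using \<open>g > 0\<close> by simp
  define z where "z = min 1 ((3 powr (g / 3) - 1) / 3)"
  have z: "0 < z" "z \<le> 1" "1 + 3 * z \<le> 3 powr (g / 3)" 
  proof -
    show "0 < z" "z \<le> 1" using g3 by (auto simp: z_def)
    have "z \<le> (3 powr (g / 3) - 1) / 3" unfolding z_def by (rule min.cobounded2)
    moreover have "x \<le> (w - 1) / 3 \<Longrightarrow> 1 + 3 * x \<le> w" for x w :: real by simp
    ultimately show "1 + 3 * z \<le> 3 powr (g / 3)" by blast
  qed
  obtain t where t: "t > 0" "\<And>s. \<bar>s\<bar> \<le> t \<Longrightarrow> z powr s \<le> 3 powr (g / 3)"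
    using powr_near_one[OF z(1) g3] by blast
  \<comment> \<open>At most \<open>6 * \<delta> * n\<^sup>2\<close> edges are unlisted, twice as
    many in ordered pairs, so \<open>\<gamma> / 24\<close> keeps them within half of the interior
    pairs.\<close>
  define \<delta> where "\<delta> = min (\<gamma> / 24) (t / 6)"
  have \<delta>: "\<delta> > 0" "\<delta> \<le> \<gamma> / 24" using assms t(1) by (auto simp: \<delta>_def)
  have "\<bar>- 6 * \<delta>\<bar> \<le> t" using \<delta>(1) by (simp add: \<delta>_def min_def)
  then have \<delta>3: "z powr (- 6 * \<delta>) \<le> 3 powr (g / 3)" by (rule t(2))
  define K where "K = real (card (KK \<rightarrow>\<^sub>E {..<3::nat}))"
  have "K \<ge> 0" by (simp add: K_def)
  define \<epsilon> where "\<epsilon> = min \<delta> (\<eta> * \<delta> ^ card (pairs k) / (K * q + 1))"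
  have Kq: "K * q + 1 > 0" using \<open>K \<ge> 0\<close> \<open>q \<ge> 0\<close> by (simp add: add_nonneg_pos)
  have \<epsilon>: "\<epsilon> > 0" "\<epsilon> \<le> \<delta>" using \<delta> \<open>\<eta> > 0\<close> Kq by (auto simp: \<epsilon>_def)
  have \<epsilon>3: "K * (q * \<epsilon>) \<le> \<eta> * \<delta> ^ card (pairs k)"
  proof -
    have "K * (q * \<epsilon>) \<le> (K * q + 1) * \<epsilon>" using \<epsilon>(1) by (simp add: algebra_simps)
    also have "\<dots> \<le> (K * q + 1) * (\<eta> * \<delta> ^ card (pairs k) / (K * q + 1))"
      using Kq by (intro mult_left_mono) (auto simp: \<epsilon>_def)
    finally show ?thesis using Kq by simp
  qed
  obtain l :: nat where l: "3 / \<epsilon>\<^sup>2 < l" using reals_Archimedean2 by blast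
  then have l: "l * \<epsilon>\<^sup>2 > 3" using \<epsilon>(1) by (simp add: field_simps)
  obtain N :: nat where N: "N \<ge> 1" "N \<ge> 4 * l / (g / 3)" "N \<ge> 1 / (100 * g)"
    using real_arch_simple[of "max 1 (max (4 * l / (g / 3)) (1 / (100 * g)))"] by (auto simp: max_def split: if_splits)
  show ?thesis
  proof (intro exI[of _ N] allI impI)
    fix V :: "nat set" and E
    assume V: "finite V" "N \<le> card V" "E \<subseteq> Kedges V" and count: "3 ^ tur m (card V) < c_count 3 k P E"
    define n where "n = real (card V)"
    have n: "n \<ge> N" "card V \<ge> 1" "V \<noteq> {}" "n > 0" using V N by (auto simp: n_def)
    have big: "(13 * 4 ^ card V) ^ l \<le> 3 powr (g / 3 * (card V)\<^sup>2)"
      using quadratic_dominates[of "g / 3" "card V" l] \<open>g > 0\<close> n N(2) by (simp add: n_def)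
    obtain c U where c: "c \<in> avoiding_colorings 3 k P E" "is_model \<epsilon> \<delta> V E c U" and
      eU: "tur m (card V) - g * (card V)\<^sup>2 \<le> 16 / 25 * card {e \<in> E. card (allowed U \<delta> e) = 2} + card {e \<in> E. card (allowed U \<delta> e) = 3}"
      using many_colourings_model[OF V(1) n(3) V(3) count z \<epsilon> \<delta>3 l big] by blast
    have cE: "c \<in> E \<rightarrow>\<^sub>E {..<3}" "\<not> has_pattern_copy k P E c" using c(1) by (auto simp: avoiding_colorings_def)
    have few: "card (listable U \<delta> V E) \<le> \<eta> * n ^ k"
    proof -
      have "card (listable U \<delta> V E) * \<delta> ^ card (pairs k) \<le> K * (q * \<epsilon> * n ^ k)"
        using model_few_listable[OF V(1,3) c(2) cE(2) \<delta>(1)] by (simp add: K_def q_def n_def)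
      also have "\<dots> = K * (q * \<epsilon>) * n ^ k" by simp
      also have "\<dots> \<le> \<eta> * \<delta> ^ card (pairs k) * n ^ k" using \<epsilon>3 n(4) by (intro mult_right_mono) auto
      finally have "card (listable U \<delta> V E) * \<delta> ^ card (pairs k) \<le> (\<eta> * n ^ k) * \<delta> ^ card (pairs k)" by (simp only: mult_ac)
      then show ?thesis using \<delta>(1) by (simp only: mult_le_cancel_right) (simp add: not_less[symmetric])
    qed
    have "\<eta> * n ^ k \<le> \<eta>0 * n ^ k" using n(4) by (intro mult_right_mono) (auto simp: \<eta>_def)
    then have "card (listable U \<delta> V E) \<le> \<eta>0 * card V ^ k" using few by (simp add: n_def)
    then obtain f where f: "f ` V \<subseteq> {..<m}"
      "pc V V (\<lambda>x y. f x \<noteq> f y \<and> \<not> ({x, y} \<in> E \<and> card (allowed U \<delta> {x, y}) = 3)) \<le> 198 * g * (card V)\<^sup>2"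
      "2 * tur m (card V) - 100 * g * (card V)\<^sup>2 \<le> pc V V (\<lambda>x y. f x \<noteq> f y)"
      using \<eta>0[OF V(1) n(3) V(3) _ eU] by blast
    have parts: "card {x \<in> V. f x = p} \<ge> 1 / (2 * m) * card V" if "p < m" for p
    proof -
      have "(1 / m - sqrt (2 * (100 * g))) * card V \<le> card {x \<in> V. f x = p}"
        by (rule balanced_parts[OF V(1) _ f(1)]) (use that m_ge \<open>g > 0\<close> f(3) N(3) n(1) in \<open>auto simp: n_def\<close>)
      moreover have "1 / (2 * m) * card V \<le> (1 / m - sqrt (2 * (100 * g))) * card V"
        using g2 by (intro mult_right_mono) (auto simp: field_simps)
      ultimately show ?thesis by (rule order_trans[rotated])
    qed
    have "pc V V (\<lambda>x y. f x = f y \<and> {x, y} \<in> E) \<le> \<gamma> * n\<^sup>2"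
    proof (rule ccontr)
      assume "\<not> ?thesis"
      moreover have "pc V V (\<lambda>x y. f x = f y \<and> {x, y} \<in> E) =
        pc V V (\<lambda>x y. (f x = f y \<and> {x, y} \<in> E) \<and> allowed U \<delta> {x, y} \<noteq> {}) + pc V V (\<lambda>x y. (f x = f y \<and> {x, y} \<in> E) \<and> \<not> allowed U \<delta> {x, y} \<noteq> {})"
        by (rule pc_split[OF V(1,1)])
      \<comment> \<open>Whatever colour \<open>c\<close> gives to an edge with empty list, it is
        unlisted.\<close>
      moreover have "pc V V (\<lambda>x y. (f x = f y \<and> {x, y} \<in> E) \<and> \<not> allowed U \<delta> {x, y} \<noteq> {})
        \<le> pc V V (\<lambda>x y. {x, y} \<in> E \<and> c {x, y} \<notin> allowed U \<delta> {x, y})"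
        by (rule pc_mono[OF V(1,1)]) auto
      moreover have "pc V V (\<lambda>x y. {x, y} \<in> E \<and> c {x, y} \<notin> allowed U \<delta> {x, y}) = 2 * card {e \<in> E. c e \<notin> allowed U \<delta> e}"
        using pc_edges_Collect[OF V(1,3), of "\<lambda>e. c e \<notin> allowed U \<delta> e"] .
      moreover have "card {e \<in> E. c e \<notin> allowed U \<delta> e} \<le> 3 * (\<delta> + \<epsilon>) * n\<^sup>2"
        using model_few_unlisted[OF V(1,3) c(2) cE(1)] \<delta>(1) by (simp add: n_def)
      moreover have "3 * (\<delta> + \<epsilon>) * n\<^sup>2 \<le> \<gamma> / 4 * n\<^sup>2" using \<delta>(2) \<epsilon>(2) by (intro mult_right_mono) auto
      ultimately have "\<gamma> / 2 * n\<^sup>2 \<le> pc V V (\<lambda>x y. f x = f y \<and> {x, y} \<in> E \<and> allowed U \<delta> {x, y} \<noteq> {})"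
        by (simp add: conj_assoc)
      then have "(\<gamma> / 2 / m * (1 / (2 * m)) ^ (k - 2) - card (pairs k) * (198 * g)) * card V ^ k \<le> card (listable U \<delta> V E)"
        using interior_listable[OF V(1,3) f(1,2) parts, of "\<gamma> / 2"] by (simp add: n_def)
      then have "(h - q * (198 * g)) * n ^ k \<le> \<eta> * n ^ k" using few by (simp add: h_def q_def n_def)
      then have "h - q * (198 * g) \<le> \<eta>" using n(4) by (simp add: mult_le_cancel_right zero_less_power not_less[symmetric])
      moreover have "\<eta> \<le> h / 4" by (simp add: \<eta>_def)
      ultimately show False using g1 \<open>h > 0\<close> by linarith
    qed
    then show "\<exists>f. f ` V \<subseteq> {..<m} \<and> pc V V (\<lambda>x y. f x = f y \<and> {x, y} \<in> E) \<le> \<gamma> * (card V)\<^sup>2"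
      using f(1) by (intro exI[of _ f]) (simp add: n_def)
  qed
qed

end

section \<open>Typical colourings\<close>

lemma real_card_UN_le: "finite I \<Longrightarrow> real (card (\<Union>i\<in>I. A i)) \<le> (\<Sum>i\<in>I. real (card (A i)))"
  using of_nat_mono[OF card_UN_le[of I A]] by simp

text \<open>One-sided quasirandomness, which suffices for embedding. The constant is the threshold
  1/8 of \<open>card_sparse_colour\<close>, well below the expected 1/3, halved because at least
  half of the pairs between two large sets will be edges.\<close>

definition typical :: "real \<Rightarrow> nat set \<Rightarrow> (nat \<Rightarrow> nat) \<Rightarrow> nat set set \<Rightarrow> (nat set \<Rightarrow> nat) \<Rightarrow> bool" where
  "typical \<xi> V f E c \<longleftrightarrow> (\<forall>S T i p q. S \<subseteq> V \<longrightarrow> T \<subseteq> V \<longrightarrow> f ` S \<subseteq> {p} \<longrightarrow> f ` T \<subseteq> {q} \<longrightarrow> p \<noteq> q \<longrightarrow> i < 3 \<longrightarrow>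
     \<xi> * real (card V) \<le> card S \<longrightarrow> \<xi> * real (card V) \<le> card T \<longrightarrow>
     pc S T (\<lambda>x y. {x, y} \<in> E \<and> c {x, y} = i) \<ge> 1 / 16 * (card S * card T))"

text \<open>Greedy embedding. For each \<open>j\<close>, typicality leaves at most
  \<open>\<xi> * card V\<close> candidates for the new vertex with less than a 1/16 share of
  suitable neighbours in \<open>A j\<close>, so some candidate is good for all \<open>j\<close>.
  Each step shrinks the other candidate sets by at most 16, hence the power of 16.\<close>

lemma typical_embedding:
  fixes \<xi> :: real
  assumes typc: "typical \<xi> V f E c" and V: "finite V" "V \<noteq> {}" and \<xi>: "\<xi> > 0"
    and "finite I" "card I \<le> k" "inj_on \<pi> I"
    and col: "\<And>i j. i \<in> I \<Longrightarrow> j \<in> I \<Longrightarrow> i \<noteq> j \<Longrightarrow> col {i, j} < 3"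
    and A: "\<And>j. j \<in> I \<Longrightarrow> A j \<subseteq> V \<and> f ` A j \<subseteq> {\<pi> j} \<and> k * \<xi> * 16 ^ card I * card V \<le> card (A j)"
  shows "\<exists>w. (\<forall>j\<in>I. w j \<in> A j) \<and> (\<forall>i\<in>I. \<forall>j\<in>I. i \<noteq> j \<longrightarrow> {w i, w j} \<in> E \<and> c {w i, w j} = col {i, j})"
  using assms(5-)
proof (induction I arbitrary: A)
  case empty
  then show ?case by simp
next
  case (insert i I)
  define n where "n = real (card V)"
  have n: "n > 0" using V by (simp add: n_def card_gt_0_iff)
  have A: "A j \<subseteq> V" "f ` A j \<subseteq> {\<pi> j}" "k * \<xi> * 16 ^ Suc (card I) * n \<le> card (A j)" if "j \<in> insert i I" for j
    using insert.prems(4)[OF that] insert.hyps by (auto simp: n_def)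
  have finA: "finite (A j)" if "j \<in> insert i I" for j using A(1)[OF that] V finite_subset by blast
  have k1: "card I < k" using insert.prems(1) insert.hyps by simp
  have big: "k * \<xi> * n \<le> card (A j)" if "j \<in> insert i I" for j
  proof -
    have "k * \<xi> * n * 1 \<le> k * \<xi> * n * 16 ^ Suc (card I)"
      using \<xi> n by (intro mult_left_mono one_le_power) auto
    also have "\<dots> \<le> card (A j)" using A(3)[OF that] by (simp add: mult_ac)
    finally show ?thesis by simp
  qed
  define N where "N x j = {y \<in> A j. {x, y} \<in> E \<and> c {x, y} = col {i, j}}" for x j
  define B where "B j = {x \<in> A i. card (N x j) < 1 / 16 * card (A j)}" for j
  have finB: "finite (B j)" for j using finA by (simp add: B_def)
  have B: "card (B j) \<le> \<xi> * n" if j: "j \<in> I" for j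
  proof (rule ccontr)
    assume c: "\<not> card (B j) \<le> \<xi> * n"
    have "1 * (\<xi> * n) \<le> k * (\<xi> * n)" using k1 \<xi> n by (intro mult_right_mono) auto
    then have Aj: "\<xi> * n \<le> card (A j)" using big[of j] j by (simp add: mult.assoc)
    have ij: "i \<noteq> j" using j insert.hyps by auto
    then have \<pi>: "\<pi> i \<noteq> \<pi> j" using insert.prems(2) j by (auto simp: inj_on_def)
    have BA: "B j \<subseteq> A i" by (auto simp: B_def)
    have "1 / 16 * (card (B j) * card (A j)) \<le> pc (B j) (A j) (\<lambda>x y. {x, y} \<in> E \<and> c {x, y} = col {i, j})"
    proof (rule typc[unfolded typical_def, rule_format, of _ _ "\<pi> i" "\<pi> j"])
      show "B j \<subseteq> V" "f ` B j \<subseteq> {\<pi> i}" using A(1,2)[of i] BA by auto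
      show "A j \<subseteq> V" "f ` A j \<subseteq> {\<pi> j}" using A(1,2)[of j] j by auto
      show "col {i, j} < 3" using insert.prems(3)[of i j] j ij by simp
    qed (use \<pi> c Aj in \<open>auto simp: n_def\<close>)
    also have "pc (B j) (A j) (\<lambda>x y. {x, y} \<in> E \<and> c {x, y} = col {i, j}) = (\<Sum>x\<in>B j. card (N x j))"
      using finB finA j by (simp add: pc_sum N_def)
    also have "real (\<Sum>x\<in>B j. card (N x j)) < (\<Sum>x\<in>B j. 1 / 16 * real (card (A j)))"
      unfolding of_nat_sum
    proof (rule sum_strict_mono[OF finB])
      have "real (card (B j)) > 0" using c \<xi> n by (smt (verit) mult_pos_pos)
      then show "B j \<noteq> {}" by auto
    qed (simp add: B_def)
    finally show False by simp
  qed
  have "real (card (\<Union>j\<in>I. B j)) \<le> (\<Sum>j\<in>I. real (card (B j)))" by (rule real_card_UN_le[OF insert.hyps(1)])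
  also have "\<dots> \<le> (\<Sum>j\<in>I. \<xi> * n)" by (rule sum_mono) (rule B)
  also have "\<dots> = card I * (\<xi> * n)" by simp
  also have "\<dots> < k * (\<xi> * n)" using k1 \<xi> n by (intro mult_strict_right_mono) auto
  also have "\<dots> \<le> card (A i)" using big[of i] by (simp add: mult.assoc)
  finally have "\<not> A i \<subseteq> (\<Union>j\<in>I. B j)" using finB insert.hyps(1) card_mono[of "\<Union>j\<in>I. B j" "A i"] by force
  then obtain x where x: "x \<in> A i" "\<And>j. j \<in> I \<Longrightarrow> x \<notin> B j" by blast
  have "\<exists>w. (\<forall>j\<in>I. w j \<in> N x j) \<and> (\<forall>i\<in>I. \<forall>j\<in>I. i \<noteq> j \<longrightarrow> {w i, w j} \<in> E \<and> c {w i, w j} = col {i, j})"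
  proof (rule insert.IH)
    fix j assume j: "j \<in> I"
    have "16 * (k * \<xi> * 16 ^ card I * n) \<le> card (A j)" using A(3)[of j] j by (simp add: mult_ac)
    moreover have "1 / 16 * card (A j) \<le> card (N x j)" using x j by (force simp: B_def)
    ultimately have "k * \<xi> * 16 ^ card I * n \<le> card (N x j)" by simp
    then show "N x j \<subseteq> V \<and> f ` N x j \<subseteq> {\<pi> j} \<and> k * \<xi> * 16 ^ card I * card V \<le> card (N x j)"
      using A(1,2)[of j] j unfolding n_def by (auto simp: N_def)
  qed (use insert.prems insert.hyps in auto)
  then obtain w where w: "\<And>j. j \<in> I \<Longrightarrow> w j \<in> N x j" "\<And>i j. i \<in> I \<Longrightarrow> j \<in> I \<Longrightarrow> i \<noteq> j \<Longrightarrow> {w i, w j} \<in> E \<and> c {w i, w j} = col {i, j}"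
    by blast
  let ?w = "w(i := x)"
  have wi: "?w j = w j" if "j \<in> I" for j using that insert.hyps by auto
  have new: "{x, w j} \<in> E \<and> c {x, w j} = col {i, j}" "w j \<in> A j" if "j \<in> I" for j using w(1)[OF that] by (auto simp: N_def)
  show ?case
  proof (intro exI[of _ ?w] conjI ballI impI)
    fix j assume "j \<in> insert i I"
    then show "?w j \<in> A j" using x(1) new(2) wi by auto
  next
    fix a b assume ab: "a \<in> insert i I" "b \<in> insert i I" "a \<noteq> b"
    consider "a = i" "b \<in> I" | "b = i" "a \<in> I" | "a \<in> I" "b \<in> I" using ab by auto
    then have "{?w a, ?w b} \<in> E \<and> c {?w a, ?w b} = col {a, b}"
    proof cases
      case 1 then show ?thesis using new(1)[of b] wi by simp
    next
      case 2 then show ?thesis using new(1)[of a] wi by (simp add: insert_commute)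
    next
      case 3 then show ?thesis using w(2)[of a b] wi ab by simp
    qed
    then show "{?w a, ?w b} \<in> E" "c {?w a, ?w b} = col {a, b}" by auto
  qed
qed

lemma pc_bipartite_edges:
  assumes "finite S" "finite T" "S \<inter> T = {}"
  shows "pc S T (\<lambda>x y. {x, y} \<in> E \<and> Q {x, y}) = card {e \<in> E. (\<exists>x\<in>S. \<exists>y\<in>T. e = {x, y}) \<and> Q e}"
proof -
  have "{e \<in> E. (\<exists>x\<in>S. \<exists>y\<in>T. e = {x, y}) \<and> Q e} = (\<lambda>(x, y). {x, y}) ` {(x, y) \<in> S \<times> T. {x, y} \<in> E \<and> Q {x, y}}"
    by auto
  moreover have "inj_on (\<lambda>(x, y). {x, y}) {(x, y) \<in> S \<times> T. {x, y} \<in> E \<and> Q {x, y}}"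
    using assms(3) by (auto simp: inj_on_def doubleton_eq_iff)
  ultimately show ?thesis unfolding pc_def by (simp add: card_image)
qed

text \<open>Rankin's trick with weight 1/2 for colour \<open>i\<close>: an edge of \<open>D\<close>
  contributes 5/2 instead of 3, the threshold costs \<open>2 powr (1 / 8)\<close> per edge, which is
  below 11/10, and \<open>11/10 * 5/6 = 11/12\<close>.\<close>

lemma card_sparse_colour:
  fixes \<alpha> :: real
  assumes "finite E" "D \<subseteq> E" "i < (3::nat)"
  shows "card {c \<in> E \<rightarrow>\<^sub>E {..<3}. card {e \<in> D. c e = i} \<le> 1 / 8 * real (card D)} \<le> 3 ^ card E * (11 / 12 :: real) ^ card D"
proof -
  let ?r = "1 / 8 * real (card D)"
  have "{e \<in> E. e \<in> D \<and> c e = i} = {e \<in> D. c e = i}" for c :: "'a \<Rightarrow> nat" using assms(2) by auto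
  then have "real (card {c \<in> E \<rightarrow>\<^sub>E {..<3}. card {e \<in> D. c e = i} \<le> ?r})
    \<le> (1 / 2) powr (- ?r) * (\<Prod>e\<in>E. \<Sum>s\<in>{..<3}. if e \<in> D \<and> s = i then 1 / 2 else 1)"
    using card_PiE_few_bad[OF assms(1), of "\<lambda>_. {..<3::nat}" "1 / 2" "\<lambda>e s. e \<in> D \<and> s = i" ?r] by simp
  also have "(\<Prod>e\<in>E. \<Sum>s\<in>{..<3}. if e \<in> D \<and> s = i then 1 / 2 else 1) = (\<Prod>e\<in>E. 3 * (if e \<in> D then 5 / 6 else (1 :: real)))"
  proof (rule prod.cong)
    fix e
    have "(\<Sum>s\<in>{..<3}. if s = i then 1 / 2 else (1 :: real)) = (\<Sum>s\<in>{..<3}. 1 - (if s = i then 1 / 2 else 0))"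
      by (rule sum.cong) auto
    also have "\<dots> = 5 / 2" using assms(3) by (simp add: sum_subtractf)
    finally show "(\<Sum>s\<in>{..<3}. if e \<in> D \<and> s = i then 1 / 2 else 1) = 3 * (if e \<in> D then 5 / 6 else (1 :: real))" by simp
  qed simp
  also have "\<dots> = 3 ^ card E * (5 / 6) ^ card D"
    using assms(1,2) by (simp add: prod.distrib prod.If_cases Int_absorb1)
  also have "(1 / 2) powr (- ?r) \<le> (11 / 10 :: real) ^ card D"
  proof -
    have "(1 / 2 :: real) = 2 powr (- 1)" by (simp add: powr_minus)
    then have "(1 / 2) powr (- ?r) = (2 :: real) powr (- 1 * - ?r)" by (simp only: powr_powr)
    also have "\<dots> = 2 powr (1 / 8 * real (card D))" by simp
    also have "\<dots> = (2 powr (1 / 8)) powr card D" by (simp add: powr_powr)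
    also have "\<dots> = (2 powr (1 / 8)) ^ card D" by (simp add: powr_realpow)
    also have "\<dots> \<le> (11 / 10) ^ card D"
    proof (rule power_mono)
      have "(2 powr (1 / 8)) ^ Suc 7 = (2 powr (1 / 8)) powr real (8 :: nat)" by (simp only: powr_realpow powr_gt_zero) simp
      also have "\<dots> = (2 :: real)" by (simp add: powr_powr)
      finally have "(2 powr (1 / 8)) ^ Suc 7 \<le> (11 / 10 :: real) ^ Suc 7" by (simp add: power_divide)
      then show "2 powr (1 / 8) \<le> (11 / 10 :: real)" by (rule power_le_imp_le_base) simp
    qed simp
    finally show ?thesis .
  qed
  finally have "real (card {c \<in> E \<rightarrow>\<^sub>E {..<3}. card {e \<in> D. c e = i} \<le> ?r}) \<le> (11 / 10) ^ card D * (3 ^ card E * (5 / 6) ^ card D)"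
    by (simp add: mult_right_mono)
  also have "\<dots> = 3 ^ card E * (11 / 10 * (5 / 6)) ^ card D" by (simp only: power_mult_distrib mult_ac)
  finally show ?thesis by simp
qed

text \<open>Union bound over two vertex sets and a colour. Between sets of size at least
  \<open>\<xi> * card V\<close> the missing pairs make up at most half, so at least
  \<open>\<xi>\<^sup>2 / 2 * (card V)\<^sup>2\<close> edges would have to use the colour too
  rarely.\<close>

lemma card_atypical:
  fixes \<xi> :: real
  assumes V: "finite V" "E \<subseteq> Kedges V" and \<xi>: "\<xi> > 0"
    and missing: "pc V V (\<lambda>x y. f x \<noteq> f y \<and> {x, y} \<notin> E) \<le> \<xi>\<^sup>2 / 2 * (card V)\<^sup>2"
  shows "card {c \<in> E \<rightarrow>\<^sub>E {..<3}. \<not> typical \<xi> V f E c}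
    \<le> 3 * 4 ^ card V * (3 ^ card E * (11 / 12) powr (\<xi>\<^sup>2 / 2 * (card V)\<^sup>2))"
proof -
  have fE: "finite E" using V finite_Kedges finite_subset by blast
  define n2 where "n2 = (real (card V))\<^sup>2"
  define D where "D S T = {e \<in> E. \<exists>x\<in>S. \<exists>y\<in>T. e = {x, y}}" for S T
  define X where "X = (\<lambda>(S, T, i). {c \<in> E \<rightarrow>\<^sub>E {..<3::nat}. card {e \<in> D S T. c e = i} \<le> 1 / 8 * real (card (D S T))})"
  define Z where "Z = {(S, T, i) \<in> Pow V \<times> Pow V \<times> {..<3::nat}. card (D S T) \<ge> \<xi>\<^sup>2 / 2 * n2}"
  have finZ: "finite Z" using V by (auto simp: Z_def intro: finite_subset[of _ "Pow V \<times> Pow V \<times> {..<3}"])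
  have finX: "finite (X t)" for t
  proof -
    have f: "finite (E \<rightarrow>\<^sub>E {..<3::nat})" by (rule finite_PiE[OF fE]) simp
    show ?thesis unfolding X_def by (cases t) (simp add: f)
  qed
  have "{c \<in> E \<rightarrow>\<^sub>E {..<3}. \<not> typical \<xi> V f E c} \<subseteq> (\<Union>t\<in>Z. X t)"
  proof
    fix c assume "c \<in> {c \<in> E \<rightarrow>\<^sub>E {..<3}. \<not> typical \<xi> V f E c}"
    then have c: "c \<in> E \<rightarrow>\<^sub>E {..<3}" "\<not> typical \<xi> V f E c" by auto
    then obtain S T i p q where ST: "S \<subseteq> V" "T \<subseteq> V" "f ` S \<subseteq> {p}" "f ` T \<subseteq> {q}" "p \<noteq> q" "i < 3"
      "\<xi> * card V \<le> card S" "\<xi> * card V \<le> card T"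
      and less: "pc S T (\<lambda>x y. {x, y} \<in> E \<and> c {x, y} = i) < 1 / 16 * (card S * card T)"
      unfolding typical_def not_all not_imp not_le by (elim exE conjE, intro that)
    have fin: "finite S" "finite T" using ST(1,2) V(1) by (auto intro: finite_subset)
    have dis: "S \<inter> T = {}" using ST(3-5) by auto
    have fne: "f a \<noteq> f b" if "a \<in> S" "b \<in> T" for a b using ST(3-5) that by auto
    note fin = fin dis
    have "(\<xi> * card V) * (\<xi> * card V) \<le> real (card S) * card T" using ST \<xi> by (intro mult_mono) auto
    then have st: "\<xi>\<^sup>2 * n2 \<le> real (card S) * card T" by (simp add: n2_def power2_eq_square mult_ac)
    have "real (card S) * card T = pc S T (\<lambda>x y. True)" by (simp add: pc_def card_cartesian_product)
    also have "pc S T (\<lambda>x y. True) = pc S T (\<lambda>x y. {x, y} \<in> E) + pc S T (\<lambda>x y. {x, y} \<notin> E)"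
      using pc_split[OF fin(1,2), of "\<lambda>_ _. True" "\<lambda>x y. {x, y} \<in> E"] by simp
    also have "pc S T (\<lambda>x y. {x, y} \<in> E) = card (D S T)"
      using pc_bipartite_edges[OF fin, of E "\<lambda>_. True"] by (simp add: D_def)
    also have "pc S T (\<lambda>x y. {x, y} \<notin> E) \<le> pc V V (\<lambda>x y. f x \<noteq> f y \<and> {x, y} \<notin> E)"
      unfolding pc_def using V ST
      by (intro of_nat_mono card_mono) (auto intro: finite_subset[of _ "V \<times> V"] dest: fne)
    finally have "real (card S) * card T \<le> card (D S T) + \<xi>\<^sup>2 / 2 * n2" using missing by (simp add: n2_def)
    then have half: "real (card S) * card T \<le> 2 * card (D S T)" "\<xi>\<^sup>2 / 2 * n2 \<le> card (D S T)" using st by auto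
    have "pc S T (\<lambda>x y. {x, y} \<in> E \<and> c {x, y} = i) = card {e \<in> D S T. c e = i}"
      unfolding pc_bipartite_edges[OF fin, of E "\<lambda>e. c e = i"] D_def by (rule arg_cong[of _ _ card]) auto
    then have "card {e \<in> D S T. c e = i} \<le> 1 / 8 * real (card (D S T))" using less half by simp
    then have "c \<in> X (S, T, i)" using c by (simp add: X_def)
    moreover have "(S, T, i) \<in> Z" using ST half by (simp add: Z_def)
    ultimately show "c \<in> (\<Union>t\<in>Z. X t)" by blast
  qed
  then have "real (card {c \<in> E \<rightarrow>\<^sub>E {..<3}. \<not> typical \<xi> V f E c}) \<le> card (\<Union>t\<in>Z. X t)"
    using finZ finX by (intro of_nat_mono card_mono) auto
  also have "\<dots> \<le> (\<Sum>t\<in>Z. real (card (X t)))" by (rule real_card_UN_le[OF finZ])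
  also have "\<dots> \<le> (\<Sum>t\<in>Z. 3 ^ card E * (11 / 12) powr (\<xi>\<^sup>2 / 2 * n2))"
  proof (rule sum_mono)
    fix t assume t: "t \<in> Z"
    obtain S T i where t': "t = (S, T, i)" by (cases t)
    have "real (card (X t)) \<le> 3 ^ card E * (11 / 12) ^ card (D S T)"
      unfolding X_def t' case_prod_conv by (rule card_sparse_colour) (use t t' fE in \<open>auto simp: D_def Z_def\<close>)
    also have "(11 / 12 :: real) ^ card (D S T) = (11 / 12) powr card (D S T)" by (simp add: powr_realpow)
    also have "\<dots> \<le> (11 / 12) powr (\<xi>\<^sup>2 / 2 * n2)" using t t' by (intro powr_mono') (auto simp: Z_def)
    finally show "real (card (X t)) \<le> 3 ^ card E * (11 / 12) powr (\<xi>\<^sup>2 / 2 * n2)" by simp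
  qed
  also have "\<dots> = card Z * (3 ^ card E * (11 / 12) powr (\<xi>\<^sup>2 / 2 * n2))" by simp
  also have "\<dots> \<le> 3 * 4 ^ card V * (3 ^ card E * (11 / 12) powr (\<xi>\<^sup>2 / 2 * n2))"
  proof (rule mult_right_mono)
    have "card Z \<le> card (Pow V \<times> Pow V \<times> {..<3::nat})" using V by (intro card_mono) (auto simp: Z_def)
    also have "\<dots> = 3 * 4 ^ card V" using V by (simp add: card_cartesian_product card_Pow power_mult_distrib[symmetric])
    finally have "real (card Z) \<le> real (3 * 4 ^ card V)" by (rule of_nat_mono)
    then show "real (card Z) \<le> 3 * 4 ^ card V" by simp
  qed simp
  finally show ?thesis by (simp add: n2_def)
qed

section \<open>Extensions of typical colourings\<close>

context two_class_pattern
begin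

lemma avoiding_restrict:
  assumes "c \<in> avoiding_colorings 3 k P E" "E' \<subseteq> E"
  shows "restrict c E' \<in> avoiding_colorings 3 k P E'"
proof -
  have c: "c \<in> E \<rightarrow>\<^sub>E {..<3}" "\<not> has_pattern_copy k P E c" using assms(1) by (auto simp: avoiding_colorings_def)
  have "\<not> has_pattern_copy k P E' (restrict c E')"
  proof
    assume "has_pattern_copy k P E' (restrict c E')"
    then obtain g where g: "inj_on g {..<k}" "\<forall>e\<in>KK. g ` e \<in> E'"
      "\<forall>e\<in>KK. \<forall>e'\<in>KK. (restrict c E' (g ` e) = restrict c E' (g ` e')) \<longleftrightarrow> (\<exists>C\<in>P. e \<in> C \<and> e' \<in> C)"
      unfolding has_pattern_copy_def by blast
    then have "has_pattern_copy k P E c" unfolding has_pattern_copy_def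
      using assms(2) by (intro exI[of _ g]) auto
    then show False using c(2) by simp
  qed
  moreover have "restrict c E' \<in> E' \<rightarrow>\<^sub>E {..<3}" using c(1) assms(2) by auto
  ultimately show ?thesis by (simp add: avoiding_colorings_def)
qed

lemma finite_avoiding: "finite E \<Longrightarrow> finite (avoiding_colorings 3 k P E)"
  unfolding avoiding_colorings_def
  by (rule finite_subset[OF _ finite_PiE[of E "\<lambda>_. {..<3::nat}"]]) auto

text \<open>Otherwise the pattern can be completed from \<open>v\<close>:
  \<open>realize_star\<close> allows all edges at \<open>v\<close> to have colour \<open>i\<close>,
  and typicality embeds the other vertices into the neighbourhoods of that colour.\<close>

lemma no_common_star_colour:
  fixes \<xi> \<epsilon> :: real
  assumes V: "finite V" "V \<noteq> {}" "E \<subseteq> Kedges V" and c: "c \<in> avoiding_colorings 3 k P E"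
    and typc: "typical \<xi> V f E c" and \<xi>: "\<xi> > 0" "k * \<xi> * 16 ^ k \<le> \<epsilon>" and "i < 3"
  shows "\<exists>p<m. card {w \<in> V. f w = p \<and> {v, w} \<in> E \<and> c {v, w} = i} < \<epsilon> * card V"
proof (rule ccontr)
  assume "\<not> ?thesis"
  then have big: "\<epsilon> * card V \<le> card {w \<in> V. f w = p \<and> {v, w} \<in> E \<and> c {v, w} = i}" if "p < m" for p
    using that by force
  let ?L = "\<lambda>e. if (0::nat) \<in> e then {i} else {..<3::nat}"
  have "\<exists>col. realizes col \<and> (\<forall>e\<in>KK. col e \<in> ?L e)"
    by (rule realize_star[of 0 i]) (use k3 \<open>i < 3\<close> in auto)
  then obtain col where col: "realizes col" "\<And>e. e \<in> KK \<Longrightarrow> col e \<in> ?L e" by blast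
  \<comment> \<open>Vertex 0 of the pattern becomes \<open>v\<close>, and vertex \<open>j\<close>
    goes to class \<open>j - 1\<close>.\<close>
  define A where "A j = {w \<in> V. f w = j - 1 \<and> {v, w} \<in> E \<and> c {v, w} = i}" for j
  have "\<exists>w. (\<forall>j\<in>{1..<k}. w j \<in> A j) \<and> (\<forall>i\<in>{1..<k}. \<forall>j\<in>{1..<k}. i \<noteq> j \<longrightarrow> {w i, w j} \<in> E \<and> c {w i, w j} = col {i, j})"
  proof (rule typical_embedding[OF typc V(1,2) \<xi>(1), where \<pi> = "\<lambda>j. j - 1" and k = k])
    show "inj_on (\<lambda>j. j - 1) {1..<k}" by (auto simp: inj_on_def)
  next
    fix a b :: nat assume "a \<in> {1..<k}" "b \<in> {1..<k}" "a \<noteq> b"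
    then show "col {a, b} < 3" using col(2)[of "{a, b}"] by auto
  next
    fix j assume j: "j \<in> {1..<k}"
    have "k * \<xi> * 16 ^ card {1..<k} * card V \<le> k * \<xi> * 16 ^ k * card V"
      using \<xi> by (intro mult_right_mono mult_left_mono power_increasing) auto
    also have "\<dots> \<le> \<epsilon> * card V" using \<xi> by (intro mult_right_mono) auto
    also have "\<dots> \<le> card (A j)" unfolding A_def using j by (intro big) auto
    finally show "A j \<subseteq> V \<and> f ` A j \<subseteq> {j - 1} \<and> k * \<xi> * 16 ^ card {1..<k} * card V \<le> card (A j)"
      by (auto simp: A_def)
  qed auto
  then obtain w where w: "\<And>j. j \<in> {1..<k} \<Longrightarrow> w j \<in> A j"
    "\<And>i j. i \<in> {1..<k} \<Longrightarrow> j \<in> {1..<k} \<Longrightarrow> i \<noteq> j \<Longrightarrow> {w i, w j} \<in> E \<and> c {w i, w j} = col {i, j}" by blast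
  let ?x = "w(0 := v)"
  have copy: "?x ` e \<in> E \<and> c (?x ` e) = col e" if e: "e \<in> KK" for e
  proof -
    obtain a b where ab: "e = {a, b}" "a < b" "b < k" using e by (rule KK_E)
    have im: "?x ` e = {?x a, ?x b}" unfolding ab(1) by simp
    show ?thesis
    proof (cases "a = 0")
      case True
      then have "{v, w b} \<in> E" "c {v, w b} = i" using w(1)[of b] ab by (auto simp: A_def)
      moreover have "col e = i" using col(2)[OF e] True ab(1) by simp
      ultimately show ?thesis unfolding im using True ab by simp
    next
      case False
      then have "{w a, w b} \<in> E \<and> c {w a, w b} = col {a, b}" using ab by (intro w(2)) auto
      then show ?thesis unfolding im using False ab by simp
    qed
  qed
  have "inj_on ?x {..<k}" using inj_on_clique_map[OF V(3), of ?x] copy by blast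
  then have "has_pattern_copy k P E c" using realizes_copy[OF col(1)] copy by blast
  then show False using c by (simp add: avoiding_colorings_def)
qed

text \<open>\<open>realize_one_edge\<close> prescribes nothing but the colour that \<open>c\<close>
  gives to \<open>{u, v}\<close>. If all nine pairs of colours were frequent towards every class
  except \<open>p0\<close>, the remaining \<open>k - 2\<close> vertices of the pattern could be
  embedded into these classes.\<close>

lemma missing_pair_of_colours:
  fixes \<xi> \<epsilon> :: real
  assumes V: "finite V" "V \<noteq> {}" "E \<subseteq> Kedges V" and c: "c \<in> avoiding_colorings 3 k P E"
    and typc: "typical \<xi> V f E c" and \<xi>: "\<xi> > 0" "k * \<xi> * 16 ^ k \<le> \<epsilon>"
    and uv: "{u, v} \<in> E" "p0 < m"
  shows "\<exists>p a b. p < m \<and> p \<noteq> p0 \<and> a < 3 \<and> b < 3 \<and>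
    card {w \<in> V. f w = p \<and> {u, w} \<in> E \<and> {v, w} \<in> E \<and> (c {u, w}, c {v, w}) = (a, b)} < \<epsilon> * card V"
proof (rule ccontr)
  assume no: "\<not> ?thesis"
  have big: "\<epsilon> * card V \<le> card {w \<in> V. f w = p \<and> {u, w} \<in> E \<and> {v, w} \<in> E \<and> (c {u, w}, c {v, w}) = (a, b)}"
    if "p < m" "p \<noteq> p0" "a < 3" "b < 3" for p a b
  proof (rule ccontr)
    assume "\<not> ?thesis"
    then have "card {w \<in> V. f w = p \<and> {u, w} \<in> E \<and> {v, w} \<in> E \<and> (c {u, w}, c {v, w}) = (a, b)} < \<epsilon> * card V"
      by (simp only: not_le)
    with that no show False by blast
  qed
  have cuv: "c {u, v} < 3" using c uv by (auto simp: avoiding_colorings_def)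
  let ?L = "\<lambda>e. if e = {0, 1::nat} then {c {u, v}} else {..<3::nat}"
  have "\<exists>col. realizes col \<and> (\<forall>e\<in>KK. col e \<in> ?L e)"
    by (rule realize_one_edge[of "{0, 1}" "c {u, v}"]) (use k3 cuv in auto)
  then obtain col where col: "realizes col" "\<And>e. e \<in> KK \<Longrightarrow> col e \<in> ?L e" by blast
  have col3: "col {a, b} < 3" if "a < b" "b < k" "2 \<le> b" for a b
    using col(2)[of "{a, b}"] that by (auto simp: doubleton_eq_iff)
  have "card {2..<k} = card ({..<m} - {p0})" using uv(2) by simp
  then obtain \<pi> where \<pi>: "bij_betw \<pi> {2..<k} ({..<m} - {p0})"
    using finite_same_card_bij[of "{2..<k}" "{..<m} - {p0}"] by auto
  define A where "A j = {w \<in> V. f w = \<pi> j \<and> {u, w} \<in> E \<and> {v, w} \<in> E \<and> (c {u, w}, c {v, w}) = (col {0, j}, col {1, j})}" for j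
  have "\<exists>w. (\<forall>j\<in>{2..<k}. w j \<in> A j) \<and> (\<forall>i\<in>{2..<k}. \<forall>j\<in>{2..<k}. i \<noteq> j \<longrightarrow> {w i, w j} \<in> E \<and> c {w i, w j} = col {i, j})"
  proof (rule typical_embedding[OF typc V(1,2) \<xi>(1), where \<pi> = \<pi> and k = k])
    show "inj_on \<pi> {2..<k}" using \<pi> by (rule bij_betw_imp_inj_on)
  next
    fix a b :: nat assume "a \<in> {2..<k}" "b \<in> {2..<k}" "a \<noteq> b"
    then show "col {a, b} < 3" using col3[of a b] col3[of b a] by (cases "a < b") (auto simp: insert_commute)
  next
    fix j assume j: "j \<in> {2..<k}"
    then have "\<pi> j \<in> {..<m} - {p0}" using \<pi> by (auto simp: bij_betw_def)
    then have \<pi>j: "\<pi> j < m" "\<pi> j \<noteq> p0" by auto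
    have "k * \<xi> * 16 ^ card {2..<k} * card V \<le> k * \<xi> * 16 ^ k * card V"
      using \<xi> by (intro mult_right_mono mult_left_mono power_increasing) auto
    also have "\<dots> \<le> \<epsilon> * card V" using \<xi> by (intro mult_right_mono) auto
    also have "\<dots> \<le> card (A j)" unfolding A_def using j \<pi>j by (intro big col3) auto
    finally show "A j \<subseteq> V \<and> f ` A j \<subseteq> {\<pi> j} \<and> k * \<xi> * 16 ^ card {2..<k} * card V \<le> card (A j)"
      by (auto simp: A_def)
  qed auto
  then obtain w where w: "\<And>j. j \<in> {2..<k} \<Longrightarrow> w j \<in> A j"
    "\<And>i j. i \<in> {2..<k} \<Longrightarrow> j \<in> {2..<k} \<Longrightarrow> i \<noteq> j \<Longrightarrow> {w i, w j} \<in> E \<and> c {w i, w j} = col {i, j}" by blast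
  let ?x = "w(0 := u, 1 := v)"
  have copy: "?x ` e \<in> E \<and> c (?x ` e) = col e" if e: "e \<in> KK" for e
  proof -
    obtain a b where ab: "e = {a, b}" "a < b" "b < k" using e by (rule KK_E)
    have im: "?x ` e = {?x a, ?x b}" unfolding ab(1) by simp
    consider "b = 1" "a = 0" | "b \<ge> 2" "a = 0" | "b \<ge> 2" "a = 1" | "a \<ge> 2" using ab by linarith
    then show ?thesis
    proof cases
      case 1
      moreover have "col e = c {u, v}" using col(2)[OF e] 1 ab(1) by (simp add: insert_commute)
      ultimately show ?thesis unfolding im using uv by simp
    next
      case 2
      then have "{u, w b} \<in> E" "c {u, w b} = col {0, b}" using w(1)[of b] ab by (auto simp: A_def)
      then show ?thesis unfolding im using 2 ab by simp
    next
      case 3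
      then have "{v, w b} \<in> E" "c {v, w b} = col {1, b}" using w(1)[of b] ab by (auto simp: A_def)
      then show ?thesis unfolding im using 3 ab by simp
    next
      case 4
      then have "{w a, w b} \<in> E \<and> c {w a, w b} = col {a, b}" using ab by (intro w(2)) auto
      then show ?thesis unfolding im using 4 ab by simp
    qed
  qed
  have "inj_on ?x {..<k}" using inj_on_clique_map[OF V(3), of ?x] copy by blast
  then have "has_pattern_copy k P E c" using realizes_copy[OF col(1)] copy by blast
  then show False using c by (simp add: avoiding_colorings_def)
qed

text \<open>Extensional colourings take the value \<open>undefined\<close> on pairs that are not edges.\<close>

definition star_values :: "nat set set \<Rightarrow> nat \<Rightarrow> nat \<Rightarrow> nat set" where
  "star_values E v w = (if {v, w} \<in> E then {..<3} else {undefined})"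

lemma star_values_mem: "c \<in> E \<rightarrow>\<^sub>E {..<3} \<Longrightarrow> c {v, w} \<in> star_values E v w"
  by (auto simp: star_values_def PiE_def extensional_def)

lemma finite_star_values [simp]: "finite (star_values E v w)"
  by (simp add: star_values_def)

lemma card_star_values: "card (star_values E v w) = (if {v, w} \<in> E then 3 else 1)"
  by (simp add: star_values_def)

lemma edge_at_vertex:
  assumes "E \<subseteq> Kedges V" "e \<in> E" "v \<in> e"
  obtains w where "w \<in> V" "w \<noteq> v" "e = {v, w}"
proof -
  have "e \<in> Kedges V" using assms by blast
  then obtain x y where "e = {x, y}" "x \<in> V" "y \<in> V" "x \<noteq> y" by (rule Kedges_E)
  then show ?thesis using that[of x] that[of y] assms(3) by auto
qed

text \<open>A colouring is determined by its restriction to the graph without \<open>v\<close> and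
  by its star at \<open>v\<close>. Record for each colour \<open>i\<close> a class
  \<open>j i\<close> in which it is rare at \<open>v\<close>, with at most \<open>m ^ 3\<close>
  choices of \<open>j\<close>. For fixed \<open>j\<close>, the star loses a factor 2/3 over a whole
  class for each colour rare there.\<close>

lemma extensions_one_vertex:
  fixes \<xi> \<epsilon> \<mu> z :: real
  assumes V: "finite V" "E \<subseteq> Kedges V" "f ` V \<subseteq> {..<m}"
    and \<xi>: "\<xi> > 0" "k * \<xi> * 16 ^ k \<le> \<epsilon>" and z: "0 < z" "z \<le> 1"
    and v: "v \<in> V" "\<And>p. p < m \<Longrightarrow> 3 * \<epsilon> * card V < card {w \<in> V. f w = p \<and> {v, w} \<in> E}"
    and parts: "\<And>p. p < m \<Longrightarrow> \<mu> * card V \<le> card {x \<in> V. f x = p}"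
  shows "card {c \<in> avoiding_colorings 3 k P E. typical \<xi> V f E c} \<le> c_count 3 k P {e \<in> E. v \<notin> e} *
    (m ^ 3 * (z powr (- 3 * \<epsilon> * card V) * (3 ^ card V * (1 + 4 * z) ^ card V * (2 / 3) powr (3 * \<mu> * card V - 3))))"
proof -
  define n where "n = real (card V)"
  have fE: "finite E" using V finite_Kedges finite_subset by blast
  define E' where "E' = {e \<in> E. v \<notin> e}"
  define V' where "V' = V - {v}"
  have fV': "finite V'" using V by (simp add: V'_def)
  \<comment> \<open>A constant \<open>j\<close> would make all three colours rare in one class,
    against the many neighbours of \<open>v\<close> there.\<close>
  define Js where "Js = {j \<in> {..<3::nat} \<rightarrow>\<^sub>E {..<m}. \<forall>p. \<exists>i<3. j i \<noteq> p}"
  define bad where "bad j w s \<longleftrightarrow> {v, w} \<in> E \<and> s < 3 \<and> f w = j s" for j :: "nat \<Rightarrow> nat" and w s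
  define St where "St j = {s \<in> PiE V' (star_values E v). card {w \<in> V'. bad j w (s w)} \<le> 3 * \<epsilon> * n}" for j
  have finJ: "finite Js" "card Js \<le> m ^ 3"
  proof -
    have fj: "finite ({..<3::nat} \<rightarrow>\<^sub>E {..<m})" by (intro finite_PiE) auto
    have sub: "Js \<subseteq> {..<3::nat} \<rightarrow>\<^sub>E {..<m}" by (auto simp: Js_def)
    show "finite Js" by (rule finite_subset[OF sub fj])
    show "card Js \<le> m ^ 3" using card_mono[OF fj sub] by (simp add: card_PiE)
  qed
  have finS: "finite (St j)" for j
    unfolding St_def using finite_PiE[of V' "star_values E v"] fV' by simp
  let ?C = "{c \<in> avoiding_colorings 3 k P E. typical \<xi> V f E c}"
  let ?h = "\<lambda>c. (restrict c E', \<lambda>w\<in>V'. c {v, w})"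
  have inj: "inj_on ?h ?C"
  proof (rule inj_onI)
    fix c d assume c: "c \<in> ?C" and d: "d \<in> ?C" and eq: "?h c = ?h d"
    have cE: "c \<in> E \<rightarrow>\<^sub>E {..<3}" "d \<in> E \<rightarrow>\<^sub>E {..<3}" using c d by (auto simp: avoiding_colorings_def)
    show "c = d"
    proof (rule PiE_ext[OF cE])
      fix e assume e: "e \<in> E"
      show "c e = d e"
      proof (cases "v \<in> e")
        case True
        obtain w where w: "w \<in> V" "w \<noteq> v" "e = {v, w}" using V(2) e True by (rule edge_at_vertex)
        then have "w \<in> V'" by (simp add: V'_def)
        moreover have "(\<lambda>w\<in>V'. c {v, w}) = (\<lambda>w\<in>V'. d {v, w})" using eq by simp
        ultimately show ?thesis using w by (metis restrict_apply')
      next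
        case False
        then have "e \<in> E'" using e by (simp add: E'_def)
        moreover have "restrict c E' = restrict d E'" using eq by simp
        ultimately show ?thesis by (metis restrict_apply')
      qed
    qed
  qed
  have "?h ` ?C \<subseteq> avoiding_colorings 3 k P E' \<times> (\<Union>j\<in>Js. St j)"
  proof (rule image_subsetI)
    fix c assume c: "c \<in> ?C"
    then have cE: "c \<in> E \<rightarrow>\<^sub>E {..<3}" by (auto simp: avoiding_colorings_def)
    have ex: "\<exists>p<m. card {w \<in> V. f w = p \<and> {v, w} \<in> E \<and> c {v, w} = i} < \<epsilon> * n" if "i < 3" for i
      unfolding n_def by (rule no_common_star_colour[OF V(1) _ V(2) _ _ \<xi>]) (use v c that in auto)
    define j0 where "j0 i = (SOME p. p < m \<and> card {w \<in> V. f w = p \<and> {v, w} \<in> E \<and> c {v, w} = i} < \<epsilon> * n)" for i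
    have j0: "j0 i < m" "card {w \<in> V. f w = j0 i \<and> {v, w} \<in> E \<and> c {v, w} = i} < \<epsilon> * n" if "i < 3" for i
      using someI_ex[OF ex[OF that]] unfolding j0_def by blast+
    define j where "j = restrict j0 {..<3}"
    define s where "s = (\<lambda>w\<in>V'. c {v, w})"
    have bads: "{w \<in> V'. bad j w (s w)} = (\<Union>i<3. {w \<in> V'. f w = j0 i \<and> {v, w} \<in> E \<and> c {v, w} = i})"
      by (auto simp: bad_def s_def j_def)
    have sum3: "real (card (\<Union>i<3::nat. X i)) \<le> 3 * \<epsilon> * n" if X: "\<And>i. i < 3 \<Longrightarrow> card (X i) < \<epsilon> * n" for X :: "nat \<Rightarrow> nat set"
    proof -
      have "real (card (\<Union>i<3::nat. X i)) \<le> (\<Sum>i<3. real (card (X i)))" by (rule real_card_UN_le) simp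
      also have "\<dots> \<le> (\<Sum>i<3::nat. \<epsilon> * n)" by (rule sum_mono) (use X in force)
      finally show ?thesis by simp
    qed
    have "card {w \<in> V'. bad j w (s w)} \<le> 3 * \<epsilon> * n" unfolding bads
    proof (rule sum3)
      fix i :: nat assume i: "i < 3"
      have "card {w \<in> V'. f w = j0 i \<and> {v, w} \<in> E \<and> c {v, w} = i} \<le> card {w \<in> V. f w = j0 i \<and> {v, w} \<in> E \<and> c {v, w} = i}"
        using V by (intro card_mono) (auto simp: V'_def)
      then show "card {w \<in> V'. f w = j0 i \<and> {v, w} \<in> E \<and> c {v, w} = i} < \<epsilon> * n" using j0(2)[OF i] by linarith
    qed
    moreover have "s \<in> PiE V' (star_values E v)" unfolding s_def using star_values_mem[OF cE] by auto
    ultimately have "s \<in> St j" by (simp add: St_def)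
    moreover have "j \<in> Js"
    proof -
      have "\<exists>i<3. j i \<noteq> p" for p
      proof (rule ccontr)
        assume "\<not> ?thesis"
        then have jp: "j0 i = p" if "i < 3" for i using that by (auto simp: j_def)
        have "{w \<in> V. f w = p \<and> {v, w} \<in> E} = (\<Union>i<3. {w \<in> V. f w = p \<and> {v, w} \<in> E \<and> c {v, w} = i})"
          using cE by auto
        moreover have "real (card (\<Union>i<3::nat. {w \<in> V. f w = p \<and> {v, w} \<in> E \<and> c {v, w} = i})) \<le> 3 * \<epsilon> * n"
          by (rule sum3) (use j0(2) jp in auto)
        moreover have "p < m" using j0(1)[of 0] jp[of 0] by simp
        ultimately show False using v(2)[of p] by (simp add: n_def)
      qed
      then show ?thesis using j0(1) by (auto simp: Js_def j_def)
    qed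
    moreover have "restrict c E' \<in> avoiding_colorings 3 k P E'"
      by (rule avoiding_restrict) (use c in \<open>auto simp: E'_def\<close>)
    ultimately show "?h c \<in> avoiding_colorings 3 k P E' \<times> (\<Union>j\<in>Js. St j)" unfolding s_def by blast
  qed
  moreover have fin': "finite (avoiding_colorings 3 k P E' \<times> (\<Union>j\<in>Js. St j))"
    using finite_avoiding[of E'] fE finJ finS by (simp add: E'_def)
  ultimately have "card ?C \<le> card (avoiding_colorings 3 k P E' \<times> (\<Union>j\<in>Js. St j))" by (rule card_inj_on_le[OF inj])
  also have "\<dots> = c_count 3 k P E' * card (\<Union>j\<in>Js. St j)" by (simp add: card_cartesian_product c_count_def)
  finally have 1: "real (card ?C) \<le> real (c_count 3 k P E') * card (\<Union>j\<in>Js. St j)" by (metis of_nat_mono of_nat_mult)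
  define R where "R = z powr (- 3 * \<epsilon> * n) * (3 ^ card V * (1 + 4 * z) ^ card V * (2 / 3) powr (3 * \<mu> * n - 3))"
  have St: "card (St j) \<le> R" if j: "j \<in> Js" for j
  proof -
    define mm where "mm w = card {i. i < (3::nat) \<and> j i = f w}" for w
    have fin3: "finite {i. i < (3::nat) \<and> Q i}" for Q by simp
    have m2: "mm w \<le> 2" for w
    proof -
      obtain i where i: "i < 3" "j i \<noteq> f w" using j by (auto simp: Js_def)
      then have "{i. i < (3::nat) \<and> j i = f w} \<subset> {..<3}" by auto
      then have "mm w < card {..<3::nat}" unfolding mm_def by (intro psubset_card_mono) auto
      then show ?thesis by simp
    qed
    have "real (card (St j)) \<le> z powr (- (3 * \<epsilon> * n)) * (\<Prod>w\<in>V'. \<Sum>s\<in>star_values E v w. if bad j w s then z else 1)"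
      unfolding St_def by (rule card_PiE_few_bad[OF fV' _ z]) simp
    also have "(\<Prod>w\<in>V'. \<Sum>s\<in>star_values E v w. if bad j w s then z else 1) \<le> (\<Prod>w\<in>V'. (3 * (1 + 4 * z)) * (2 / 3) ^ mm w)"
    proof (rule prod_mono, intro conjI)
      fix w
      show "(\<Sum>s\<in>star_values E v w. if bad j w s then z else 1) \<ge> 0" using z by (intro sum_nonneg) auto
      \<comment> \<open>With at most two rare colours, \<open>3 - mm w\<close> is at most
        \<open>3 * (2 / 3) ^ mm w\<close>. With three, and \<open>z\<close> small, the bound would
        drop below the one value that a non-neighbour always has.\<close>
      have mw: "mm w = 0 \<or> mm w = 1 \<or> mm w = 2" using m2[of w] by linarith
      show "(\<Sum>s\<in>star_values E v w. if bad j w s then z else 1) \<le> 3 * (1 + 4 * z) * (2 / 3) ^ mm w"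
      proof (cases "{v, w} \<in> E")
        case True
        have "{..<3} \<inter> {s. bad j w s} = {i. i < 3 \<and> j i = f w}" using True by (auto simp: bad_def)
        moreover have "{..<3} \<inter> - {s. bad j w s} = {..<3} - {i. i < 3 \<and> j i = f w}" using True by (auto simp: bad_def)
        ultimately have "(\<Sum>s\<in>{..<3}. if bad j w s then z else 1) = mm w * z + card ({..<3} - {i. i < 3 \<and> j i = f w})"
          by (simp add: sum.If_cases mm_def)
        also have "card ({..<3} - {i. i < 3 \<and> j i = f w}) = 3 - mm w" unfolding mm_def by (subst card_Diff_subset) auto
        finally show ?thesis using True mw z by (auto simp: star_values_def power2_eq_square)
      next
        case False
        then show ?thesis using mw z by (auto simp: star_values_def bad_def power2_eq_square)
      qed
    qed
    also have "\<dots> = (3 * (1 + 4 * z)) ^ card V' * (2 / 3) ^ (\<Sum>w\<in>V'. mm w)"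
      by (simp add: prod.distrib power_sum)
    also have "\<dots> \<le> (3 ^ card V * (1 + 4 * z) ^ card V) * (2 / 3) powr (3 * \<mu> * n - 3)"
    proof (rule mult_mono)
      have "(3 * (1 + 4 * z)) ^ card V' \<le> (3 * (1 + 4 * z)) ^ card V"
        using z V by (intro power_increasing card_mono) (auto simp: V'_def)
      then show "(3 * (1 + 4 * z)) ^ card V' \<le> 3 ^ card V * (1 + 4 * z) ^ card V" by (simp only: power_mult_distrib)
      have "(\<Sum>w\<in>V'. mm w) = (\<Sum>w\<in>V'. \<Sum>i<3. if j i = f w then 1 else 0)"
        by (rule sum.cong) (auto simp: mm_def sum.If_cases Int_def)
      also have "\<dots> = (\<Sum>i<3. \<Sum>w\<in>V'. if j i = f w then 1 else 0)" by (rule sum.swap)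
      also have "\<dots> = (\<Sum>i<3. card {w \<in> V'. f w = j i})"
        using fV' by (intro sum.cong) (auto simp: sum.If_cases Int_def eq_commute)
      finally have "real (\<Sum>w\<in>V'. mm w) = (\<Sum>i<3. real (card {w \<in> V'. f w = j i}))" by simp
      \<comment> \<open>A class may contain \<open>v\<close>, which is not in \<open>V'\<close>;
        over the three colours this is the 3 subtracted in the exponent.\<close>
      moreover have "(\<Sum>i<3::nat. \<mu> * n - 1) \<le> (\<Sum>i<3. real (card {w \<in> V'. f w = j i}))"
      proof (rule sum_mono)
        fix i :: nat assume "i \<in> {..<3}"
        then have "j i < m" using j by (auto simp: Js_def)
        then have "\<mu> * n \<le> card {w \<in> V. f w = j i}" using parts by (simp add: n_def)
        moreover have "{w \<in> V. f w = j i} \<subseteq> insert v {w \<in> V'. f w = j i}" by (auto simp: V'_def)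
        then have "card {w \<in> V. f w = j i} \<le> card (insert v {w \<in> V'. f w = j i})" using fV' by (intro card_mono) auto
        moreover have "card (insert v {w \<in> V'. f w = j i}) \<le> Suc (card {w \<in> V'. f w = j i})"
          using fV' by (simp add: card_insert_if)
        ultimately show "\<mu> * n - 1 \<le> real (card {w \<in> V'. f w = j i})" by linarith
      qed
      ultimately have "3 * \<mu> * n - 3 \<le> real (\<Sum>w\<in>V'. mm w)" by simp
      then have "(2 / 3) powr real (\<Sum>w\<in>V'. mm w) \<le> (2 / 3) powr (3 * \<mu> * n - 3)" by (intro powr_mono') auto
      then show "(2 / 3) ^ (\<Sum>w\<in>V'. mm w) \<le> (2 / 3 :: real) powr (3 * \<mu> * n - 3)"
        using powr_realpow[of "2 / 3 :: real" "\<Sum>w\<in>V'. mm w"] by linarith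
    qed (use z in auto)
    finally show ?thesis using z by (simp add: R_def mult_left_mono)
  qed
  have "real (card (\<Union>j\<in>Js. St j)) \<le> (\<Sum>j\<in>Js. real (card (St j)))" by (rule real_card_UN_le[OF finJ(1)])
  also have "\<dots> \<le> (\<Sum>j\<in>Js. R)" by (rule sum_mono) (rule St)
  also have "\<dots> = card Js * R" by simp
  also have "\<dots> \<le> real (m ^ 3) * R"
    using finJ(2) z by (intro mult_right_mono) (simp_all only: of_nat_le_iff, simp add: R_def)
  finally have "real (c_count 3 k P E') * card (\<Union>j\<in>Js. St j) \<le> c_count 3 k P E' * (m ^ 3 * R)"
    by (intro mult_left_mono) auto
  then show ?thesis using 1 unfolding R_def n_def E'_def by linarith
qed


text \<open>Both ends of an interior edge are removed. Towards another class, the edges to a common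
  neighbour take nine pairs of colours, one of which is rare in some class; inside their own class
  \<open>u\<close> and \<open>v\<close> have few edges. The factor \<open>27 * m\<close> counts the
  colour of \<open>{u, v}\<close>, the rare pair and its class.\<close>

lemma extensions_two_vertices:
  fixes \<xi> \<epsilon> \<mu> z :: real
  assumes V: "finite V" "E \<subseteq> Kedges V" "f ` V \<subseteq> {..<m}"
    and \<xi>: "\<xi> > 0" "k * \<xi> * 16 ^ k \<le> \<epsilon>" and z: "0 < z" "z \<le> 1"
    and uv: "u \<in> V" "v \<in> V" "{u, v} \<in> E" "f u = p0" "f v = p0"
    and deg: "card {w \<in> V. f w = p0 \<and> {u, w} \<in> E} \<le> 3 * \<epsilon> * card V"
      "card {w \<in> V. f w = p0 \<and> {v, w} \<in> E} \<le> 3 * \<epsilon> * card V"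
    and parts: "\<And>p. p < m \<Longrightarrow> \<mu> * card V \<le> card {x \<in> V. f x = p}"
  shows "card {c \<in> avoiding_colorings 3 k P E. typical \<xi> V f E c} \<le> c_count 3 k P {e \<in> E. u \<notin> e \<and> v \<notin> e} *
    (27 * m * (z powr (- \<epsilon> * card V) * ((1 + z) ^ card V *
      (3 powr (6 * \<epsilon> * card V) * 9 powr ((1 - \<mu>) * card V) * (8 / 9) powr (\<mu> * card V)))))"
proof -
  define n where "n = real (card V)"
  have fE: "finite E" using V finite_Kedges finite_subset by blast
  have p0: "p0 < m" using uv V(3) by auto
  define E' where "E' = {e \<in> E. u \<notin> e \<and> v \<notin> e}"
  define V' where "V' = V - {u, v}"
  have fV': "finite V'" using V by (simp add: V'_def)
  define Js where "Js = {(p, a, b). p < m \<and> p \<noteq> p0 \<and> a < (3::nat) \<and> b < (3::nat)}"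
  define bad where "bad = (\<lambda>(p, a, b) w s. f w = p \<and> {u, w} \<in> E \<and> {v, w} \<in> E \<and> s = (a :: nat, b :: nat))"
  define S where "S w = star_values E u w \<times> star_values E v w" for w
  define St where "St j = {s \<in> PiE V' S. card {w \<in> V'. bad j w (s w)} \<le> \<epsilon> * n}" for j
  have finJ: "finite Js" "card Js \<le> m * 9"
  proof -
    have sub: "Js \<subseteq> {..<m} \<times> {..<3} \<times> {..<3}" by (auto simp: Js_def)
    then show "finite Js" by (rule finite_subset) simp
    have "card Js \<le> card ({..<m} \<times> {..<3::nat} \<times> {..<3::nat})" using sub by (intro card_mono) auto
    then show "card Js \<le> m * 9" by (simp add: card_cartesian_product)
  qed
  have finSw: "finite (S w)" for w by (simp add: S_def)
  have finS: "finite (St j)" for j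
    unfolding St_def using finite_PiE[of V' S] fV' finSw by simp
  let ?C = "{c \<in> avoiding_colorings 3 k P E. typical \<xi> V f E c}"
  let ?h = "\<lambda>c. (restrict c E', c {u, v}, \<lambda>w\<in>V'. (c {u, w}, c {v, w}))"
  have inj: "inj_on ?h ?C"
  proof (rule inj_onI)
    fix c d assume c: "c \<in> ?C" and d: "d \<in> ?C" and eq: "?h c = ?h d"
    have cE: "c \<in> E \<rightarrow>\<^sub>E {..<3}" "d \<in> E \<rightarrow>\<^sub>E {..<3}" using c d by (auto simp: avoiding_colorings_def)
    have eq3: "restrict c E' = restrict d E'" "c {u, v} = d {u, v}"
      "(\<lambda>w\<in>V'. (c {u, w}, c {v, w})) = (\<lambda>w\<in>V'. (d {u, w}, d {v, w}))" using eq by simp_all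
    have pw: "c {u, w} = d {u, w}" "c {v, w} = d {v, w}" if "w \<in> V'" for w
      using fun_cong[OF eq3(3), of w] that by simp_all
    show "c = d"
    proof (rule PiE_ext[OF cE])
      fix e assume e: "e \<in> E"
      consider "e \<in> E'" | "u \<in> e" | "v \<in> e" using e by (auto simp: E'_def)
      then show "c e = d e"
      proof cases
        case 1
        then show ?thesis using fun_cong[OF eq3(1), of e] by simp
      next
        case 2
        obtain w where w: "w \<in> V" "w \<noteq> u" "e = {u, w}" using V(2) e 2 by (rule edge_at_vertex)
        show ?thesis using w pw(1)[of w] eq3(2) by (cases "w = v") (auto simp: V'_def)
      next
        case 3
        obtain w where w: "w \<in> V" "w \<noteq> v" "e = {v, w}" using V(2) e 3 by (rule edge_at_vertex)
        show ?thesis using w pw(2)[of w] eq3(2) by (cases "w = u") (auto simp: V'_def insert_commute)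
      qed
    qed
  qed
  have "?h ` ?C \<subseteq> avoiding_colorings 3 k P E' \<times> {..<3} \<times> (\<Union>j\<in>Js. St j)"
  proof (rule image_subsetI)
    fix c assume c: "c \<in> ?C"
    then have cE: "c \<in> E \<rightarrow>\<^sub>E {..<3}" by (auto simp: avoiding_colorings_def)
    have "\<exists>p a b. p < m \<and> p \<noteq> p0 \<and> a < 3 \<and> b < 3 \<and>
      card {w \<in> V. f w = p \<and> {u, w} \<in> E \<and> {v, w} \<in> E \<and> (c {u, w}, c {v, w}) = (a, b)} < \<epsilon> * card V"
      by (rule missing_pair_of_colours[OF V(1) _ V(2) _ _ \<xi> uv(3) p0]) (use uv c in auto)
    then obtain p a b where pab: "p < m" "p \<noteq> p0" "a < 3" "b < 3"
      "card {w \<in> V. f w = p \<and> {u, w} \<in> E \<and> {v, w} \<in> E \<and> (c {u, w}, c {v, w}) = (a, b)} < \<epsilon> * n"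
      unfolding n_def by blast
    define s where "s = (\<lambda>w\<in>V'. (c {u, w}, c {v, w}))"
    have "card {w \<in> V'. bad (p, a, b) w (s w)} \<le> card {w \<in> V. f w = p \<and> {u, w} \<in> E \<and> {v, w} \<in> E \<and> (c {u, w}, c {v, w}) = (a, b)}"
      using V by (intro card_mono) (auto simp: bad_def s_def V'_def)
    then have "card {w \<in> V'. bad (p, a, b) w (s w)} \<le> \<epsilon> * n" using pab(5) by linarith
    moreover have "s \<in> PiE V' S" unfolding s_def S_def using star_values_mem[OF cE] by auto
    ultimately have "s \<in> St (p, a, b)" by (simp add: St_def)
    moreover have "(p, a, b) \<in> Js" using pab by (simp add: Js_def)
    moreover have "restrict c E' \<in> avoiding_colorings 3 k P E'"
      by (rule avoiding_restrict) (use c in \<open>auto simp: E'_def\<close>)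
    moreover have "c {u, v} \<in> {..<3}" using cE uv(3) by auto
    ultimately show "?h c \<in> avoiding_colorings 3 k P E' \<times> {..<3} \<times> (\<Union>j\<in>Js. St j)" unfolding s_def by blast
  qed
  moreover have fin': "finite (avoiding_colorings 3 k P E' \<times> {..<3::nat} \<times> (\<Union>j\<in>Js. St j))"
    using finite_avoiding[of E'] fE finJ finS by (simp add: E'_def)
  ultimately have "card ?C \<le> card (avoiding_colorings 3 k P E' \<times> {..<3::nat} \<times> (\<Union>j\<in>Js. St j))" by (rule card_inj_on_le[OF inj])
  also have "\<dots> = c_count 3 k P E' * (3 * card (\<Union>j\<in>Js. St j))" by (simp add: card_cartesian_product c_count_def)
  finally have "real (card ?C) \<le> real (c_count 3 k P E' * (3 * card (\<Union>j\<in>Js. St j)))" by (rule of_nat_mono)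
  then have 1: "real (card ?C) \<le> real (c_count 3 k P E') * (3 * card (\<Union>j\<in>Js. St j))" by simp
  define R where "R = z powr (- \<epsilon> * n) * ((1 + z) ^ card V * (3 powr (6 * \<epsilon> * n) * 9 powr ((1 - \<mu>) * n) * (8 / 9) powr (\<mu> * n)))"
  have St: "card (St j) \<le> R" if j: "j \<in> Js" for j
  proof -
    obtain p a b where pab: "j = (p, a, b)" "p < m" "p \<noteq> p0" "a < 3" "b < 3" using j by (auto simp: Js_def)
    \<comment> \<open>Factors per vertex: \<open>A1\<close> and \<open>A2\<close> for the few edges
      inside class \<open>p0\<close>, \<open>A3\<close> for a free pair of colours outside it,
      \<open>A4\<close> for the saving in class \<open>p\<close>.\<close>
    define A1 where "A1 w = (if f w = p0 \<and> {u, w} \<in> E then 3 else (1::real))" for w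
    define A2 where "A2 w = (if f w = p0 \<and> {v, w} \<in> E then 3 else (1::real))" for w
    define A3 where "A3 w = (if f w \<noteq> p0 then 9 else (1::real))" for w
    define A4 where "A4 w = (if f w = p then 8 / 9 else (1::real))" for w
    have "real (card (St j)) \<le> z powr (- (\<epsilon> * n)) * (\<Prod>w\<in>V'. \<Sum>s\<in>S w. if bad j w s then z else 1)"
      unfolding St_def by (rule card_PiE_few_bad[OF fV' finSw z])
    also have "(\<Prod>w\<in>V'. \<Sum>s\<in>S w. if bad j w s then z else 1) \<le> (\<Prod>w\<in>V'. (1 + z) * (A1 w * A2 w * A3 w * A4 w))"
    proof (rule prod_mono, intro conjI)
      fix w
      show "(\<Sum>s\<in>S w. if bad j w s then z else 1) \<ge> 0" using z by (intro sum_nonneg) auto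
      have Sc: "card (S w) = (if {u, w} \<in> E then 3 else 1) * (if {v, w} \<in> E then 3 else 1)"
        by (simp add: S_def card_cartesian_product card_star_values)
      show "(\<Sum>s\<in>S w. if bad j w s then z else 1) \<le> (1 + z) * (A1 w * A2 w * A3 w * A4 w)"
      proof (cases "f w = p \<and> {u, w} \<in> E \<and> {v, w} \<in> E")
        case True
        have "(\<Sum>s\<in>S w. if bad j w s then z else 1) = (\<Sum>s\<in>S w. 1 - (if s = (a, b) then 1 - z else 0))"
          using True by (intro sum.cong) (auto simp: bad_def pab)
        also have "\<dots> = 9 - (1 - z)"
        proof -
          have "(a, b) \<in> S w" using True pab by (simp add: S_def star_values_def)
          then show ?thesis using finSw Sc True by (simp add: sum_subtractf)
        qed
        also have "\<dots> \<le> (1 + z) * (A1 w * A2 w * A3 w * A4 w)"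
          using True pab z by (simp add: A1_def A2_def A3_def A4_def)
        finally show ?thesis .
      next
        case False
        then have "(\<Sum>s\<in>S w. if bad j w s then z else 1) = (\<Sum>s\<in>S w. 1)"
          by (intro sum.cong) (auto simp: bad_def pab)
        also have "\<dots> = card (S w)" by simp
        also have "real (card (S w)) \<le> 1 * (A1 w * A2 w * A3 w * A4 w)"
          using False pab unfolding Sc by (auto simp: A1_def A2_def A3_def A4_def)
        also have "\<dots> \<le> (1 + z) * (A1 w * A2 w * A3 w * A4 w)"
          using z by (intro mult_right_mono) (auto simp: A1_def A2_def A3_def A4_def)
        finally show ?thesis .
      qed
    qed
    also have "\<dots> = (1 + z) ^ card V' * ((\<Prod>w\<in>V'. A1 w) * (\<Prod>w\<in>V'. A2 w) * (\<Prod>w\<in>V'. A3 w) * (\<Prod>w\<in>V'. A4 w))"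
      by (simp add: prod.distrib)
    also have "\<dots> \<le> (1 + z) ^ card V * (3 powr (3 * \<epsilon> * n) * 3 powr (3 * \<epsilon> * n) * 9 powr ((1 - \<mu>) * n) * (8 / 9) powr (\<mu> * n))"
    proof (intro mult_mono)
      show "(1 + z) ^ card V' \<le> (1 + z) ^ card V"
        using z V by (intro power_increasing card_mono) (auto simp: V'_def)
      have a: "3 ^ card {w \<in> V'. f w = p0 \<and> {x, w} \<in> E} \<le> (3::real) powr (3 * \<epsilon> * n)"
        if "card {w \<in> V. f w = p0 \<and> {x, w} \<in> E} \<le> 3 * \<epsilon> * n" for x
      proof -
        have "card {w \<in> V'. f w = p0 \<and> {x, w} \<in> E} \<le> card {w \<in> V. f w = p0 \<and> {x, w} \<in> E}"
          using V by (intro card_mono) (auto simp: V'_def)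
        then have "(3::real) powr card {w \<in> V'. f w = p0 \<and> {x, w} \<in> E} \<le> 3 powr (3 * \<epsilon> * n)"
          using that by (intro powr_mono) auto
        then show ?thesis by (simp add: powr_realpow)
      qed
      show "(\<Prod>w\<in>V'. A1 w) \<le> 3 powr (3 * \<epsilon> * n)" "(\<Prod>w\<in>V'. A2 w) \<le> 3 powr (3 * \<epsilon> * n)"
        using a[of u] a[of v] deg fV' unfolding n_def A1_def A2_def by (simp_all add: prod.If_cases Int_def)
      have p0card: "\<mu> * n \<le> card {w \<in> V. f w = p0}" using parts[OF p0] by (simp add: n_def)
      have "{w \<in> V'. f w \<noteq> p0} \<subseteq> V - {w \<in> V. f w = p0}" by (auto simp: V'_def)
      then have "card {w \<in> V'. f w \<noteq> p0} \<le> card (V - {w \<in> V. f w = p0})" using V by (intro card_mono) auto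
      also have "\<dots> = card V - card {w \<in> V. f w = p0}" using V by (intro card_Diff_subset) auto
      finally have "card {w \<in> V'. f w \<noteq> p0} + card {w \<in> V. f w = p0} \<le> card V"
        using card_mono[OF V(1), of "{w \<in> V. f w = p0}"] by fastforce
      then have "real (card {w \<in> V'. f w \<noteq> p0}) \<le> (1 - \<mu>) * n"
        using p0card unfolding n_def by (simp add: algebra_simps)
      then have "(9::real) powr card {w \<in> V'. f w \<noteq> p0} \<le> 9 powr ((1 - \<mu>) * n)" by (intro powr_mono) auto
      then show "(\<Prod>w\<in>V'. A3 w) \<le> 9 powr ((1 - \<mu>) * n)"
        using fV' unfolding A3_def by (simp add: prod.If_cases Int_def powr_realpow)
      \<comment> \<open>Neither \<open>u\<close> nor \<open>v\<close> is in class \<open>p\<close>,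
        so the whole class contributes to the saving.\<close>
      have "{w \<in> V'. f w = p} = {w \<in> V. f w = p}" using uv pab by (auto simp: V'_def)
      then have "\<mu> * n \<le> card {w \<in> V'. f w = p}" using parts[OF pab(2)] by (simp add: n_def)
      then have "(8 / 9 :: real) powr card {w \<in> V'. f w = p} \<le> (8 / 9) powr (\<mu> * n)" by (intro powr_mono') auto
      then show "(\<Prod>w\<in>V'. A4 w) \<le> (8 / 9) powr (\<mu> * n)"
        using fV' unfolding A4_def by (simp add: prod.If_cases Int_def powr_realpow)
    qed (use z in \<open>auto intro!: prod_nonneg mult_nonneg_nonneg simp: A1_def A2_def A3_def A4_def\<close>)
    also have "3 powr (3 * \<epsilon> * n) * 3 powr (3 * \<epsilon> * n) = (3::real) powr (6 * \<epsilon> * n)"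
      by (simp add: powr_add[symmetric] mult.assoc)
    finally show ?thesis using z by (simp add: R_def mult_left_mono)
  qed
  have "real (card (\<Union>j\<in>Js. St j)) \<le> (\<Sum>j\<in>Js. real (card (St j)))" by (rule real_card_UN_le[OF finJ(1)])
  also have "\<dots> \<le> (\<Sum>j\<in>Js. R)" by (rule sum_mono) (rule St)
  also have "\<dots> = card Js * R" by simp
  also have "\<dots> \<le> real (m * 9) * R"
    using of_nat_mono[OF finJ(2)] z by (intro mult_right_mono) (auto simp: R_def)
  finally have "real (card (\<Union>j\<in>Js. St j)) \<le> real (m * 9) * R" .
  then have "3 * real (card (\<Union>j\<in>Js. St j)) \<le> 3 * (real (m * 9) * R)" by (rule mult_left_mono) simp
  also have "\<dots> = 27 * m * R" by simp
  finally have "3 * real (card (\<Union>j\<in>Js. St j)) \<le> 27 * m * R" .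
  then have "real (c_count 3 k P E') * (3 * card (\<Union>j\<in>Js. St j)) \<le> c_count 3 k P E' * (27 * m * R)"
    by (intro mult_left_mono) auto
  then show ?thesis using 1 unfolding R_def n_def E'_def by linarith
qed

end

section \<open>The Turan graph is optimal\<close>

lemma count_le_pow:
  assumes "finite E"
  shows "c_count 3 k P E \<le> 3 ^ card E"
proof -
  have f: "finite (E \<rightarrow>\<^sub>E {..<3::nat})" by (rule finite_PiE[OF assms]) simp
  have "avoiding_colorings 3 k P E \<subseteq> E \<rightarrow>\<^sub>E {..<3}" by (auto simp: avoiding_colorings_def)
  from card_mono[OF f this] show ?thesis using assms by (simp add: c_count_def card_PiE)
qed

text \<open>Moving \<open>v\<close> to class \<open>p\<close> changes the number of interior pairs
  by twice the difference of its degrees into the two classes, so in a minimiser every vertex has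
  its fewest neighbours in its own class.\<close>

lemma minimal_interior_partition:
  fixes m :: nat
  assumes V: "finite V" "E \<subseteq> Kedges V" and f0: "f0 ` V \<subseteq> {..<m}"
  shows "\<exists>f. f ` V \<subseteq> {..<m} \<and>
    pc V V (\<lambda>x y. f x = f y \<and> {x, y} \<in> E) \<le> pc V V (\<lambda>x y. f0 x = f0 y \<and> {x, y} \<in> E) \<and>
    (\<forall>v\<in>V. \<forall>p<m. card {w \<in> V. f w = f v \<and> {v, w} \<in> E} \<le> card {w \<in> V. f w = p \<and> {v, w} \<in> E})"
proof -
  \<comment> \<open>Extensional maps, so that the minimum is over a finite set.\<close>
  define S where "S = V \<rightarrow>\<^sub>E {..<m}"
  define h where "h f = pc V V (\<lambda>x y. f x = f y \<and> {x, y} \<in> E)" for f :: "nat \<Rightarrow> nat"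
  have S: "finite S" "restrict f0 V \<in> S" using V f0 unfolding S_def by (auto intro: finite_PiE)
  define f where "f = arg_min_on h S"
  have fS: "f \<in> S" unfolding f_def using S by (intro arg_min_if_finite(1)) auto
  have min: "h f \<le> h g" if "g \<in> S" for g
    using arg_min_if_finite(2)[OF S(1), of h] S(2) that unfolding f_def by (force simp: not_less)
  have "h (restrict f0 V) = pc V V (\<lambda>x y. f0 x = f0 y \<and> {x, y} \<in> E)"
    unfolding h_def by (rule pc_cong) auto
  moreover have "card {w \<in> V. f w = f v \<and> {v, w} \<in> E} \<le> card {w \<in> V. f w = p \<and> {v, w} \<in> E}" if v: "v \<in> V" and p: "p < m" for v p
  proof -
    define W where "W = V - {v}"
    have W: "finite W" "v \<notin> W" "V = insert v W" using V v by (auto simp: W_def)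
    have vv: "{v, v} \<notin> E" using V(2) by (auto simp: Kedges_def)
    let ?g = "f(v := p)"
    have gS: "?g \<in> S" using fS v p unfolding S_def by auto
    have hf: "h f = pc W W (\<lambda>x y. f x = f y \<and> {x, y} \<in> E) + 2 * card {y \<in> W. f v = f y \<and> {v, y} \<in> E}"
      unfolding h_def W(3) by (rule pc_insert_vertex) (use W vv in \<open>auto simp: insert_commute\<close>)
    have "h ?g = pc W W (\<lambda>x y. ?g x = ?g y \<and> {x, y} \<in> E) + 2 * card {y \<in> W. ?g v = ?g y \<and> {v, y} \<in> E}"
      unfolding h_def W(3) by (rule pc_insert_vertex) (use W vv in \<open>auto simp: insert_commute\<close>)
    moreover have "pc W W (\<lambda>x y. ?g x = ?g y \<and> {x, y} \<in> E) = pc W W (\<lambda>x y. f x = f y \<and> {x, y} \<in> E)"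
      by (rule pc_cong) (use W in auto)
    moreover have "{y \<in> W. ?g v = ?g y \<and> {v, y} \<in> E} = {w \<in> V. f w = p \<and> {v, w} \<in> E}"
      using vv W by auto
    moreover have "{y \<in> W. f v = f y \<and> {v, y} \<in> E} = {w \<in> V. f w = f v \<and> {v, w} \<in> E}"
      using vv W by auto
    ultimately show ?thesis using min[OF gS] hf by simp
  qed
  ultimately show ?thesis using min[OF S(2)] fS unfolding h_def S_def
    by (intro exI[of _ f]) auto
qed

section \<open>Numerical bounds for deleting vertices\<close>

lemma powr_mult_nat: "(x :: real) > 0 \<Longrightarrow> x powr (a * b) = (x powr a) powr b"
  by (simp add: powr_powr)

text \<open>The number of stars, about \<open>(8/27 * 3 ^ m) ^ (N / m)\<close>, is below the gain of
  the Turan graph by the factor \<open>(8/9) powr (N / m)\<close>, which is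
  \<open>\<omega> powr (- 8 * N)\<close>. Three errors use one power \<open>\<omega> ^ N\<close>
  each, and what is left absorbs the constants and \<open>m ^ 3\<close>. The leading 6 is what
  \<open>excess_step\<close> demands.\<close>

lemma one_vertex_extension_bound:
  fixes \<omega> \<epsilon> \<gamma> z :: real and m N :: nat
  assumes "m \<ge> 2" and \<omega>: "\<omega> = (9 / 8) powr (1 / (8 * m))" and z: "0 < z" "1 + 4 * z \<le> \<omega>" "z powr (- 3 * \<epsilon>) \<le> \<omega>"
    and \<gamma>: "(81 / 8) powr \<gamma> \<le> \<omega>" "\<gamma> \<ge> 0" and N: "N \<ge> 1" "19683 * real (m ^ 3) \<le> \<omega> ^ N"
  shows "6 * (real (m ^ 3) * (z powr (- 3 * \<epsilon> * N) * (3 ^ N * (1 + 4 * z) ^ N * (2 / 3) powr (3 * (1 / m - \<gamma>) * N - 3))))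
    \<le> 3 powr ((1 - 1 / m) * (real N - 1))"
proof -
  define n where "n = real N"
  have n: "n \<ge> 1" using N by (simp add: n_def)
  have w1: "\<omega> \<ge> 1" unfolding \<omega> by (rule ge_one_powr_ge_zero) auto
  have a1: "z powr (- 3 * \<epsilon> * n) \<le> \<omega> powr n"
    using z n unfolding powr_mult_nat[OF z(1)] by (intro powr_mono2) auto
  have a2: "(1 + 4 * z) ^ N \<le> \<omega> powr n"
  proof -
    have "(1 + 4 * z) ^ N \<le> \<omega> ^ N" using z by (intro power_mono) auto
    then show ?thesis using w1 by (simp add: n_def powr_realpow)
  qed
  have a3: "(2 / 3) powr (3 * (1 / m - \<gamma>) * n - 3) \<le> 27 / 8 * ((8 / 27) powr (n / m) * \<omega> powr n)"
  proof -
    have "(2 / 3 :: real) powr (3 * (1 / m - \<gamma>) * n - 3) = (2 / 3) powr (3 * (n / m)) * (2 / 3) powr (- (3 * (\<gamma> * n))) * (2 / 3) powr (- 3)"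
      by (simp add: powr_add[symmetric] algebra_simps)
    also have "(2 / 3 :: real) powr (3 * (n / m)) = (8 / 27) powr (n / m)"
    proof -
      have "(2 / 3 :: real) powr (3 * (n / m)) = ((2 / 3) powr 3) powr (n / m)" by (simp only: powr_powr)
      also have "(2 / 3 :: real) powr 3 = 8 / 27" by (simp add: powr_numeral power3_eq_cube)
      finally show ?thesis .
    qed
    also have "(2 / 3 :: real) powr (- 3) = 27 / 8" by (simp add: powr_minus powr_numeral power3_eq_cube)
    also have "(2 / 3 :: real) powr (- (3 * (\<gamma> * n))) = ((27 / 8) powr \<gamma>) powr n"
    proof -
      have "(2 / 3 :: real) powr (- (3 * (\<gamma> * n))) = ((2 / 3) powr (- 3)) powr (\<gamma> * n)" by (simp add: powr_powr)
      also have "(2 / 3 :: real) powr (- 3) = 27 / 8" by (simp add: powr_minus powr_numeral power3_eq_cube)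
      finally show ?thesis by (simp add: powr_powr)
    qed
    also have "((27 / 8) powr \<gamma>) powr n \<le> \<omega> powr n"
    proof (rule powr_mono2)
      \<comment> \<open>A defect \<open>\<gamma>\<close> in the class sizes costs
        \<open>(3/2) ^ 3 = 27/8\<close> here; the larger base 81/8 serves both deletion
        bounds.\<close>
      have "(27 / 8) powr \<gamma> \<le> (81 / 8) powr \<gamma>" using \<gamma> by (intro powr_mono2) auto
      then show "(27 / 8) powr \<gamma> \<le> \<omega>" using \<gamma> by linarith
    qed (use n in auto)
    finally show ?thesis by (simp add: mult_ac)
  qed
  have w8: "(8 / 9 :: real) powr (n / m) = \<omega> powr (- 8 * n)"
  proof -
    have "\<omega> powr (- 8 * n) = (9 / 8) powr (- (n / m))" unfolding \<omega> powr_powr using assms(1) by (simp add: field_simps)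
    also have "\<dots> = (8 / 9) powr (n / m)" by (simp add: powr_minus powr_divide inverse_eq_divide)
    finally show ?thesis by simp
  qed
  have a4: "3 ^ N * (8 / 27) powr (n / m) = 3 powr (n - n / m) * \<omega> powr (- 8 * n)"
  proof -
    have "(8 / 27 :: real) powr (n / m) = (1 / 3 * (8 / 9)) powr (n / m)" by simp
    also have "\<dots> = (1 / 3) powr (n / m) * (8 / 9) powr (n / m)" by (rule powr_mult)
    also have "(1 / 3 :: real) powr (n / m) = 3 powr (- (n / m))" by (simp add: powr_minus powr_divide inverse_eq_divide)
    finally have "(3::real) ^ N * (8 / 27) powr (n / m) = 3 powr n * 3 powr (- (n / m)) * (8 / 9) powr (n / m)"
      by (simp add: n_def powr_realpow)
    then show ?thesis unfolding w8 by (simp add: powr_add[symmetric])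
  qed
  have "6 * (real (m ^ 3) * (z powr (- 3 * \<epsilon> * n) * (3 ^ N * (1 + 4 * z) ^ N * (2 / 3) powr (3 * (1 / m - \<gamma>) * n - 3))))
    \<le> 6 * (real (m ^ 3) * (\<omega> powr n * (3 ^ N * \<omega> powr n * (27 / 8 * ((8 / 27) powr (n / m) * \<omega> powr n)))))"
    using a1 a2 a3 z(1) by (intro mult_left_mono mult_mono) auto
  also have "\<dots> = 81 / 4 * real (m ^ 3) * (3 ^ N * (8 / 27) powr (n / m)) * (\<omega> powr n * \<omega> powr n * \<omega> powr n)" by simp
  also have "\<dots> = 81 / 4 * real (m ^ 3) * \<omega> powr (- 5 * n) * 3 powr (n - n / m)"
    unfolding a4 by (simp add: powr_add[symmetric])
  also have "81 / 4 * real (m ^ 3) \<le> \<omega> powr (5 * n) * (1 / 3)"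
  proof -
    have "81 / 4 * real (m ^ 3) * 3 \<le> 19683 * real (m ^ 3)" by simp
    also have "\<dots> \<le> \<omega> powr n" using N(2) w1 by (simp add: n_def powr_realpow)
    also have "\<dots> \<le> \<omega> powr (5 * n)" using n w1 by (intro powr_mono) auto
    finally show ?thesis by simp
  qed
  also have "\<omega> powr (5 * n) * (1 / 3) * \<omega> powr (- 5 * n) * 3 powr (n - n / m) = 1 / 3 * 3 powr (n - n / m)"
    using w1 by (simp add: powr_minus)
  also have "\<dots> = 3 powr (n - n / m - 1)" by (simp add: powr_diff)
  also have "\<dots> \<le> 3 powr ((1 - 1 / m) * (n - 1))" using assms(1) by (intro powr_mono) (auto simp: algebra_simps intro: divide_right_mono)
  finally show ?thesis by (simp add: n_def mult_right_mono)
qed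

text \<open>The same gap \<open>(8/9) powr (N / m)\<close>, now from one rare pair of colours among
  nine. Four errors use a power of \<open>\<omega>\<close>, one more than before because of the
  edges inside the class; a defect \<open>\<gamma>\<close> in the class sizes costs the base
  \<open>9 * (9/8) = 81/8\<close>.\<close>

lemma two_vertex_extension_bound:
  fixes \<omega> \<epsilon> \<gamma> z :: real and m N :: nat
  assumes "m \<ge> 2" and \<omega>: "\<omega> = (9 / 8) powr (1 / (8 * m))" and z: "0 < z" "z \<le> 1" "1 + 4 * z \<le> \<omega>" "z powr (- 3 * \<epsilon>) \<le> \<omega>"
    and \<epsilon>: "3 powr (6 * \<epsilon>) \<le> \<omega>" "\<epsilon> \<ge> 0"
    and \<gamma>: "(81 / 8) powr \<gamma> \<le> \<omega>" and N: "N \<ge> 1" "19683 * real (m ^ 3) \<le> \<omega> ^ N"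
  shows "6 * (27 * m * (z powr (- \<epsilon> * N) * ((1 + z) ^ N *
      (3 powr (6 * \<epsilon> * N) * 9 powr ((1 - (1 / m - \<gamma>)) * N) * (8 / 9) powr ((1 / m - \<gamma>) * N)))))
    \<le> 3 powr ((1 - 1 / m) * (2 * real N - 3))"
proof -
  define n where "n = real N"
  have n: "n \<ge> 1" using N by (simp add: n_def)
  have w1: "\<omega> \<ge> 1" unfolding \<omega> by (rule ge_one_powr_ge_zero) auto
  have a1: "z powr (- \<epsilon> * n) \<le> \<omega> powr n"
  proof -
    have "z powr (- \<epsilon>) \<le> z powr (- 3 * \<epsilon>)" using z \<epsilon> by (intro powr_mono') auto
    then show ?thesis using z n unfolding powr_mult_nat[OF z(1)] by (intro powr_mono2) auto
  qed
  have a2: "(1 + z) ^ N \<le> \<omega> powr n"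
  proof -
    have "(1 + z) ^ N \<le> \<omega> ^ N" using z by (intro power_mono) auto
    then show ?thesis using w1 by (simp add: n_def powr_realpow)
  qed
  have a3: "3 powr (6 * \<epsilon> * n) \<le> \<omega> powr n"
    using \<epsilon> n unfolding powr_mult_nat[of 3 "6 * \<epsilon>" n, simplified] by (intro powr_mono2) auto
  have w8: "(8 / 9 :: real) powr (n / m) = \<omega> powr (- 8 * n)"
  proof -
    have "\<omega> powr (- 8 * n) = (9 / 8) powr (- (n / m))" unfolding \<omega> powr_powr using assms(1) by (simp add: field_simps)
    also have "\<dots> = (8 / 9) powr (n / m)" by (simp add: powr_minus powr_divide inverse_eq_divide)
    finally show ?thesis by simp
  qed
  have a4: "9 powr ((1 - (1 / m - \<gamma>)) * n) * (8 / 9) powr ((1 / m - \<gamma>) * n) \<le> 9 powr (n - n / m) * (\<omega> powr n * \<omega> powr (- 8 * n))"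
  proof -
    have "9 powr ((1 - (1 / m - \<gamma>)) * n) = 9 powr (n - n / m) * (9 :: real) powr (\<gamma> * n)"
      by (simp add: powr_add[symmetric] algebra_simps)
    moreover have "(8 / 9 :: real) powr ((1 / m - \<gamma>) * n) = (8 / 9) powr (n / m) * (8 / 9) powr (- (\<gamma> * n))"
      by (simp add: powr_add[symmetric] algebra_simps)
    moreover have "(8 / 9 :: real) powr (- (\<gamma> * n)) = (9 / 8) powr (\<gamma> * n)"
      by (simp add: powr_minus powr_divide inverse_eq_divide)
    moreover have "9 powr (\<gamma> * n) * (9 / 8 :: real) powr (\<gamma> * n) = ((81 / 8) powr \<gamma>) powr n"
      by (simp add: powr_mult[symmetric] powr_powr)
    moreover have "((81 / 8 :: real) powr \<gamma>) powr n \<le> \<omega> powr n" using \<gamma> n by (intro powr_mono2) auto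
    ultimately have "9 powr ((1 - (1 / m - \<gamma>)) * n) * (8 / 9) powr ((1 / m - \<gamma>) * n)
      = 9 powr (n - n / m) * \<omega> powr (- 8 * n) * ((81 / 8) powr \<gamma>) powr n"
      unfolding w8 by (simp add: mult_ac)
    also have "\<dots> \<le> 9 powr (n - n / m) * \<omega> powr (- 8 * n) * \<omega> powr n"
      using \<open>((81 / 8 :: real) powr \<gamma>) powr n \<le> \<omega> powr n\<close> by (intro mult_left_mono) auto
    finally show ?thesis by (simp add: mult_ac)
  qed
  have "6 * (27 * m * (z powr (- \<epsilon> * n) * ((1 + z) ^ N *
      (3 powr (6 * \<epsilon> * n) * 9 powr ((1 - (1 / m - \<gamma>)) * n) * (8 / 9) powr ((1 / m - \<gamma>) * n)))))
    = 162 * real m * (z powr (- \<epsilon> * n) * ((1 + z) ^ N *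
      (3 powr (6 * \<epsilon> * n) * (9 powr ((1 - (1 / m - \<gamma>)) * n) * (8 / 9) powr ((1 / m - \<gamma>) * n)))))" by simp
  also have "\<dots> \<le> 162 * real m * (\<omega> powr n * (\<omega> powr n * (\<omega> powr n * (9 powr (n - n / m) * (\<omega> powr n * \<omega> powr (- 8 * n))))))"
  proof -
    have "a * (b * (c * d)) \<le> w * (w * (w * D))"
      if "a \<le> w" "b \<le> w" "c \<le> w" "d \<le> D" "0 \<le> a" "0 \<le> b" "0 \<le> c" "0 \<le> d" for a b c d w D :: real
      using that by (intro mult_mono) auto
    from this[OF a1 a2 a3 a4] show ?thesis using z(1) by (intro mult_left_mono) auto
  qed
  also have "\<dots> = 162 * real m * \<omega> powr (- 4 * n) * 9 powr (n - n / m)"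
    by (simp add: powr_add[symmetric])
  also have "162 * real m \<le> \<omega> powr (4 * n) * (1 / 27)"
  proof -
    have "1 * 1 \<le> real m * real m" using assms(1) by (intro mult_mono) auto
    then have "real m * 1 \<le> real m * (real m * real m)" by (intro mult_left_mono) auto
    then have "162 * real m * 27 \<le> 19683 * real (m ^ 3)" by (simp add: power3_eq_cube)
    also have "\<dots> \<le> \<omega> powr n" using N(2) w1 by (simp add: n_def powr_realpow)
    also have "\<dots> \<le> \<omega> powr (4 * n)" using n w1 by (intro powr_mono) auto
    finally show ?thesis by simp
  qed
  also have "\<omega> powr (4 * n) * (1 / 27) * \<omega> powr (- 4 * n) * 9 powr (n - n / m) = 1 / 27 * 9 powr (n - n / m)"
    using w1 by (simp add: powr_minus)
  also have "\<dots> = 3 powr (2 * (n - n / m) - 3)"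
  proof -
    have "(9 :: real) powr (n - n / m) = (3 powr 2) powr (n - n / m)" by (simp add: powr_numeral)
    also have "\<dots> = 3 powr (2 * (n - n / m))" by (rule powr_powr)
    finally show ?thesis by (simp add: powr_diff powr_numeral)
  qed
  also have "\<dots> \<le> 3 powr ((1 - 1 / m) * (2 * n - 3))" using assms(1) by (intro powr_mono) (auto simp: algebra_simps intro: divide_right_mono)
  finally show ?thesis by (simp add: n_def mult_right_mono)
qed

text \<open>Split the decay into two halves of exponent \<open>x\<close>. One pays for the surplus
  of edges over \<open>T\<close>, using \<open>3 \<le> (12/11) ^ 13\<close> and
  \<open>26 = 2 * 13\<close>. The other pays for the union bound, using
  \<open>6 * 4 \<le> (12/11) ^ 37\<close> and \<open>148 = 4 * 37\<close>.\<close>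

lemma atypical_decay:
  fixes \<xi> g :: real
  assumes "0 < \<xi>" "g \<le> \<xi>\<^sup>2 / 26" "N \<ge> 1" "real N \<ge> 148 / \<xi>\<^sup>2" "real e \<le> T + g / 2 * (real N)\<^sup>2"
  shows "3 * 4 ^ N * (3 ^ e * (11 / 12) powr (\<xi>\<^sup>2 / 2 * (real N)\<^sup>2)) \<le> (1 / 2) * 3 ^ T"
proof -
  define x where "x = \<xi>\<^sup>2 / 4 * (real N)\<^sup>2"
  have x0: "x \<ge> 0" by (simp add: x_def)
  have d: "(11 / 12 :: real) powr y = (12 / 11) powr (- y)" for y
    by (simp add: powr_minus powr_divide inverse_eq_divide)
  have "(3::real) ^ e = 3 powr e" by (simp add: powr_realpow)
  also have "\<dots> \<le> 3 powr (T + g / 2 * (real N)\<^sup>2)" using assms(5) by (intro powr_mono) auto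
  also have "\<dots> = 3 ^ T * 3 powr (g / 2 * (real N)\<^sup>2)" by (simp add: powr_add powr_realpow)
  also have "3 powr (g / 2 * (real N)\<^sup>2) \<le> (12 / 11) powr x"
  proof -
    have "g * (real N)\<^sup>2 \<le> \<xi>\<^sup>2 / 26 * (real N)\<^sup>2" using assms(2) by (intro mult_right_mono) auto
    then have "g / 2 * (real N)\<^sup>2 \<le> x / 13" by (simp add: x_def)
    then have "3 powr (g / 2 * (real N)\<^sup>2) \<le> 3 powr (x / 13)" by (intro powr_mono) auto
    also have "\<dots> \<le> ((12 / 11) powr 13) powr (x / 13)"
      using x0 by (intro powr_mono2) (auto simp: powr_numeral power_divide)
    also have "\<dots> = (12 / 11) powr x" by (simp only: powr_powr) simp
    finally show ?thesis .
  qed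
  finally have e: "(3::real) ^ e \<le> 3 ^ T * (12 / 11) powr x" by simp
  have n: "6 * 4 ^ N \<le> (12 / 11) powr x"
  proof -
    have "(6 * 4 ^ N :: real) \<le> 6 ^ N * 4 ^ N" using assms(3) power_increasing[of 1 N "6 :: real"] by (intro mult_right_mono) auto
    also have "\<dots> = 24 powr N" by (simp add: powr_realpow flip: power_mult_distrib)
    also have "\<dots> \<le> ((12 / 11) powr 37) powr N"
      by (intro powr_mono2) (auto simp: powr_numeral power_divide)
    also have "\<dots> = (12 / 11) powr (37 * N)" by (simp only: powr_powr) simp
    also have "\<dots> \<le> (12 / 11) powr x"
    proof (rule powr_mono)
      have "148 \<le> \<xi>\<^sup>2 * N" using assms(1,4) by (simp add: field_simps)
      then have "148 * real N \<le> \<xi>\<^sup>2 * N * real N" by (intro mult_right_mono) auto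
      then show "real (37 * N) \<le> x" by (simp add: x_def power2_eq_square)
    qed simp
    finally show ?thesis .
  qed
  have "3 * 4 ^ N * (3 ^ e * (11 / 12) powr (\<xi>\<^sup>2 / 2 * (real N)\<^sup>2)) = 3 * 4 ^ N * (3 ^ e * (12 / 11) powr (- (x + x)))"
    unfolding d by (simp add: x_def)
  also have "\<dots> \<le> (1 / 2 * (12 / 11) powr x) * ((3 ^ T * (12 / 11) powr x) * (12 / 11) powr (- (x + x)))"
  proof -
    have "3 * 4 ^ N \<le> 1 / 2 * (12 / 11 :: real) powr x" using n by simp
    from mult_mono[OF this mult_right_mono[OF e]] show ?thesis by simp
  qed
  also have "\<dots> = 1 / 2 * 3 ^ T * ((12 / 11) powr x * (12 / 11) powr x * (12 / 11) powr (- (x + x)))" by simp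
  also have "(12 / 11) powr x * (12 / 11) powr x * (12 / 11) powr (- (x + x)) = (1 :: real)"
    by (simp add: powr_add[symmetric])
  finally show ?thesis by simp
qed

section \<open>Descent by deleting one or two vertices\<close>

context two_class_pattern
begin

definition excess :: "nat set \<Rightarrow> nat set set \<Rightarrow> real" where
  "excess V E = c_count 3 k P E / 3 ^ tur m (card V)"

text \<open>The atypical part \<open>a\<close> is less than half of \<open>X\<close>, so
  \<open>X\<close> is at most \<open>2 * b\<close> times the count on the smaller graph. This
  accounts for a factor 2 in the 6; the other factor 3 is the gain.\<close>

lemma excess_step:
  fixes a b d :: real and X t t' :: nat
  assumes "real X \<le> c_count 3 k P E' * b + a" "a \<le> 1 / 2 * 3 ^ t" "3 ^ t < X" "6 * b \<le> 3 powr d" "real t' + d \<le> t"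
  shows "3 * (real X / 3 ^ t) \<le> c_count 3 k P E' / 3 ^ t'"
proof -
  define C where "C = real (c_count 3 k P E')"
  have "(3::real) ^ t < X" using assms(3) by (metis of_nat_less_iff of_nat_numeral of_nat_power)
  then have "real X \<le> 2 * (C * b)" using assms(1,2) unfolding C_def by linarith
  then have "3 * real X \<le> C * (6 * b)" by simp
  also have "\<dots> \<le> C * 3 powr d" using assms(4) by (intro mult_left_mono) (auto simp: C_def)
  also have "\<dots> \<le> C * 3 powr (real t - real t')" using assms(5) by (intro mult_left_mono powr_mono) (auto simp: C_def)
  also have "\<dots> = C * 3 ^ t / 3 ^ t'" by (simp add: powr_diff powr_realpow)
  finally show ?thesis unfolding C_def by (simp add: field_simps)
qed

lemma excess_increases:
  "\<exists>n0. \<forall>V E. finite V \<longrightarrow> card V \<ge> n0 \<longrightarrow> E \<subseteq> Kedges V \<longrightarrow> excess V E > 1 \<longrightarrow>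
    (\<exists>W E'. W \<subseteq> V \<and> (card V = card W + 1 \<or> card V = card W + 2) \<and> E' \<subseteq> Kedges W \<and> 3 * excess V E \<le> excess W E')"
proof -
  \<comment> \<open>The gap \<open>(8/9) powr (n / m)\<close> of both deletion bounds is cut into
    eight equal parts, and every error below is chosen to fit into one of them.\<close>
  define \<omega> :: real where "\<omega> = (9 / 8) powr (1 / (8 * m))"
  have \<omega>: "\<omega> > 1" unfolding \<omega>_def using m_ge k3 by (intro gr_one_powr) auto
  define z where "z = min 1 ((\<omega> - 1) / 4)"
  have z: "0 < z" "z \<le> 1" "1 + 4 * z \<le> \<omega>" using \<omega> by (auto simp: z_def min_def field_simps)
  obtain t1 where t1: "t1 > 0" "\<And>s. \<bar>s\<bar> \<le> t1 \<Longrightarrow> z powr s \<le> \<omega>" using powr_near_one[OF z(1) \<omega>] by blast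
  obtain t2 where t2: "t2 > 0" "\<And>s. \<bar>s\<bar> \<le> t2 \<Longrightarrow> 3 powr s \<le> \<omega>" using powr_near_one[of 3, OF _ \<omega>] by auto
  obtain \<gamma> where \<gamma>: "\<gamma> > 0" "(81 / 8) powr \<gamma> \<le> \<omega>"
    using powr_near_one[of "81 / 8", OF _ \<omega>] by (metis abs_of_pos order_refl zero_less_divide_iff zero_less_numeral)
  define \<epsilon> where "\<epsilon> = min (t1 / 3) (t2 / 6)"
  have \<epsilon>: "\<epsilon> > 0" using t1(1) t2(1) by (simp add: \<epsilon>_def)
  have "\<bar>- 3 * \<epsilon>\<bar> \<le> t1" "\<bar>6 * \<epsilon>\<bar> \<le> t2" using \<epsilon> by (auto simp: \<epsilon>_def min_def)
  then have \<epsilon>b: "z powr (- 3 * \<epsilon>) \<le> \<omega>" "3 powr (6 * \<epsilon>) \<le> \<omega>" using t1(2) t2(2) by blast+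
  \<comment> \<open>Scaled so that candidate sets of size \<open>\<epsilon> * card V\<close> survive
    all steps of the greedy embedding.\<close>
  define \<xi> where "\<xi> = \<epsilon> / (k * 16 ^ k)"
  have \<xi>: "\<xi> > 0" "k * \<xi> * 16 ^ k \<le> \<epsilon>" using \<epsilon> k3 by (auto simp: \<xi>_def)
  define g where "g = min (\<xi>\<^sup>2 / 26) (\<gamma>\<^sup>2 / 2)"
  have g: "g > 0" "g \<le> \<xi>\<^sup>2 / 26" "g \<le> \<gamma>\<^sup>2 / 2" using \<xi> \<gamma> by (auto simp: g_def)
  have sg: "sqrt (2 * g) \<le> \<gamma>" using g(1,3) \<gamma>(1) by (intro real_le_lsqrt) auto
  obtain N1 where N1: "\<And>V E. finite V \<Longrightarrow> card V \<ge> N1 \<Longrightarrow> E \<subseteq> Kedges V \<Longrightarrow> 3 ^ tur m (card V) < c_count 3 k P E \<Longrightarrow>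
    (\<exists>f. f ` V \<subseteq> {..<m} \<and> pc V V (\<lambda>x y. f x = f y \<and> {x, y} \<in> E) \<le> g * (card V)\<^sup>2)"
    using few_interior_edges[OF g(1)] by blast
  obtain N2 :: nat where N2: "19683 * real (m ^ 3) \<le> \<omega> ^ N2" using real_arch_pow[OF \<omega>, of "19683 * real (m ^ 3)"] less_imp_le by blast
  obtain N3 :: nat where N3: "148 / \<xi>\<^sup>2 \<le> N3" using real_arch_simple by blast
  obtain N4 :: nat where N4: "1 / g \<le> N4" using real_arch_simple by blast
  define n0 where "n0 = N1 + N2 + N3 + N4 + 2"
  show ?thesis
  proof (intro exI[of _ n0] allI impI)
    fix V :: "nat set" and E
    assume V: "finite V" "n0 \<le> card V" "E \<subseteq> Kedges V" and ex: "excess V E > 1"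
    define N where "N = card V"
    have N: "N \<ge> N1" "N \<ge> N2" "N \<ge> 2" "148 / \<xi>\<^sup>2 \<le> N" "1 / g \<le> N" using V(2) N3 N4 unfolding n0_def N_def by auto
    have Nw: "19683 * real (m ^ 3) \<le> \<omega> ^ N" using N2 power_increasing[OF N(2), of \<omega>] \<omega> by linarith
    have Vne: "V \<noteq> {}" using N(3) unfolding N_def by auto
    have m1: "1 \<le> m" using m_ge by simp
    have fE: "finite E" using V finite_Kedges finite_subset by blast
    define T where "T = tur m N"
    define X where "X = c_count 3 k P E"
    have "(3::real) ^ T < X" using ex unfolding excess_def X_def T_def N_def by (simp add: less_divide_eq)
    then have TX: "3 ^ T < X" by (metis of_nat_less_iff of_nat_numeral of_nat_power)
    \<comment> \<open>Even if all colourings avoided the pattern, so many of them need more edges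
      than the Turan graph has.\<close>
    have "3 ^ T < (3::nat) ^ card E" using TX count_le_pow[OF fE] unfolding X_def by (rule less_le_trans)
    then have TE: "T < card E" by simp
    obtain f0 where f0: "f0 ` V \<subseteq> {..<m}" "pc V V (\<lambda>x y. f0 x = f0 y \<and> {x, y} \<in> E) \<le> g * (card V)\<^sup>2"
      using N1[OF V(1) _ V(3)] N(1) TX unfolding N_def T_def X_def by blast
    obtain f where f: "f ` V \<subseteq> {..<m}"
      "pc V V (\<lambda>x y. f x = f y \<and> {x, y} \<in> E) \<le> pc V V (\<lambda>x y. f0 x = f0 y \<and> {x, y} \<in> E)"
      "\<And>v p. v \<in> V \<Longrightarrow> p < m \<Longrightarrow> card {w \<in> V. f w = f v \<and> {v, w} \<in> E} \<le> card {w \<in> V. f w = p \<and> {v, w} \<in> E}"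
      using minimal_interior_partition[OF V(1,3) f0(1)] by blast
    define int where "int = pc V V (\<lambda>x y. f x = f y \<and> {x, y} \<in> E)"
    define cut where "cut = pc V V (\<lambda>x y. f x \<noteq> f y)"
    define mis where "mis = pc V V (\<lambda>x y. f x \<noteq> f y \<and> {x, y} \<notin> E)"
    have int: "real int \<le> g * (real N)\<^sup>2" using f(2) f0(2) unfolding int_def N_def by simp
    have cutT: "cut \<le> 2 * T" unfolding cut_def T_def N_def by (rule cut_le_tur[OF V(1) m1 f(1)])
    have E_eq: "2 * card E + mis = int + cut"
    proof -
      have "2 * card E = pc V V (\<lambda>x y. {x, y} \<in> E)" using pc_edges[OF V(1,3)] by simp
      also have "\<dots> = pc V V (\<lambda>x y. {x, y} \<in> E \<and> f x = f y) + pc V V (\<lambda>x y. {x, y} \<in> E \<and> f x \<noteq> f y)"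
        by (rule pc_split[OF V(1,1)])
      also have "pc V V (\<lambda>x y. {x, y} \<in> E \<and> f x = f y) = int" unfolding int_def by (rule pc_cong) auto
      also have "pc V V (\<lambda>x y. {x, y} \<in> E \<and> f x \<noteq> f y) = pc V V (\<lambda>x y. f x \<noteq> f y \<and> {x, y} \<in> E)" by (rule pc_cong) auto
      finally show ?thesis
        unfolding cut_def mis_def using pc_split[OF V(1,1), of "\<lambda>x y. f x \<noteq> f y" "\<lambda>x y. {x, y} \<in> E"] by simp
    qed
    \<comment> \<open>More than \<open>T\<close> edges against a cut of at most \<open>2 * T\<close>
      ordered pairs: the missing cross pairs are outnumbered by the interior pairs, so one small
      quantity controls both.\<close>
    have "mis \<le> int" using E_eq cutT TE by linarith
    then have mis: "real mis \<le> g * (real N)\<^sup>2" using int by linarith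
    have cutlow: "2 * real T - g * (real N)\<^sup>2 \<le> cut" using E_eq TE int by linarith
    have cardE: "real (card E) \<le> T + g / 2 * (real N)\<^sup>2" using E_eq cutT int by linarith
    have parts: "(1 / m - \<gamma>) * card V \<le> card {x \<in> V. f x = p}" if "p < m" for p
    proof -
      have "(1 / m - sqrt (2 * g)) * card V \<le> card {x \<in> V. f x = p}"
        by (rule balanced_parts[OF V(1) m1 f(1) g(1) _ _ that]) (use cutlow N(5) in \<open>auto simp: cut_def T_def N_def\<close>)
      moreover have "(1 / m - \<gamma>) * card V \<le> (1 / m - sqrt (2 * g)) * card V"
        using sg by (intro mult_right_mono) auto
      ultimately show ?thesis by (rule order_trans[rotated])
    qed
    define aty where "aty = real (card {c \<in> E \<rightarrow>\<^sub>E {..<3}. \<not> typical \<xi> V f E c})"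
    have "\<xi>\<^sup>2 / 26 * (real N)\<^sup>2 \<le> \<xi>\<^sup>2 / 2 * (real N)\<^sup>2" by (intro mult_right_mono) auto
    moreover have "g * (real N)\<^sup>2 \<le> \<xi>\<^sup>2 / 26 * (real N)\<^sup>2" using g(2) by (intro mult_right_mono) auto
    ultimately have "real mis \<le> \<xi>\<^sup>2 / 2 * (real N)\<^sup>2" using mis by linarith
    then have "aty \<le> 3 * 4 ^ N * (3 ^ card E * (11 / 12) powr (\<xi>\<^sup>2 / 2 * (real N)\<^sup>2))"
      using card_atypical[OF V(1,3) \<xi>(1), of f] unfolding mis_def N_def aty_def by simp
    also have "\<dots> \<le> (1 / 2) * 3 ^ T"
      by (rule atypical_decay[OF \<xi>(1) g(2) _ N(4) cardE]) (use N(3) in simp)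
    finally have aty: "aty \<le> 1 / 2 * 3 ^ T" .
    define ntyp where "ntyp = card {c \<in> avoiding_colorings 3 k P E. typical \<xi> V f E c}"
    have Xle: "real X \<le> ntyp + aty"
    proof -
      have fin: "finite (E \<rightarrow>\<^sub>E {..<3::nat})" by (rule finite_PiE[OF fE]) simp
      have "X \<le> card ({c \<in> avoiding_colorings 3 k P E. typical \<xi> V f E c} \<union> {c \<in> E \<rightarrow>\<^sub>E {..<3}. \<not> typical \<xi> V f E c})"
        unfolding X_def c_count_def
        by (rule card_mono) (use finite_avoiding[OF fE] fin in \<open>auto simp: avoiding_colorings_def\<close>)
      also have "\<dots> \<le> ntyp + card {c \<in> E \<rightarrow>\<^sub>E {..<3}. \<not> typical \<xi> V f E c}" unfolding ntyp_def by (rule card_Un_le)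
      finally show ?thesis unfolding aty_def by linarith
    qed
    show "\<exists>W E'. W \<subseteq> V \<and> (card V = card W + 1 \<or> card V = card W + 2) \<and> E' \<subseteq> Kedges W \<and> 3 * excess V E \<le> excess W E'"
    proof (cases "\<exists>v\<in>V. \<forall>p<m. 3 * \<epsilon> * card V < card {w \<in> V. f w = p \<and> {v, w} \<in> E}")
      case True
      then obtain v where v: "v \<in> V" "\<And>p. p < m \<Longrightarrow> 3 * \<epsilon> * card V < card {w \<in> V. f w = p \<and> {v, w} \<in> E}" by blast
      define W where "W = V - {v}"
      define E' where "E' = {e \<in> E. v \<notin> e}"
      define b where "b = real (m ^ 3) * (z powr (- 3 * \<epsilon> * N) * (3 ^ N * (1 + 4 * z) ^ N * (2 / 3) powr (3 * (1 / m - \<gamma>) * N - 3)))"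
      have W: "W \<subseteq> V" "card V = card W + 1" "E' \<subseteq> Kedges W"
        using v(1) V card_Suc_Diff1[OF V(1) v(1)] unfolding W_def E'_def by (auto simp: Kedges_def)
      have "real ntyp \<le> c_count 3 k P E' * b"
        using extensions_one_vertex[OF V(1,3) f(1) \<xi> z(1,2) v parts] unfolding ntyp_def E'_def b_def N_def by simp
      then have 1: "real X \<le> c_count 3 k P E' * b + aty" using Xle by linarith
      have 2: "6 * b \<le> 3 powr ((1 - 1 / m) * (real N - 1))" unfolding b_def
        by (rule one_vertex_extension_bound[OF m_ge \<omega>_def z(1,3) \<epsilon>b(1) \<gamma>(2) _ _ Nw]) (use \<gamma>(1) N(3) in auto)
      have 3: "real (tur m (card W)) + (1 - 1 / m) * (real N - 1) \<le> T"
        using tur_step_real[OF m1, of "card W"] W(2) unfolding T_def N_def by simp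
      have "3 * excess V E \<le> excess W E'"
        using excess_step[OF 1 aty TX 2 3] unfolding excess_def X_def T_def N_def .
      then show ?thesis using W by blast
    next
      case False
      \<comment> \<open>Here the minimality of the partition is used: few neighbours in some class
        means few neighbours in the own class.\<close>
      have small: "card {w \<in> V. f w = f v \<and> {v, w} \<in> E} \<le> 3 * \<epsilon> * card V" if "v \<in> V" for v
      proof -
        obtain p where p: "p < m" "card {w \<in> V. f w = p \<and> {v, w} \<in> E} \<le> 3 * \<epsilon> * card V"
          using False \<open>v \<in> V\<close> by (auto simp: not_less)
        then show ?thesis using f(3)[OF \<open>v \<in> V\<close> p(1)] by linarith
      qed
      \<comment> \<open>The surplus of edges over \<open>T\<close> does not fit into the
        cut.\<close>
      have "int > 0" using E_eq cutT TE by linarith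
      then have "{(x, y) \<in> V \<times> V. f x = f y \<and> {x, y} \<in> E} \<noteq> {}" unfolding int_def pc_def by (metis card.empty less_irrefl)
      then obtain u v where uv: "u \<in> V" "v \<in> V" "f u = f v" "{u, v} \<in> E" by blast
      have "{u, v} \<in> Kedges V" using uv(4) V(3) by blast
      then have "u \<noteq> v" by simp
      define W where "W = V - {u, v}"
      define E' where "E' = {e \<in> E. u \<notin> e \<and> v \<notin> e}"
      define b where "b = 27 * m * (z powr (- \<epsilon> * N) * ((1 + z) ^ N *
        (3 powr (6 * \<epsilon> * N) * 9 powr ((1 - (1 / m - \<gamma>)) * N) * (8 / 9) powr ((1 / m - \<gamma>) * N))))"
      have W: "W \<subseteq> V" "card V = card W + 2" "E' \<subseteq> Kedges W"
      proof -
        show "W \<subseteq> V" by (auto simp: W_def)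
        have "card W = card V - card {u, v}" unfolding W_def by (rule card_Diff_subset) (use uv in auto)
        then show "card V = card W + 2" using \<open>u \<noteq> v\<close> N(3) unfolding N_def by simp
        show "E' \<subseteq> Kedges W" using V(3) unfolding E'_def W_def by (auto simp: Kedges_def)
      qed
      have "real ntyp \<le> c_count 3 k P E' * b"
        using extensions_two_vertices[OF V(1,3) f(1) \<xi> z(1,2) uv(1,2,4) uv(3) refl _ small[OF uv(2)] parts] small[OF uv(1)]
        unfolding ntyp_def E'_def b_def N_def uv(3) by simp
      then have 1: "real X \<le> c_count 3 k P E' * b + aty" using Xle by linarith
      have 2: "6 * b \<le> 3 powr ((1 - 1 / m) * (2 * real N - 3))" unfolding b_def
        by (rule two_vertex_extension_bound[OF m_ge \<omega>_def z \<epsilon>b _ \<gamma>(2) _ Nw]) (use \<epsilon> N(3) in auto)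
      have "real (tur m (card W)) + (1 - 1 / m) * card W \<le> tur m (Suc (card W))" by (rule tur_step_real[OF m1])
      moreover have "real (tur m (Suc (card W))) + (1 - 1 / m) * Suc (card W) \<le> tur m (Suc (Suc (card W)))" by (rule tur_step_real[OF m1])
      moreover have "Suc (Suc (card W)) = N" using W(2) by (simp add: N_def)
      moreover have "real N = real (card W) + 2" using W(2) by (simp add: N_def)
      moreover have "a + d * (2 * N' - 3) \<le> e" if "a + d * w \<le> b" "b + d * (w + 1) \<le> e" "N' = w + 2" for a b d e w N' :: real
        using that by (simp add: algebra_simps)
      ultimately have 3: "real (tur m (card W)) + (1 - 1 / m) * (2 * real N - 3) \<le> T"
        unfolding T_def by (simp add: add.commute)
      have "3 * excess V E \<le> excess W E'"
        using excess_step[OF 1 aty TX 2 3] unfolding excess_def X_def T_def N_def .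
      then show ?thesis using W by blast
    qed
  qed
qed

text \<open>The potential \<open>3 ^ card V * (excess V E)\<^sup>2\<close> never decreases along the
  deletions: at most two vertices cost 9, and tripling the excess gains 9. The descent stops below
  \<open>n0\<close>, where the potential is bounded by a constant, while at the start it is at least
  \<open>3 ^ card V\<close>.\<close>

lemma count_le_turan:
  "\<exists>N. \<forall>V E. finite V \<longrightarrow> card V \<ge> N \<longrightarrow> E \<subseteq> Kedges V \<longrightarrow> c_count 3 k P E \<le> 3 ^ tur m (card V)"
proof -
  obtain n0 where n0: "\<And>V E. finite V \<Longrightarrow> card V \<ge> n0 \<Longrightarrow> E \<subseteq> Kedges V \<Longrightarrow> excess V E > 1 \<Longrightarrow>
    (\<exists>W E'. W \<subseteq> V \<and> (card V = card W + 1 \<or> card V = card W + 2) \<and> E' \<subseteq> Kedges W \<and> 3 * excess V E \<le> excess W E')"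
    using excess_increases by blast
  \<comment> \<open>Below \<open>n0\<close> there are at most \<open>n0\<^sup>2\<close> edges, so
    the excess is at most 3 to that power, and squaring doubles the exponent.\<close>
  define D where "D = n0 + 2 * n0\<^sup>2"
  have descent: "3 ^ card V * (excess V E)\<^sup>2 \<le> 3 ^ D" if "finite V" "E \<subseteq> Kedges V" "excess V E > 1" for V E
    using that
  proof (induction "card V" arbitrary: V E rule: less_induct)
    case less
    show ?case
    proof (cases "card V \<ge> n0")
      case False
      have fE: "finite E" using less.prems finite_Kedges finite_subset by blast
      have "2 * card E \<le> card V * card V"
        using pc_edges[OF less.prems(1,2)] pc_le[OF less.prems(1,1), of "\<lambda>x y. {x, y} \<in> E"] by simp
      also have "\<dots> \<le> n0 * n0" using False by (intro mult_le_mono) auto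
      finally have cE: "2 * card E \<le> 2 * n0\<^sup>2" by (simp add: power2_eq_square)
      have "excess V E \<le> c_count 3 k P E / 1" unfolding excess_def by (intro divide_left_mono) auto
      also have "\<dots> \<le> 3 ^ card E" using of_nat_mono[OF count_le_pow[OF fE], where 'a = real] by simp
      finally have "(excess V E)\<^sup>2 \<le> (3 ^ card E)\<^sup>2" using less.prems(3) by (intro power_mono) auto
      then have "3 ^ card V * (excess V E)\<^sup>2 \<le> 3 ^ card V * (3 ^ card E)\<^sup>2" by (intro mult_left_mono) auto
      also have "\<dots> = 3 ^ (card V + card E * 2)" by (simp only: power_add power_mult)
      also have "\<dots> \<le> 3 ^ D" unfolding D_def by (intro power_increasing) (use False cE in auto)
      finally show ?thesis .
    next
      case True
      obtain W E' where W: "W \<subseteq> V" "card V = card W + 1 \<or> card V = card W + 2" "E' \<subseteq> Kedges W" "3 * excess V E \<le> excess W E'"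
        using n0[OF less.prems(1) True less.prems(2,3)] by blast
      have "excess W E' > 1" using W(4) less.prems(3) by linarith
      then have IH: "3 ^ card W * (excess W E')\<^sup>2 \<le> 3 ^ D"
        using less.hyps[of W E'] W(2,3) finite_subset[OF W(1) less.prems(1)] by auto
      have "(3 * excess V E)\<^sup>2 \<le> (excess W E')\<^sup>2" using W(4) less.prems(3) by (intro power_mono) auto
      then have sq: "9 * (excess V E)\<^sup>2 \<le> (excess W E')\<^sup>2" by (simp add: power_mult_distrib)
      have "(3::real) ^ card V \<le> 3 ^ (card W + 2)" using W(2) by (intro power_increasing) auto
      then have "3 ^ card V * (excess V E)\<^sup>2 \<le> 3 ^ (card W + 2) * (excess V E)\<^sup>2" by (intro mult_right_mono) auto
      also have "\<dots> = 3 ^ card W * (9 * (excess V E)\<^sup>2)" by (simp add: power_add)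
      also have "\<dots> \<le> 3 ^ card W * (excess W E')\<^sup>2" using sq by (intro mult_left_mono) auto
      finally show ?thesis using IH by linarith
    qed
  qed
  show ?thesis
  proof (intro exI[of _ "Suc D"] allI impI, rule ccontr)
    fix V :: "nat set" and E
    assume V: "finite V" "Suc D \<le> card V" "E \<subseteq> Kedges V" and "\<not> c_count 3 k P E \<le> 3 ^ tur m (card V)"
    then have "3 ^ tur m (card V) < c_count 3 k P E" by simp
    then have "real (3 ^ tur m (card V)) < real (c_count 3 k P E)" by (simp only: of_nat_less_iff)
    then have ex: "excess V E > 1" unfolding excess_def by (simp add: less_divide_eq)
    have "(3::real) ^ card V * 1 \<le> 3 ^ card V * (excess V E)\<^sup>2" using ex by (intro mult_left_mono) (auto simp: one_le_power)
    also have "\<dots> \<le> 3 ^ D" by (rule descent[OF V(1,3) ex])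
    finally have "card V \<le> D" by simp
    then show False using V(2) by simp
  qed
qed

text \<open>A copy would need \<open>k\<close> vertices with distinct residues modulo
  \<open>k - 1\<close>, so every colouring avoids the pattern.\<close>

lemma turan_count: "c_count 3 k P (turan_edges m n) = 3 ^ tur m n"
proof -
  have "\<not> has_pattern_copy k P (turan_edges m n) c" for c
  proof
    assume "has_pattern_copy k P (turan_edges m n) c"
    then obtain g where g: "\<And>e. e \<in> KK \<Longrightarrow> g ` e \<in> turan_edges m n" unfolding has_pattern_copy_def by blast
    have "inj_on (\<lambda>i. g i mod m) {..<k}"
    proof (rule inj_onI, rule ccontr)
      fix i j assume ij: "i \<in> {..<k}" "j \<in> {..<k}" "g i mod m = g j mod m" "i \<noteq> j"
      then have "g ` {i, j} \<in> turan_edges m n" by (intro g) simp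
      then have "{g i, g j} \<in> turan_edges m n" by simp
      then show False using ij(3) by (auto simp: turan_edges_def)
    qed
    moreover have "(\<lambda>i. g i mod m) ` {..<k} \<subseteq> {..<m}" using m_ge by auto
    ultimately have "card {..<k} \<le> card {..<m}" by (metis card_inj_on_le finite_lessThan)
    then show False using k3 by simp
  qed
  then have "avoiding_colorings 3 k P (turan_edges m n) = turan_edges m n \<rightarrow>\<^sub>E {..<3}"
    by (simp add: avoiding_colorings_def)
  then show ?thesis by (simp add: c_count_def card_PiE finite_turan)
qed

end

theorem theorem1p3:
  fixes k :: nat and P :: "nat set set set" and J :: "nat set set"
  assumes "k \<ge> 3"
    and "is_pattern k P"
    and "card P = 2"
    and "J \<in> P"
    and "ramsey_number J \<le> k"
  shows "\<exists>N. \<forall>n\<ge>N. c_count 3 k P (turan_edges (k - 1) n) = c_max 3 k P n"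
proof -
  interpret two_class_pattern k P J by unfold_locales (use assms in auto)
  obtain N where N: "\<And>V E. finite V \<Longrightarrow> card V \<ge> N \<Longrightarrow> E \<subseteq> Kedges V \<Longrightarrow> c_count 3 k P E \<le> 3 ^ tur m (card V)"
    using count_le_turan by blast
  have "c_count 3 k P (turan_edges m n) = c_max 3 k P n" if "n \<ge> N" for n
  proof -
    let ?S = "{c_count 3 k P E | E. graph_on n E}"
    have "?S = c_count 3 k P ` Pow (Kedges {..<n})" by (auto simp: graph_on_def)
    then have fin: "finite ?S" by (simp add: finite_Kedges)
    have "Max ?S = c_count 3 k P (turan_edges m n)"
    proof (rule Max_eqI[OF fin])
      fix y assume "y \<in> ?S"
      then obtain E where "y = c_count 3 k P E" "E \<subseteq> Kedges {..<n}" by (auto simp: graph_on_def)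
      then show "y \<le> c_count 3 k P (turan_edges m n)"
        using N[of "{..<n}" E] that unfolding turan_count by simp
    next
      have "graph_on n (turan_edges m n)" by (auto simp: graph_on_def turan_edges_def)
      then show "c_count 3 k P (turan_edges m n) \<in> ?S" by blast
    qed
    then show ?thesis by (simp add: c_max_def)
  qed
  then show ?thesis by blast
qed

end
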